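(* Let $D\subset\mathbb R^d$ be open, bounded and convex, and let $\lambda:D\to[0,\infty)$ be continuous, bounded and locally Lipschitz. For $s\ge1$ let $X^{(s)}$ be a Poisson point process on $sD$ with intensity function $\lambda^{(s)}(y)=\lambda(y/s)$. Let $\mathcal A$ be the directed spanning tree navigation. Then for every $0<\xi<1$, with $g(s)=s^\xi$, the following holds: there exists a function $\lambda_{\mathcal A}:D\to(0,\infty)$ such that for every $x\in D$, $$\lambda_{\mathcal A}(x)=\lim_{s\to\infty}\nu_{d-1}(I_s(x))^{-1}\,\mathbb E\,\#\Xi_s(x).$$
   Context: $\pi_1:\mathbb R^d\to\mathbb R$ is the projection to the first coordinate, $\nu_{d-1}$ is $(d-1)$-dimensional Hausdorff measure, $B^d_r(y)$ is the ball of radius $r$ around $y$. Directed spanning tree navigation: for locally finite $\varphi\subset\mathbb R^d$ and $y\in\varphi$, $\mathcal A(y,\varphi)$ is the point of $\varphi\cap((\pi_1(y),\infty)\times\mathbb R^{d-1})$ of minimal Euclidean distance to $y$ (the lexicographically smallest one in case of ties); if this set is empty, $\mathcal A(y,\varphi)=y$. $I_s(x)=B^d_{g(s)}(sx)\cap\{y\in\mathbb R^d:\pi_1(y)=\pi_1(sx)\}$ and $\Xi_s(x)=\{X_i\in X^{(s)}:[X_i,\mathcal A(X_i,X^{(s)})]\cap I_s(x)\ne\emptyset\}$, where $[a,b]$ is the line segment between $a$ and $b$.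
   Formalization: The limit function takes values in [0,∞) and is shown to be positive only at points x with λ(x)>0; as printed, positivity everywhere fails when λ vanishes (for example λ=0 gives an empty process and limit 0). *)

theory Defs
  imports "HOL-Probability.Probability" "HOL-Library.Fun_Lexorder"
begin

text \<open>
  The Hausdorff measure is normalised so that it agrees with Lebesgue measure in the top dimension.
  Covering sets are required to be bounded because \<^const>\<open>diameter\<close> carries no information on
  unbounded sets. Empty covering sets contribute nothing; this only matters for \<open>k = 0\<close>, where
  every nonempty set contributes \<open>1\<close>, so that one obtains the counting measure.
\<close>

definition hausdorff_content :: "nat \<Rightarrow> real \<Rightarrow> 'a::metric_space set \<Rightarrow> ennreal" where
  "hausdorff_content k \<delta> A =
     (INF U \<in> {U :: nat \<Rightarrow> 'a set. A \<subseteq> (\<Union>i. U i) \<and> (\<forall>i. bounded (U i) \<and> diameter (U i) \<le> \<delta>)}.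
        (\<Sum>i. if U i = {} then 0
             else ennreal (unit_ball_vol (real k) * (diameter (U i) / 2) ^ k)))"

definition hausdorff_measure :: "nat \<Rightarrow> 'a::metric_space set \<Rightarrow> ennreal" where
  "hausdorff_measure k A = (SUP \<delta> \<in> {0<..}. hausdorff_content k \<delta> A)"

definition locally_finite_set :: "'a::metric_space set \<Rightarrow> bool" where
  "locally_finite_set \<phi> \<longleftrightarrow> (\<forall>B. bounded B \<longrightarrow> finite (\<phi> \<inter> B))"

definition intensity_measure :: "'a::euclidean_space set \<Rightarrow> ('a \<Rightarrow> real) \<Rightarrow> 'a set \<Rightarrow> ennreal" where
  "intensity_measure U f B = (\<integral>\<^sup>+ y \<in> U \<inter> B. ennreal (f y) \<partial>lborel)"

text \<open>
  \<open>X\<close> is a Poisson point process on \<open>U\<close> with intensity function \<open>f\<close>. Since the intensity measure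
  has no atoms, the process is simple and can be identified with a random locally finite set.
  The Poisson weights are written out because \<^const>\<open>poisson_pmf\<close> excludes rate \<open>0\<close>
  (here \<open>0 ^ 0 = 1\<close>, so rate \<open>0\<close> gives the point mass at \<open>0\<close>).
\<close>

definition poisson_process ::
    "'w measure \<Rightarrow> 'a::euclidean_space set \<Rightarrow> ('a \<Rightarrow> real) \<Rightarrow> ('w \<Rightarrow> 'a set) \<Rightarrow> bool" where
  "poisson_process M U f X \<longleftrightarrow>
     prob_space M \<and>
     (\<forall>\<omega> \<in> space M. X \<omega> \<subseteq> U \<and> locally_finite_set (X \<omega>)) \<and>
     (\<forall>B \<in> sets borel. bounded B \<longrightarrow>
        (\<lambda>\<omega>. card (X \<omega> \<inter> B)) \<in> measurable M (count_space UNIV) \<and>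
        intensity_measure U f B < \<infinity> \<and>
        (\<forall>k. measure M {\<omega> \<in> space M. card (X \<omega> \<inter> B) = k} =
               enn2real (intensity_measure U f B) ^ k / fact k
                 * exp (- enn2real (intensity_measure U f B)))) \<and>
     (\<forall>n (B :: nat \<Rightarrow> 'a set).
        (\<forall>i<n. B i \<in> sets borel \<and> bounded (B i)) \<and> disjoint_family_on B {..<n} \<longrightarrow>
        prob_space.indep_vars M (\<lambda>_. count_space UNIV) (\<lambda>i \<omega>. card (X \<omega> \<inter> B i)) {..<n})"

text \<open>
  Euclidean space of dimension \<open>CARD('d)\<close> is \<open>real ^ 'd\<close>; the linear order on the index type
  singles out the first coordinate and determines the lexicographic order of points.
\<close>

definition proj1 :: "real ^ 'd::{finite,linorder} \<Rightarrow> real" where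
  "proj1 y = y $ Min UNIV"

definition points_ahead ::
    "real ^ 'd::{finite,linorder} \<Rightarrow> (real ^ 'd::{finite,linorder}) set \<Rightarrow> (real ^ 'd::{finite,linorder}) set" where
  "points_ahead y \<phi> = {z \<in> \<phi>. proj1 y < proj1 z}"

definition dst_nav :: "real ^ 'd::{finite,linorder} \<Rightarrow> (real ^ 'd::{finite,linorder}) set \<Rightarrow> real ^ 'd::{finite,linorder}" where
  "dst_nav y \<phi> =
     (if points_ahead y \<phi> = {} then y
      else THE z. z \<in> points_ahead y \<phi> \<and>
             (\<forall>w \<in> points_ahead y \<phi>. dist y z \<le> dist y w) \<and>
             (\<forall>w \<in> points_ahead y \<phi>. dist y w = dist y z \<longrightarrow>
                w = z \<or> less_fun (vec_nth z) (vec_nth w)))"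

definition cross_section ::
    "(real \<Rightarrow> real) \<Rightarrow> real \<Rightarrow> real ^ 'd::{finite,linorder} \<Rightarrow> (real ^ 'd::{finite,linorder}) set" where
  "cross_section g s x = cball (s *\<^sub>R x) (g s) \<inter> {y. proj1 y = proj1 (s *\<^sub>R x)}"

definition crossing_points ::
    "(real \<Rightarrow> real) \<Rightarrow> real \<Rightarrow> real ^ 'd::{finite,linorder} \<Rightarrow> (real ^ 'd::{finite,linorder}) set \<Rightarrow> (real ^ 'd::{finite,linorder}) set" where
  "crossing_points g s x \<phi> =
     {y \<in> \<phi>. closed_segment y (dst_nav y \<phi>) \<inter> cross_section g s x \<noteq> {}}"

end

theory Submission
  imports Defs "HOL-Real_Asymp.Real_Asymp"
begin

text \<open>
  Edges longer than \<open>R\<close> are negligible by packing: two starting points of edges longer than \<open>r\<close>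
  are at distance at least \<open>r\<close> unless their first coordinates agree, which almost surely never
  happens. Summing over dyadic lengths, the edges longer than \<open>R\<close> that meet a cross-section of
  radius \<open>g\<close> number \<open>O(g\<^sup>d\<^sup>-\<^sup>1 (1 / R + log s / g))\<close> for \<open>d \<ge> 2\<close>.

  The edges of length at most \<open>R\<close> only see the process close to \<open>s x\<close>, where the intensity is
  nearly the constant \<open>c = lam x\<close>. Since \<open>(y, z)\<close> is an edge iff no point of the process is preferred to
  \<open>z\<close>, the Mecke formula turns their expected number into a double integral, which is asymptotically
  proportional to \<open>g\<^sup>d\<^sup>-\<^sup>1 c\<^sup>2 \<integral> v\<^sub>1 exp (- c m(v)) dv\<close> over \<open>v\<^sub>1 > 0\<close>, \<open>|v| \<le> R\<close>, with
  \<open>m(v)\<close> the volume of the half ball preferred to \<open>v\<close>. In particular the limit is \<open>0\<close>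
  where \<open>lam x = 0\<close>. Only the scaling of the Hausdorff measure of the cross-section matters, and that
  it is positive and finite.

  For \<open>d = 1\<close> exactly one edge crosses \<open>s x\<close> as soon as there are points on both sides.
\<close>

section \<open>Configurations\<close>

text \<open>The definition of the process supplies only the laws and the independence of counts,
  while the navigation selects one point by looking at the whole configuration. The bridge is a
  class of functionals that involves no selection: numbers of ordered pairs of points with a void
  region attached to each pair. Both their measurability and their mean, by two applications of the
  Mecke formula, can be derived from void events.

  The packing bound is deterministic and blind to the intensity. Its price is a residue of order
  \<open>1 / R\<close> that does not disappear as \<open>s\<close> grows: for fixed \<open>R\<close>
  the ratio is pinned down only up to a constant over \<open>R\<close>, and the limit is obtained as
  a supremum over \<open>R\<close>. On the line packing gives no gain, since every dyadic scale
  contributes the same constant, which is why dimension one is computed exactly instead.\<close>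

text \<open>Void events suffice as generators: a countable base separates the points of a finite set, so
  counts are measurable as well.\<close>

definition conf :: "'a::{second_countable_topology,t2_space} set measure" where
  "conf = sigma {\<phi>. finite \<phi>} {{\<phi>. finite \<phi> \<and> \<phi> \<inter> B = {}} |B. B \<in> sets borel}"

lemma space_conf [simp]: "space conf = {\<phi>. finite \<phi>}"
  unfolding conf_def by (rule space_measure_of) auto

lemma sets_conf: "sets conf = sigma_sets {\<phi>. finite \<phi>} {{\<phi>. finite \<phi> \<and> \<phi> \<inter> B = {}} |B. B \<in> sets borel}"
  unfolding conf_def by (rule sets_measure_of) auto

lemma void_in_sets_conf: "B \<in> sets borel \<Longrightarrow> {\<phi>. finite \<phi> \<and> \<phi> \<inter> B = {}} \<in> sets conf"
  unfolding sets_conf by (intro sigma_sets.Basic) blast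

lemma measurable_confI:
  assumes "\<And>p. p \<in> space P \<Longrightarrow> finite (K p)"
    and "\<And>B. B \<in> sets borel \<Longrightarrow> {p \<in> space P. K p \<inter> B = {}} \<in> sets P"
  shows "K \<in> measurable P conf"
  unfolding conf_def
proof (rule measurable_measure_of)
  show "K \<in> space P \<rightarrow> {\<phi>. finite \<phi>}" using assms(1) by auto
  fix y :: "'b set set" assume "y \<in> {{\<phi>. finite \<phi> \<and> \<phi> \<inter> B = {}} |B. B \<in> sets borel}"
  then obtain B where B: "B \<in> sets borel" "y = {\<phi>. finite \<phi> \<and> \<phi> \<inter> B = {}}" by auto
  have "K -` y \<inter> space P = {p \<in> space P. K p \<inter> B = {}}" using assms(1) B(2) by auto
  then show "K -` y \<inter> space P \<in> sets P" using assms(2)[OF B(1)] by simp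
qed auto

text \<open>A finite set without one of its points is closed, so some basic set contains that point
  alone. In the converse direction \<open>V\<close> need not isolate anything: one point inside
  \<open>V\<close> and \<open>k\<close> points outside already suffice. Since \<open>B\<close>
  shrinks to \<open>B - V\<close>, an induction on \<open>k\<close> has to keep \<open>B\<close>
  arbitrary.\<close>

lemma card_ge_Suc_iff_separated:
  fixes \<phi> :: "'a::t2_space set"
  assumes "topological_basis \<B>" "finite \<phi>"
  shows "Suc k \<le> card (\<phi> \<inter> B) \<longleftrightarrow> (\<exists>V\<in>\<B>. \<phi> \<inter> (B \<inter> V) \<noteq> {} \<and> k \<le> card (\<phi> \<inter> (B - V)))"
proof
  assume *: "Suc k \<le> card (\<phi> \<inter> B)"
  then have "\<phi> \<inter> B \<noteq> {}" by auto
  then obtain y where y: "y \<in> \<phi> \<inter> B" by blast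
  have "open (- (\<phi> - {y}))" using assms(2) by (intro open_Compl finite_imp_closed) auto
  then obtain V where V: "V \<in> \<B>" "y \<in> V" "V \<subseteq> - (\<phi> - {y})"
    using topological_basisE[OF assms(1)] by (metis ComplI DiffD2 insertI1)
  have "\<phi> \<inter> (B - V) = \<phi> \<inter> B - {y}" using V y by auto
  then have "card (\<phi> \<inter> (B - V)) = card (\<phi> \<inter> B) - 1" using y assms(2) by simp
  then show "\<exists>V\<in>\<B>. \<phi> \<inter> (B \<inter> V) \<noteq> {} \<and> k \<le> card (\<phi> \<inter> (B - V))" using * V(1,2) y
    by (intro bexI[of _ V]) auto
next
  assume "\<exists>V\<in>\<B>. \<phi> \<inter> (B \<inter> V) \<noteq> {} \<and> k \<le> card (\<phi> \<inter> (B - V))"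
  then obtain V where V: "\<phi> \<inter> (B \<inter> V) \<noteq> {}" "k \<le> card (\<phi> \<inter> (B - V))" by auto
  have "card (\<phi> \<inter> B) = card (\<phi> \<inter> (B \<inter> V)) + card (\<phi> \<inter> (B - V))"
    using assms(2) by (subst card_Un_disjoint[symmetric]) (auto intro!: arg_cong[where f=card])
  moreover have "card (\<phi> \<inter> (B \<inter> V)) > 0" using V(1) assms(2) by (simp add: card_gt_0_iff)
  ultimately show "Suc k \<le> card (\<phi> \<inter> B)" using V(2) by linarith
qed

lemma card_ge_in_sets_conf:
  fixes B :: "'a::{second_countable_topology,t2_space} set"
  shows "B \<in> sets borel \<Longrightarrow> {\<phi>. finite \<phi> \<and> k \<le> card (\<phi> \<inter> B)} \<in> sets conf"
proof (induction k arbitrary: B)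
  case 0
  have "{\<phi>. finite \<phi> \<and> 0 \<le> card (\<phi> \<inter> B)} = space conf" by auto
  then show ?case by (metis sets.top)
next
  case (Suc k)
  obtain \<B> :: "'a set set" where \<B>: "countable \<B>" "topological_basis \<B>"
    using ex_countable_basis by blast
  have V: "V \<in> sets borel" if "V \<in> \<B>" for V
    using topological_basis_open[OF \<B>(2) that] by simp
  have eq: "{\<phi>. finite \<phi> \<and> Suc k \<le> card (\<phi> \<inter> B)} =
    (\<Union>V\<in>\<B>. {\<phi>. finite \<phi> \<and> k \<le> card (\<phi> \<inter> (B - V))} - {\<phi>. finite \<phi> \<and> \<phi> \<inter> (B \<inter> V) = {}})"
    (is "?L = ?R")
  proof (rule set_eqI)
    fix \<phi> :: "'a set"
    show "\<phi> \<in> ?L \<longleftrightarrow> \<phi> \<in> ?R"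
    proof (cases "finite \<phi>")
      case True
      then show ?thesis
        by (simp only: card_ge_Suc_iff_separated[OF \<B>(2)] mem_Collect_eq UN_iff Diff_iff simp_thms)
          (intro bex_cong refl conj_commute)
    qed simp
  qed
  show ?case unfolding eq using Suc V
    by (intro sets.countable_UN' \<B> image_subsetI sets.Diff void_in_sets_conf Suc.IH sets.Int) auto
qed

lemma measurable_card_conf:
  assumes "B \<in> sets borel"
  shows "(\<lambda>\<phi>. card (\<phi> \<inter> B)) \<in> measurable conf (count_space UNIV)"
proof (subst measurable_count_space_eq2_countable, intro conjI ballI)
  fix k
  have "(\<lambda>\<phi>. card (\<phi> \<inter> B)) -` {k} \<inter> space conf =
     {\<phi>. finite \<phi> \<and> k \<le> card (\<phi> \<inter> B)} - {\<phi>. finite \<phi> \<and> Suc k \<le> card (\<phi> \<inter> B)}" by auto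
  then show "(\<lambda>\<phi>. card (\<phi> \<inter> B)) -` {k} \<inter> space conf \<in> sets conf"
    by (simp only: sets.Diff[OF card_ge_in_sets_conf[OF assms] card_ge_in_sets_conf[OF assms]])
qed auto

text \<open>A sum over a finite set is the cardinality times the mean under the uniform
  distribution. That distribution is a measurable kernel, because its values are ratios of counts,
  so measurability of kernel integrals applies and no measurable enumeration of the points has to be
  constructed.\<close>

lemma borel_measurable_sum_conf:
  fixes f :: "'p \<Rightarrow> 'a::{second_countable_topology,t2_space} \<Rightarrow> ennreal"
  assumes K: "K \<in> measurable P conf"
    and f: "case_prod f \<in> borel_measurable (P \<Otimes>\<^sub>M borel)"
  shows "(\<lambda>p. \<Sum>y\<in>K p. f p y) \<in> borel_measurable P"
proof -
  \<comment> \<open>The uniform distribution on the empty set has no meaning, hence the null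
    measure; the factor \<open>card (K p)\<close> makes this choice harmless.\<close>
  define L where "L = (\<lambda>p. if K p = {} then null_measure borel
    else distr (measure_pmf (pmf_of_set (K p))) borel (\<lambda>y. y))"
  have fin: "finite (K p)" if "p \<in> space P" for p
    using measurable_space[OF K that] by simp
  have [measurable]: "(\<lambda>p. card (K p \<inter> B)) \<in> measurable P (count_space UNIV)" if "B \<in> sets borel" for B
    using measurable_compose[OF K measurable_card_conf[OF that]] .
  have cm[measurable]: "(\<lambda>p. card (K p)) \<in> measurable P (count_space UNIV)"
    using \<open>UNIV \<in> sets borel \<Longrightarrow> _\<close> by simp
  have L: "L \<in> measurable P (subprob_algebra borel)"
  proof (rule measurable_subprob_algebra)
    fix p assume p: "p \<in> space P"
    show "subprob_space (L p)" unfolding L_def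
      by (auto intro!: measure_pmf.subprob_space_distr intro: subprob_spaceI)
    show "sets (L p) = sets borel" unfolding L_def by simp
  next
    fix A :: "'a set" assume A: "A \<in> sets borel"
    \<comment> \<open>For empty \<open>K p\<close> the quotient is \<open>0 / 0 = 0\<close>, in
      agreement with the null measure.\<close>
    have "emeasure (L p) A = ennreal (real (card (K p \<inter> A)) / real (card (K p)))"
      if p: "p \<in> space P" for p
      unfolding L_def using fin[OF p] A
      by (auto simp: emeasure_distr emeasure_pmf_of_set)
    moreover have "(\<lambda>p. ennreal (real (card (K p \<inter> A)) / real (card (K p)))) \<in> borel_measurable P"
      using A by measurable
    ultimately show "(\<lambda>p. emeasure (L p) A) \<in> borel_measurable P"
      by (simp cong: measurable_cong)
  qed
  have "(\<Sum>y\<in>K p. f p y) = ennreal (real (card (K p))) * (\<integral>\<^sup>+ y. f p y \<partial>L p)" if p: "p \<in> space P" for p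
  proof (cases "K p = {}")
    case False
    have m: "f p \<in> borel_measurable borel"
      using measurable_compose[OF measurable_Pair1'[OF p] f] by simp
    have "(\<integral>\<^sup>+ y. f p y \<partial>L p) = sum (f p) (K p) / card (K p)"
      unfolding L_def using False m fin[OF p] by (simp add: nn_integral_distr nn_integral_pmf_of_set)
    moreover have "card (K p) > 0" using False fin[OF p] by (simp add: card_gt_0_iff)
    moreover have "a = ennreal (real n) * (a / ennreal (real n))" if "n > 0" for a n
      using that by (metis ennreal_eq_0_iff ennreal_mult_divide_eq ennreal_neq_top ennreal_times_divide
          mult.commute not_less of_nat_0_less_iff)
    ultimately show ?thesis by (simp add: ennreal_of_nat_eq_real_of_nat)
  qed simp
  moreover have "(\<lambda>p. ennreal (real (card (K p))) * (\<integral>\<^sup>+ y. f p y \<partial>L p)) \<in> borel_measurable P"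
    using nn_integral_measurable_subprob_algebra2[OF f L] by measurable
  ultimately show ?thesis by (simp cong: measurable_cong)
qed

section \<open>Poisson processes on bounded domains\<close>

text \<open>The mean is read off from the series itself, so that rate \<open>0\<close> is
  covered.\<close>

lemma (in prob_space) nn_integral_poisson_count:
  assumes K: "K \<in> measurable M (count_space UNIV)" and m: "0 \<le> m"
    and p: "\<And>k. prob {\<omega> \<in> space M. K \<omega> = k} = m ^ k / fact k * exp (- m)"
  shows "(\<integral>\<^sup>+ \<omega>. ennreal (real (K \<omega>)) \<partial>M) = ennreal m"
proof -
  note K[measurable]
  have sets: "{\<omega> \<in> space M. K \<omega> = k} \<in> sets M" for k
    by measurable
  have "(\<Sum>k. ennreal (real k) * indicator {\<omega> \<in> space M. K \<omega> = k} \<omega>) = ennreal (real (K \<omega>))"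
    if "\<omega> \<in> space M" for \<omega>
    using that by (subst suminf_finite[of "{K \<omega>}"]) auto
  then have "(\<integral>\<^sup>+ \<omega>. ennreal (real (K \<omega>)) \<partial>M) =
      (\<integral>\<^sup>+ \<omega>. (\<Sum>k. ennreal (real k) * indicator {\<omega> \<in> space M. K \<omega> = k} \<omega>) \<partial>M)"
    by (intro nn_integral_cong) simp
  also have "\<dots> = (\<Sum>k. \<integral>\<^sup>+ \<omega>. ennreal (real k) * indicator {\<omega> \<in> space M. K \<omega> = k} \<omega> \<partial>M)"
    using sets by (intro nn_integral_suminf) measurable
  also have "\<dots> = (\<Sum>k. ennreal (real k * (m ^ k / fact k * exp (- m))))"
    using sets m by (intro suminf_cong)
      (simp add: nn_integral_cmult_indicator emeasure_eq_measure p ennreal_mult[symmetric])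
  also have "\<dots> = ennreal m"
  proof (rule suminf_ennreal_eq)
    \<comment> \<open>The term for \<open>k = 0\<close> vanishes, and an index shift turns the
      remaining series into \<open>m * exp (- m)\<close> times the exponential series.\<close>
    have "(\<lambda>k. m * exp (- m) * (m ^ k /\<^sub>R fact k)) sums (m * exp (- m) * exp m)"
      by (intro sums_mult exp_converges)
    also have "m * exp (- m) * exp m = m" by (simp add: exp_minus)
    also have "(\<lambda>k. m * exp (- m) * (m ^ k /\<^sub>R fact k)) =
        (\<lambda>k. real (Suc k) * (m ^ Suc k / fact (Suc k) * exp (- m)))"
      by (intro ext) (simp add: field_simps del: of_nat_Suc)
    finally show "(\<lambda>k. real k * (m ^ k / fact k * exp (- m))) sums m"
      by (subst (asm) sums_Suc_iff) simp
  qed (use m in auto)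
  finally show ?thesis .
qed

text \<open>Needed because the counts of a set and of its truncation agree only for outcomes in
  \<open>space M\<close>, where the process is known to stay in its domain.\<close>

lemma (in prob_space) indep_vars_cong_on_space:
  assumes "indep_vars N Y I" "\<And>i \<omega>. i \<in> I \<Longrightarrow> \<omega> \<in> space M \<Longrightarrow> Y i \<omega> = Z i \<omega>"
  shows "indep_vars N Z I"
proof -
  have "Y i -` A \<inter> space M = Z i -` A \<inter> space M" if "i \<in> I" for i A
    using assms(2)[OF that] by auto
  then have "indep_sets (\<lambda>i. {Z i -` A \<inter> space M |A. A \<in> sets (N i)}) I"
    using assms(1) unfolding indep_vars_def2 by (simp cong: indep_sets_cong)
  moreover have "random_variable (N i) (Z i)" if "i \<in> I" for i
  proof -
    have "random_variable (N i) (Y i)" using assms(1) that by (simp add: indep_vars_def2)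
    then show ?thesis by (rule measurable_cong[THEN iffD1, rotated]) (rule assms(2)[OF that])
  qed
  ultimately show ?thesis unfolding indep_vars_def2 by auto
qed

locale bounded_poisson_process =
  fixes M :: "'w measure" and U :: "'a::euclidean_space set" and f :: "'a \<Rightarrow> real" and X :: "'w \<Rightarrow> 'a set"
  assumes process: "poisson_process M U f X"
    and bounded_domain: "bounded U"
    and domain_borel: "U \<in> sets borel"
    and density_borel: "(\<lambda>y. ennreal (f y) * indicator U y) \<in> borel_measurable borel"
begin

sublocale prob_space M
  using process by (simp add: poisson_process_def)

definition intensity :: "'a measure" where
  "intensity = density lborel (\<lambda>y. ennreal (f y) * indicator U y)"

lemma sets_intensity [simp, measurable_cong]: "sets intensity = sets borel"
  by (simp add: intensity_def)

lemma space_intensity [simp]: "space intensity = UNIV"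
  by (simp add: intensity_def)

lemma emeasure_intensity: "B \<in> sets borel \<Longrightarrow> emeasure intensity B = intensity_measure U f B"
  using density_borel unfolding intensity_def intensity_measure_def
  by (subst emeasure_density) (auto intro!: nn_integral_cong split: split_indicator)

lemma nn_integral_intensity:
  "h \<in> borel_measurable borel \<Longrightarrow>
    (\<integral>\<^sup>+ y. h y \<partial>intensity) = (\<integral>\<^sup>+ y. ennreal (f y) * indicator U y * h y \<partial>lborel)"
  using density_borel unfolding intensity_def by (subst nn_integral_density) auto

lemma domain_subset_cball: obtains r where "U \<subseteq> cball 0 r"
  using bounded_domain that unfolding bounded_iff by (auto simp: subset_iff)

lemma emeasure_intensity_Int: "U \<subseteq> V \<Longrightarrow> V \<in> sets borel \<Longrightarrow> B \<in> sets borel \<Longrightarrow>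
    emeasure intensity (B \<inter> V) = emeasure intensity B"
  by (subst (1 2) emeasure_intensity)
    (auto simp: intensity_measure_def intro!: nn_integral_cong split: split_indicator)

text \<open>The defining properties concern bounded Borel sets. With a ball that contains the
  domain, truncation alters neither the counts nor the intensity, and the properties pass to all
  Borel sets.\<close>

lemma process_truncated:
  assumes "B \<in> sets borel"
  shows "(\<lambda>\<omega>. card (X \<omega> \<inter> (B \<inter> cball 0 r))) \<in> measurable M (count_space UNIV)" (is ?count)
    and "intensity_measure U f (B \<inter> cball 0 r) < \<infinity>" (is ?fin)
    and "prob {\<omega> \<in> space M. card (X \<omega> \<inter> (B \<inter> cball 0 r)) = k} =
      enn2real (intensity_measure U f (B \<inter> cball 0 r)) ^ k / fact k *
        exp (- enn2real (intensity_measure U f (B \<inter> cball 0 r)))" (is ?prob)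
proof -
  have "B \<inter> cball 0 r \<in> sets borel" "bounded (B \<inter> cball 0 r)"
    using assms by (auto intro: bounded_subset[OF bounded_cball])
  note this process[unfolded poisson_process_def]
  then show ?count and ?fin and ?prob by blast+
qed

lemma emeasure_intensity_finite: "B \<in> sets borel \<Longrightarrow> emeasure intensity B < \<infinity>"
proof -
  assume B: "B \<in> sets borel"
  obtain r where r: "U \<subseteq> cball 0 r" by (rule domain_subset_cball)
  have "intensity_measure U f (B \<inter> cball 0 r) < \<infinity>"
    by (intro process_truncated B)
  then show ?thesis using B emeasure_intensity_Int[OF r, of B]
    by (subst (asm) emeasure_intensity[symmetric]) auto
qed

sublocale intensity: finite_measure intensity
  using emeasure_intensity_finite[of UNIV] by (intro finite_measureI) auto

lemma X_subset: "\<omega> \<in> space M \<Longrightarrow> X \<omega> \<subseteq> U"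
  using process by (auto simp: poisson_process_def)

lemma finite_X: "\<omega> \<in> space M \<Longrightarrow> finite (X \<omega>)"
proof -
  assume w: "\<omega> \<in> space M"
  then have "X \<omega> \<inter> U = X \<omega>" "locally_finite_set (X \<omega>)"
    using process by (auto simp: poisson_process_def)
  then show ?thesis using bounded_domain unfolding locally_finite_set_def by metis
qed

lemma count_truncate:
  assumes "U \<subseteq> V" "\<omega> \<in> space M"
  shows "X \<omega> \<inter> (B \<inter> V) = X \<omega> \<inter> B"
  using X_subset[OF assms(2)] assms(1) by auto

lemma measurable_count: "B \<in> sets borel \<Longrightarrow> (\<lambda>\<omega>. card (X \<omega> \<inter> B)) \<in> measurable M (count_space UNIV)"
proof -
  assume B: "B \<in> sets borel"
  obtain r where r: "U \<subseteq> cball 0 r" by (rule domain_subset_cball)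
  have "(\<lambda>\<omega>. card (X \<omega> \<inter> (B \<inter> cball 0 r))) \<in> measurable M (count_space UNIV)"
    by (intro process_truncated B)
  then show ?thesis by (simp add: count_truncate[OF r] cong: measurable_cong)
qed

lemma prob_count: "B \<in> sets borel \<Longrightarrow>
  prob {\<omega> \<in> space M. card (X \<omega> \<inter> B) = k} =
    measure intensity B ^ k / fact k * exp (- measure intensity B)"
proof -
  assume B: "B \<in> sets borel"
  obtain r where r: "U \<subseteq> cball 0 r" by (rule domain_subset_cball)
  let ?B = "B \<inter> cball 0 r"
  have m: "enn2real (intensity_measure U f ?B) = measure intensity B"
    using B emeasure_intensity_Int[OF r, of B] by (simp add: measure_def emeasure_intensity[symmetric])
  have "prob {\<omega> \<in> space M. card (X \<omega> \<inter> ?B) = k} =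
       enn2real (intensity_measure U f ?B) ^ k / fact k * exp (- enn2real (intensity_measure U f ?B))"
    by (intro process_truncated B)
  also have "{\<omega> \<in> space M. card (X \<omega> \<inter> ?B) = k} = {\<omega> \<in> space M. card (X \<omega> \<inter> B) = k}"
    by (auto simp: count_truncate[OF r])
  finally show ?thesis unfolding m .
qed

lemma measurable_X [measurable]: "X \<in> measurable M conf"
proof (rule measurable_confI)
  fix B :: "'a set" assume B: "B \<in> sets borel"
  have "{\<omega> \<in> space M. X \<omega> \<inter> B = {}} = {\<omega> \<in> space M. card (X \<omega> \<inter> B) = 0}"
    by (auto simp: finite_X)
  then show "{\<omega> \<in> space M. X \<omega> \<inter> B = {}} \<in> sets M"
    using measurable_count[OF B] by simp
qed (rule finite_X)

lemma sets_void: "B \<in> sets borel \<Longrightarrow> {\<omega> \<in> space M. X \<omega> \<inter> B = {}} \<in> sets M"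
  using measurable_sets[OF measurable_X void_in_sets_conf]
  by (rule back_subst[of "\<lambda>A. A \<in> sets M"]) (auto simp: finite_X)

lemma prob_void: "B \<in> sets borel \<Longrightarrow>
  prob {\<omega> \<in> space M. X \<omega> \<inter> B = {}} = exp (- measure intensity B)"
proof -
  assume B: "B \<in> sets borel"
  have "{\<omega> \<in> space M. X \<omega> \<inter> B = {}} = {\<omega> \<in> space M. card (X \<omega> \<inter> B) = 0}"
    by (auto simp: finite_X)
  then show ?thesis using prob_count[OF B, of 0] by simp
qed

lemma indep_counts:
  assumes "A \<in> sets borel" "B \<in> sets borel" "A \<inter> B = {}"
  shows "indep_vars (\<lambda>_. count_space UNIV) (\<lambda>i \<omega>. card (X \<omega> \<inter> (if i = 0 then A else B))) {..<2::nat}"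
proof -
  obtain r where r: "U \<subseteq> cball 0 r" by (rule domain_subset_cball)
  define C where "C = (\<lambda>i::nat. (if i = 0 then A else B) \<inter> cball 0 r)"
  have "(\<forall>i<2. C i \<in> sets borel \<and> bounded (C i)) \<and> disjoint_family_on C {..<2}"
    using assms unfolding C_def disjoint_family_on_def
    by (auto intro: bounded_subset[OF bounded_cball])
  then have "indep_vars (\<lambda>_. count_space UNIV) (\<lambda>i \<omega>. card (X \<omega> \<inter> C i)) {..<2::nat}"
    using process unfolding poisson_process_def by blast
  then show ?thesis
    by (rule indep_vars_cong_on_space) (simp add: C_def count_truncate[OF r])
qed

text \<open>On the void event of \<open>B\<close> the points in \<open>A\<close> all lie in
  \<open>A - B\<close>. This set is disjoint from \<open>B\<close>, so the expectation factorises
  into a Poisson mean and a void probability.\<close>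

lemma nn_integral_count_void:
  assumes A: "A \<in> sets borel" and B: "B \<in> sets borel"
  shows "(\<integral>\<^sup>+ \<omega>. of_nat (card (X \<omega> \<inter> A)) * of_bool (X \<omega> \<inter> B = {}) \<partial>M) =
    emeasure intensity (A - B) * ennreal (exp (- measure intensity B))"
proof -
  let ?C = "\<lambda>i::nat. if i = 0 then A - B else B"
  define Y :: "nat \<Rightarrow> nat \<Rightarrow> ennreal" where
    "Y = (\<lambda>i n. if i = 0 then ennreal (real n) else of_bool (n = 0))"
  have AB: "A - B \<in> sets borel" using A B by simp
  have ind: "indep_vars (\<lambda>_. borel) (\<lambda>i \<omega>. Y i (card (X \<omega> \<inter> ?C i))) {..<2::nat}"
    using indep_counts[OF AB B] by (rule indep_vars_compose2) auto
  have "(\<integral>\<^sup>+ \<omega>. of_nat (card (X \<omega> \<inter> A)) * of_bool (X \<omega> \<inter> B = {}) \<partial>M) =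
     (\<integral>\<^sup>+ \<omega>. (\<Prod>i<2. Y i (card (X \<omega> \<inter> ?C i))) \<partial>M)"
  proof (intro nn_integral_cong)
    fix \<omega> assume w: "\<omega> \<in> space M"
    have "X \<omega> \<inter> A = X \<omega> \<inter> (A - B)" if "X \<omega> \<inter> B = {}" using that by auto
    then show "of_nat (card (X \<omega> \<inter> A)) * of_bool (X \<omega> \<inter> B = {}) =
        (\<Prod>i<2. Y i (card (X \<omega> \<inter> ?C i)))"
      using finite_X[OF w] by (auto simp: Y_def numeral_2_eq_2 ennreal_of_nat_eq_real_of_nat)
  qed
  also have "\<dots> = (\<Prod>i<2. \<integral>\<^sup>+ \<omega>. Y i (card (X \<omega> \<inter> ?C i)) \<partial>M)"
    by (intro indep_vars_nn_integral ind) auto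
  also have "\<dots> = (\<integral>\<^sup>+ \<omega>. ennreal (real (card (X \<omega> \<inter> (A - B)))) \<partial>M) *
      (\<integral>\<^sup>+ \<omega>. of_bool (card (X \<omega> \<inter> B) = 0) \<partial>M)"
    by (simp add: Y_def numeral_2_eq_2)
  also have "(\<integral>\<^sup>+ \<omega>. ennreal (real (card (X \<omega> \<inter> (A - B)))) \<partial>M) = ennreal (measure intensity (A - B))"
    using prob_count[OF AB] by (intro nn_integral_poisson_count measurable_count AB) auto
  also have "(\<integral>\<^sup>+ \<omega>. of_bool (card (X \<omega> \<inter> B) = 0) \<partial>M) =
      (\<integral>\<^sup>+ \<omega>. indicator {\<omega> \<in> space M. X \<omega> \<inter> B = {}} \<omega> \<partial>M)"
    by (intro nn_integral_cong) (auto simp: finite_X split: split_indicator)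
  also have "\<dots> = ennreal (exp (- measure intensity B))"
    using sets_void[OF B] prob_void[OF B] by (simp add: emeasure_eq_measure)
  finally show ?thesis by (simp add: intensity.emeasure_eq_measure)
qed

end

section \<open>The Mecke formula\<close>

context bounded_poisson_process
begin

text \<open>After insertion of \<open>y\<close>, the set \<open>B\<close> is void iff
  \<open>y\<close> avoids \<open>B\<close> and \<open>X\<close> does; the preimage of a generator is
  therefore a rectangle.\<close>

lemma measurable_insert_X:
  "(\<lambda>(y, \<omega>). insert y (X \<omega>)) \<in> measurable (borel \<Otimes>\<^sub>M M) conf"
proof (rule measurable_confI)
  fix B :: "'a set" assume B: "B \<in> sets borel"
  have "{p \<in> space (borel \<Otimes>\<^sub>M M). (case p of (y, \<omega>) \<Rightarrow> insert y (X \<omega>)) \<inter> B = {}} =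
    (- B) \<times> {\<omega> \<in> space M. X \<omega> \<inter> B = {}}"
    by (auto simp: space_pair_measure)
  then show "{p \<in> space (borel \<Otimes>\<^sub>M M). (case p of (y, \<omega>) \<Rightarrow> insert y (X \<omega>)) \<inter> B = {}}
      \<in> sets (borel \<Otimes>\<^sub>M M)"
    using B sets_void[OF B] by simp
qed (auto simp: space_pair_measure finite_X)

lemma measurable_mecke:
  assumes F: "case_prod F \<in> borel_measurable (conf \<Otimes>\<^sub>M borel)"
  shows "(\<lambda>\<omega>. \<Sum>y\<in>X \<omega>. F (X \<omega>) y) \<in> borel_measurable M"
    and "(\<lambda>(y, \<omega>). F (insert y (X \<omega>)) y) \<in> borel_measurable (borel \<Otimes>\<^sub>M M)"
    and "(\<lambda>\<omega>. F (insert y (X \<omega>)) y) \<in> borel_measurable M"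
    and "(\<lambda>y. \<integral>\<^sup>+ \<omega>. F (insert y (X \<omega>)) y \<partial>M) \<in> borel_measurable borel"
proof -
  have "(\<lambda>(\<omega>, y). (X \<omega>, y)) \<in> measurable (M \<Otimes>\<^sub>M borel) (conf \<Otimes>\<^sub>M borel)" by measurable
  from measurable_compose[OF this F]
  show "(\<lambda>\<omega>. \<Sum>y\<in>X \<omega>. F (X \<omega>) y) \<in> borel_measurable M"
    by (intro borel_measurable_sum_conf measurable_X) (simp add: split_def)
  have "(\<lambda>(y, \<omega>). (insert y (X \<omega>), y)) \<in> measurable (borel \<Otimes>\<^sub>M M) (conf \<Otimes>\<^sub>M borel)"
    using measurable_insert_X by (simp add: split_def)
  from measurable_compose[OF this F]
  show *: "(\<lambda>(y, \<omega>). F (insert y (X \<omega>)) y) \<in> borel_measurable (borel \<Otimes>\<^sub>M M)"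
    by (simp add: split_def)
  show "(\<lambda>\<omega>. F (insert y (X \<omega>)) y) \<in> borel_measurable M"
    using measurable_compose[OF measurable_Pair1' *, of y] by simp
  show "(\<lambda>y. \<integral>\<^sup>+ \<omega>. F (insert y (X \<omega>)) y \<partial>M) \<in> borel_measurable borel"
    using * by (rule borel_measurable_nn_integral)
qed

text \<open>Both sides equal the intensity of \<open>A - B\<close> times the void probability of \<open>B\<close>. Void events are
  intersection-stable, so no joint laws beyond two disjoint sets are needed.\<close>

lemma mecke_rectangle:
  assumes A: "A \<in> sets borel" and B: "B \<in> sets borel"
  shows "(\<integral>\<^sup>+ \<omega>. (\<Sum>y\<in>X \<omega>. indicator ({\<phi>. finite \<phi> \<and> \<phi> \<inter> B = {}} \<times> A) (X \<omega>, y)) \<partial>M) =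
    (\<integral>\<^sup>+ y. \<integral>\<^sup>+ \<omega>. indicator ({\<phi>. finite \<phi> \<and> \<phi> \<inter> B = {}} \<times> A) (insert y (X \<omega>), y) \<partial>M \<partial>intensity)"
proof -
  have "(\<integral>\<^sup>+ \<omega>. (\<Sum>y\<in>X \<omega>. indicator ({\<phi>. finite \<phi> \<and> \<phi> \<inter> B = {}} \<times> A) (X \<omega>, y)) \<partial>M) =
    (\<integral>\<^sup>+ \<omega>. of_nat (card (X \<omega> \<inter> A)) * of_bool (X \<omega> \<inter> B = {}) \<partial>M)"
  proof (intro nn_integral_cong)
    fix \<omega> assume w: "\<omega> \<in> space M"
    have "(\<Sum>y\<in>X \<omega>. indicator ({\<phi>. finite \<phi> \<and> \<phi> \<inter> B = {}} \<times> A) (X \<omega>, y)) =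
      (\<Sum>y\<in>X \<omega>. indicator A y * of_bool (X \<omega> \<inter> B = {}) :: ennreal)"
      using finite_X[OF w] by (intro sum.cong) (auto split: split_indicator)
    also have "\<dots> = of_nat (card (X \<omega> \<inter> A)) * of_bool (X \<omega> \<inter> B = {})"
      using finite_X[OF w] by (simp add: sum_distrib_right[symmetric] indicator_def sum.If_cases
          Int_def)
    finally show "(\<Sum>y\<in>X \<omega>. indicator ({\<phi>. finite \<phi> \<and> \<phi> \<inter> B = {}} \<times> A) (X \<omega>, y)) =
      of_nat (card (X \<omega> \<inter> A)) * (of_bool (X \<omega> \<inter> B = {}) :: ennreal)" .
  qed
  also have "\<dots> = emeasure intensity (A - B) * ennreal (exp (- measure intensity B))"
    by (rule nn_integral_count_void[OF A B])
  also have "\<dots> = (\<integral>\<^sup>+ y. ennreal (exp (- measure intensity B)) * indicator (A - B) y \<partial>intensity)"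
    using A B by (subst nn_integral_cmult_indicator) (auto simp: mult.commute)
  also have "\<dots> = (\<integral>\<^sup>+ y. \<integral>\<^sup>+ \<omega>. indicator ({\<phi>. finite \<phi> \<and> \<phi> \<inter> B = {}} \<times> A) (insert y (X \<omega>), y) \<partial>M \<partial>intensity)"
  proof (intro nn_integral_cong)
    fix y
    have "(\<integral>\<^sup>+ \<omega>. indicator ({\<phi>. finite \<phi> \<and> \<phi> \<inter> B = {}} \<times> A) (insert y (X \<omega>), y) \<partial>M) =
      (\<integral>\<^sup>+ \<omega>. indicator (A - B) y * indicator {\<omega> \<in> space M. X \<omega> \<inter> B = {}} \<omega> \<partial>M)"
      by (intro nn_integral_cong) (auto split: split_indicator simp: finite_X)
    also have "\<dots> = indicator (A - B) y * ennreal (exp (- measure intensity B))"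
      using sets_void[OF B] prob_void[OF B] by (simp add: nn_integral_cmult_indicator emeasure_eq_measure)
    finally show "ennreal (exp (- measure intensity B)) * indicator (A - B) y =
      (\<integral>\<^sup>+ \<omega>. indicator ({\<phi>. finite \<phi> \<and> \<phi> \<inter> B = {}} \<times> A) (insert y (X \<omega>), y) \<partial>M)"
      by (simp add: mult.commute)
  qed
  finally show ?thesis .
qed

text \<open>Provides an intersection-stable generator of the product on which
  \<open>mecke_rectangle\<close> is available. The whole configuration space is itself the void
  event of the empty set, which yields the countable covers that the product of generators
  requires.\<close>

lemma sets_conf_pair:
  "sets (conf \<Otimes>\<^sub>M borel) = sigma_sets ({\<phi>. finite \<phi>} \<times> UNIV)
     {{\<phi>. finite \<phi> \<and> \<phi> \<inter> B = {}} \<times> A |(A :: 'a set) (B :: 'a set). A \<in> sets borel \<and> B \<in> sets borel}"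
    (is "_ = sigma_sets _ ?G")
proof -
  let ?\<Omega> = "{\<phi>::'a set. finite \<phi>}"
  let ?E = "{{\<phi>. finite \<phi> \<and> \<phi> \<inter> B = {}} |B. B \<in> sets (borel :: 'a measure)}"
  have \<Omega>: "?\<Omega> \<in> ?E"
    by (rule CollectI, rule exI[of _ "{}"]) simp
  have "sets (sigma ?\<Omega> ?E \<Otimes>\<^sub>M sigma (UNIV :: 'a set) (sets borel)) =
    sets (sigma (?\<Omega> \<times> UNIV) {a \<times> b |a b. a \<in> ?E \<and> b \<in> sets (borel :: 'a measure)})"
  proof (rule arg_cong[where f=sets], rule sigma_prod)
    show "\<exists>E\<subseteq>?E. countable E \<and> ?\<Omega> = \<Union>E"
      by (rule exI[of _ "{?\<Omega>}"]) (use \<Omega> in simp)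
    show "\<exists>E\<subseteq>sets (borel :: 'a measure). countable E \<and> UNIV = \<Union>E"
      by (rule exI[of _ "{UNIV}"]) simp
  qed auto
  also have "{a \<times> b |a b. a \<in> ?E \<and> b \<in> sets (borel :: 'a measure)} = ?G" by blast
  also have "sets (sigma ?\<Omega> ?E \<Otimes>\<^sub>M sigma (UNIV :: 'a set) (sets borel)) = sets (conf \<Otimes>\<^sub>M borel)"
  proof (rule sets_pair_measure_cong)
    show "sets (sigma ?\<Omega> ?E) = sets conf" by (simp add: conf_def)
    show "sets (sigma (UNIV :: 'a set) (sets borel)) = sets borel"
      using sets.sigma_sets_eq[of "borel :: 'a measure"] by simp
  qed
  also have "sets (sigma (?\<Omega> \<times> UNIV) ?G) = sigma_sets (?\<Omega> \<times> UNIV) ?G"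
    by (rule sets_measure_of) auto
  finally show ?thesis .
qed

text \<open>Lets series and monotone limits pass through a sum over the points, by the convergence
  theorems for integrals.\<close>

lemma nn_integral_count_space_X:
  "\<omega> \<in> space M \<Longrightarrow> (\<integral>\<^sup>+ y. h y \<partial>count_space (X \<omega>)) = (\<Sum>y\<in>X \<omega>. h y)"
  by (intro nn_integral_count_space_finite finite_X)

text \<open>Dynkin's argument: both sides are additive in \<open>S\<close> and agree on the
  rectangles with a void event as one factor.\<close>

lemma mecke_indicator:
  assumes S: "S \<in> sets (conf \<Otimes>\<^sub>M borel)"
  shows "(\<integral>\<^sup>+ \<omega>. (\<Sum>y\<in>X \<omega>. indicator S (X \<omega>, y)) \<partial>M) =
    (\<integral>\<^sup>+ y. \<integral>\<^sup>+ \<omega>. indicator S (insert y (X \<omega>), y) \<partial>M \<partial>intensity)"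
    (is "?l S = ?r S")
proof -
  let ?\<Omega> = "{\<phi>::'a set. finite \<phi>} \<times> (UNIV :: 'a set)"
  let ?G = "{{\<phi>. finite \<phi> \<and> \<phi> \<inter> B = {}} \<times> A |(A :: 'a set) (B :: 'a set). A \<in> sets borel \<and> B \<in> sets borel}"
  have meas: "(\<lambda>\<omega>. \<Sum>y\<in>X \<omega>. indicator A (X \<omega>, y) :: ennreal) \<in> borel_measurable M"
    "(\<lambda>\<omega>. indicator A (insert y (X \<omega>), y) :: ennreal) \<in> borel_measurable M"
    "(\<lambda>y. \<integral>\<^sup>+ \<omega>. indicator A (insert y (X \<omega>), y) \<partial>M) \<in> borel_measurable intensity"
    if "A \<in> sigma_sets ?\<Omega> ?G" for A y
    using measurable_mecke[of "\<lambda>\<phi> y. indicator A (\<phi>, y)"] that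
    by (simp_all add: sets_conf_pair[symmetric] split_def measurable_cong_sets[OF sets_intensity refl])
  have add: "?l A + ?l B = ?l C" "?r A + ?r B = ?r C"
    if "A \<in> sigma_sets ?\<Omega> ?G" "B \<in> sigma_sets ?\<Omega> ?G" "A \<inter> B = {}" "C = A \<union> B" for A B C
  proof -
    have *: "indicator C x = indicator A x + (indicator B x :: ennreal)" for x
      using that(3,4) by (auto split: split_indicator)
    show "?l A + ?l B = ?l C"
      unfolding * sum.distrib using that by (intro nn_integral_add[symmetric] meas)
    show "?r A + ?r B = ?r C"
      unfolding * using that
      by (simp add: nn_integral_add meas)
  qed
  have stable: "Int_stable ?G"
  proof (rule Int_stableI)
    fix a b assume "a \<in> ?G" "b \<in> ?G"
    then obtain A B A' B' where *: "a = {\<phi>. finite \<phi> \<and> \<phi> \<inter> B = {}} \<times> A" "b = {\<phi>. finite \<phi> \<and> \<phi> \<inter> B' = {}} \<times> A'"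
      "A \<in> sets borel" "B \<in> sets borel" "A' \<in> sets borel" "B' \<in> sets borel" by auto
    then have "a \<inter> b = {\<phi>. finite \<phi> \<and> \<phi> \<inter> (B \<union> B') = {}} \<times> (A \<inter> A')" by auto
    then show "a \<inter> b \<in> ?G" using * by auto
  qed
  have closed: "?G \<subseteq> Pow ?\<Omega>" by auto
  from stable closed S[unfolded sets_conf_pair] show ?thesis
  proof (induct rule: sigma_sets_induct_disjoint)
    case (basic A)
    then show ?case using mecke_rectangle by auto
  next
    case empty
    show ?case by simp
  next
    case (compl A)
    have \<Omega>: "?\<Omega> \<in> sigma_sets ?\<Omega> ?G" by (rule sigma_sets_top)
    have A: "A \<subseteq> ?\<Omega>" using compl by (intro sigma_sets_into_sp[of ?G]) auto
    have A': "?\<Omega> - A \<in> sigma_sets ?\<Omega> ?G" using compl by (intro sigma_sets.Compl)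
    have total: "?l ?\<Omega> = ?r ?\<Omega>" using mecke_rectangle[of UNIV "{}"] by simp
    \<comment> \<open>Passing to a complement requires a subtraction in \<open>ennreal\<close>,
      hence a finite total; it is the mass of the intensity, finite because the domain is
      bounded.\<close>
    have "?r ?\<Omega> = emeasure intensity UNIV"
    proof -
      have "?r ?\<Omega> = (\<integral>\<^sup>+ y. 1 \<partial>intensity)"
        by (intro nn_integral_cong, subst nn_integral_cong[where v="\<lambda>_. 1"])
          (auto simp: finite_X emeasure_space_1)
      then show ?thesis by simp
    qed
    then have fin: "?r ?\<Omega> \<noteq> \<top>" by simp
    have "?l A + ?l (?\<Omega> - A) = ?l ?\<Omega>" "?r A + ?r (?\<Omega> - A) = ?r ?\<Omega>"
      using A by (intro add compl(1) A'; auto)+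
    then have "?r A + ?l (?\<Omega> - A) = ?r A + ?r (?\<Omega> - A)" "?r A \<noteq> \<top>"
      using compl(2) total fin by (auto simp: ennreal_add_eq_top)
    then show ?case by (simp add: ennreal_add_left_cancel)
  next
    case (union A)
    from union(2) have A: "A i \<in> sigma_sets ?\<Omega> ?G" for i by auto
    have *: "indicator (\<Union>i. A i) x = (\<Sum>i. indicator (A i) x :: ennreal)" for x
      using suminf_indicator[OF union(1), of x] by simp
    have "?l (\<Union>i. A i) = (\<integral>\<^sup>+ \<omega>. (\<Sum>i. (\<Sum>y\<in>X \<omega>. indicator (A i) (X \<omega>, y))) \<partial>M)"
    proof (rule nn_integral_cong)
      fix \<omega> assume w: "\<omega> \<in> space M"
      show "(\<Sum>y\<in>X \<omega>. indicator (\<Union>i. A i) (X \<omega>, y) :: ennreal) =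
        (\<Sum>i. (\<Sum>y\<in>X \<omega>. indicator (A i) (X \<omega>, y)))"
        unfolding * nn_integral_count_space_X[OF w, symmetric]
        by (rule nn_integral_suminf) simp
    qed
    also have "\<dots> = (\<Sum>i. ?l (A i))" using A by (intro nn_integral_suminf meas)
    also have "\<dots> = (\<Sum>i. ?r (A i))" using union(3) by simp
    also have "\<dots> = ?r (\<Union>i. A i)"
      unfolding * using A by (simp add: nn_integral_suminf meas)
    finally show ?case .
  qed
qed

text \<open>The law of the process has been exploited completely in \<open>mecke_indicator\<close>;
  what remains is linearity and monotone convergence on both sides.\<close>

lemma mecke:
  assumes F: "case_prod F \<in> borel_measurable (conf \<Otimes>\<^sub>M borel)"
  shows "(\<integral>\<^sup>+ \<omega>. (\<Sum>y\<in>X \<omega>. F (X \<omega>) y) \<partial>M) =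
    (\<integral>\<^sup>+ y. \<integral>\<^sup>+ \<omega>. F (insert y (X \<omega>)) y \<partial>M \<partial>intensity)"
proof -
  define P where "P u \<longleftrightarrow> (\<integral>\<^sup>+ \<omega>. (\<Sum>y\<in>X \<omega>. u (X \<omega>, y)) \<partial>M) =
    (\<integral>\<^sup>+ y. \<integral>\<^sup>+ \<omega>. u (insert y (X \<omega>), y) \<partial>M \<partial>intensity)" for u :: "'a set \<times> 'a \<Rightarrow> ennreal"
  have meas: "(\<lambda>\<omega>. \<Sum>y\<in>X \<omega>. u (X \<omega>, y)) \<in> borel_measurable M"
    "(\<lambda>\<omega>. u (insert y (X \<omega>), y)) \<in> borel_measurable M"
    "(\<lambda>y. \<integral>\<^sup>+ \<omega>. u (insert y (X \<omega>), y) \<partial>M) \<in> borel_measurable intensity"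
    if "u \<in> borel_measurable (conf \<Otimes>\<^sub>M borel)" for u :: "'a set \<times> 'a \<Rightarrow> ennreal" and y
    using measurable_mecke[of "\<lambda>\<phi> y. u (\<phi>, y)"] that by (simp_all add: split_def measurable_cong_sets[OF sets_intensity refl])
  have "P (case_prod F)" using F
  proof (induct rule: borel_measurable_induct)
    case (cong f g)
    have 1: "(\<Sum>y\<in>X \<omega>. f (X \<omega>, y)) = (\<Sum>y\<in>X \<omega>. g (X \<omega>, y))" if "\<omega> \<in> space M" for \<omega>
      using cong(3) finite_X[OF that] by (intro sum.cong) (auto simp: space_pair_measure)
    have 2: "f (insert y (X \<omega>), y) = g (insert y (X \<omega>), y)" if "\<omega> \<in> space M" for \<omega> y
      using cong(3) finite_X[OF that] by (auto simp: space_pair_measure)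
    show ?case using cong(4) by (simp add: P_def 1 2 cong: nn_integral_cong)
  next
    case (set A)
    then show ?case unfolding P_def by (rule mecke_indicator)
  next
    case (mult u c)
    then show ?case unfolding P_def sum_distrib_left[symmetric]
      by (simp add: nn_integral_cmult meas)
  next
    case (add u v)
    then show ?case unfolding P_def sum.distrib
      by (simp add: nn_integral_add meas)
  next
    case (seq W)
    have inc: "incseq (\<lambda>i. W i x)" for x using seq(4) by (cases x) (simp add: incseq_def le_fun_def)
    have "(\<integral>\<^sup>+ \<omega>. (\<Sum>y\<in>X \<omega>. (SUP i. W i) (X \<omega>, y)) \<partial>M) =
      (\<integral>\<^sup>+ \<omega>. (SUP i. \<Sum>y\<in>X \<omega>. W i (X \<omega>, y)) \<partial>M)"
    proof (rule nn_integral_cong)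
      fix \<omega> assume w: "\<omega> \<in> space M"
      show "(\<Sum>y\<in>X \<omega>. (SUP i. W i) (X \<omega>, y)) = (SUP i. \<Sum>y\<in>X \<omega>. W i (X \<omega>, y))"
        unfolding nn_integral_count_space_X[OF w, symmetric] SUP_apply
        using inc by (intro nn_integral_monotone_convergence_SUP) (auto simp: incseq_def le_fun_def)
    qed
    also have "\<dots> = (SUP i. \<integral>\<^sup>+ \<omega>. (\<Sum>y\<in>X \<omega>. W i (X \<omega>, y)) \<partial>M)"
      using inc seq(1) by (intro nn_integral_monotone_convergence_SUP meas)
        (auto simp: incseq_def le_fun_def intro!: sum_mono)
    also have "\<dots> = (SUP i. \<integral>\<^sup>+ y. \<integral>\<^sup>+ \<omega>. W i (insert y (X \<omega>), y) \<partial>M \<partial>intensity)"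
      using seq(3) by (simp add: P_def)
    also have "\<dots> = (\<integral>\<^sup>+ y. (SUP i. \<integral>\<^sup>+ \<omega>. W i (insert y (X \<omega>), y) \<partial>M) \<partial>intensity)"
    proof (rule nn_integral_monotone_convergence_SUP[symmetric])
      show "incseq (\<lambda>i y. \<integral>\<^sup>+ \<omega>. W i (insert y (X \<omega>), y) \<partial>M)"
        using inc by (auto simp: incseq_def le_fun_def intro!: nn_integral_mono)
      show "(\<lambda>y. \<integral>\<^sup>+ \<omega>. W i (insert y (X \<omega>), y) \<partial>M) \<in> borel_measurable intensity" for i
        using meas(3)[OF seq(1)] by simp
    qed
    also have "\<dots> = (\<integral>\<^sup>+ y. \<integral>\<^sup>+ \<omega>. (SUP i. W i) (insert y (X \<omega>), y) \<partial>M \<partial>intensity)"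
    proof (rule nn_integral_cong)
      fix y
      show "(SUP i. \<integral>\<^sup>+ \<omega>. W i (insert y (X \<omega>), y) \<partial>M) = (\<integral>\<^sup>+ \<omega>. (SUP i. W i) (insert y (X \<omega>), y) \<partial>M)"
        unfolding SUP_apply using inc seq(1)
        by (intro nn_integral_monotone_convergence_SUP[symmetric] meas) (auto simp: incseq_def le_fun_def)
    qed
    finally show ?case unfolding P_def .
  qed
  then show ?thesis by (simp add: P_def)
qed

end

section \<open>Counting pairs of points with a void region\<close>

lemma borel_measurable_void_conf:
  fixes K :: "'p \<Rightarrow> 'a::{second_countable_topology,t2_space} set"
  assumes K: "K \<in> measurable P conf"
    and T: "{(p, w) \<in> space P \<times> UNIV. w \<in> T p} \<in> sets (P \<Otimes>\<^sub>M borel)"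
  shows "(\<lambda>p. of_bool (K p \<inter> T p = {}) :: ennreal) \<in> borel_measurable P"
proof -
  \<comment> \<open>The generators of \<open>conf\<close> treat fixed sets. For a region that moves
    with \<open>p\<close>, being void is expressed as the vanishing of a sum over points, which is
    measurable by \<open>borel_measurable_sum_conf\<close>.\<close>
  let ?f = "\<lambda>p w. indicator {(p, w) \<in> space P \<times> UNIV. w \<in> T p} (p, w) :: ennreal"
  have [measurable]: "(\<lambda>p. \<Sum>w\<in>K p. ?f p w) \<in> borel_measurable P"
    using T by (intro borel_measurable_sum_conf K) (simp add: split_def)
  have "K p \<inter> T p = {} \<longleftrightarrow> (\<Sum>w\<in>K p. ?f p w) = 0" if "p \<in> space P" for p
    using measurable_space[OF K that] that by (auto simp: indicator_def)
  moreover have "(\<lambda>p. of_bool ((\<Sum>w\<in>K p. ?f p w) = 0) :: ennreal) \<in> borel_measurable P"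
    unfolding of_bool_def by measurable
  ultimately show ?thesis by (simp cong: measurable_cong)
qed

text \<open>The form to which the Mecke formula can be applied twice: the configuration enters
  through its points and through one void event. With \<open>T = preferred\<close> the pairs counted
  are edges of the navigation.\<close>

definition pair_count :: "('a \<times> 'a) set \<Rightarrow> ('a \<Rightarrow> 'a \<Rightarrow> 'a set) \<Rightarrow> 'a set \<Rightarrow> ennreal" where
  "pair_count P T \<phi> = (\<Sum>y\<in>\<phi>. \<Sum>z\<in>\<phi>. indicator P (y, z) * of_bool (\<phi> \<inter> T y z = {}))"

lemma borel_measurable_inner_pair_count:
  fixes P :: "('a::{second_countable_topology,t2_space} \<times> 'a) set"
  assumes P: "P \<in> sets (borel \<Otimes>\<^sub>M borel)"
    and T: "{(y, z, w). w \<in> T y z} \<in> sets (borel \<Otimes>\<^sub>M (borel \<Otimes>\<^sub>M borel))"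
  shows "(\<lambda>(\<phi>, y). \<Sum>z\<in>\<phi>. indicator P (y, z) * of_bool (\<phi> \<inter> T y z = {}) :: ennreal)
    \<in> borel_measurable (conf \<Otimes>\<^sub>M borel)"
proof -
  let ?Q = "(conf \<Otimes>\<^sub>M borel) \<Otimes>\<^sub>M borel :: (('a set \<times> 'a) \<times> 'a) measure"
  have proj: "(\<lambda>q. (snd (fst (fst q)), snd (fst q), snd q)) \<in>
      measurable (?Q \<Otimes>\<^sub>M borel) (borel \<Otimes>\<^sub>M (borel \<Otimes>\<^sub>M borel))"
    by measurable
  have "{(q, w) \<in> space ?Q \<times> UNIV. w \<in> T (snd (fst q)) (snd q)} =
      (\<lambda>q. (snd (fst (fst q)), snd (fst q), snd q)) -` {(y, z, w). w \<in> T y z} \<inter> space (?Q \<Otimes>\<^sub>M borel)"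
    by (auto simp: space_pair_measure)
  then have set: "{(q, w) \<in> space ?Q \<times> UNIV. w \<in> T (snd (fst q)) (snd q)} \<in> sets (?Q \<Otimes>\<^sub>M borel)"
    using measurable_sets[OF proj T] by simp
  have "(\<lambda>q. of_bool (fst (fst q) \<inter> T (snd (fst q)) (snd q) = {}) :: ennreal) \<in> borel_measurable ?Q"
    by (rule borel_measurable_void_conf[OF _ set]) measurable
  moreover have "(\<lambda>q. indicator P (snd (fst q), snd q) :: ennreal) \<in> borel_measurable ?Q"
    using P by measurable
  ultimately have "(\<lambda>q. indicator P (snd (fst q), snd q) *
      of_bool (fst (fst q) \<inter> T (snd (fst q)) (snd q) = {}) :: ennreal) \<in> borel_measurable ?Q"
    by measurable
  then have "(\<lambda>p. \<Sum>z\<in>fst p. indicator P (snd p, z) * of_bool (fst p \<inter> T (snd p) z = {}) :: ennreal)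
      \<in> borel_measurable (conf \<Otimes>\<^sub>M borel)"
    by (intro borel_measurable_sum_conf) (auto simp: split_def)
  then show ?thesis by (simp add: split_def)
qed

lemma borel_measurable_pair_count:
  fixes P :: "('a::{second_countable_topology,t2_space} \<times> 'a) set"
  assumes P: "P \<in> sets (borel \<Otimes>\<^sub>M borel)"
    and T: "{(y, z, w). w \<in> T y z} \<in> sets (borel \<Otimes>\<^sub>M (borel \<Otimes>\<^sub>M borel))"
  shows "pair_count P T \<in> borel_measurable conf"
proof -
  have "(\<lambda>\<phi>. \<Sum>y\<in>\<phi>. (\<Sum>z\<in>\<phi>. indicator P (y, z) * of_bool (\<phi> \<inter> T y z = {}) :: ennreal)) \<in> borel_measurable conf"
    by (rule borel_measurable_sum_conf[OF _ borel_measurable_inner_pair_count[OF P T]]) simp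
  then show ?thesis by (simp add: pair_count_def[abs_def])
qed

context bounded_poisson_process
begin

text \<open>The Mecke formula is applied to \<open>y\<close> and then, with \<open>y\<close> fixed,
  to \<open>z\<close>. By \<open>irrefl\<close> the inserted points are invisible: neither of them
  fills \<open>T y z\<close>, and \<open>y\<close> does not pair with itself. Only the void
  probability of \<open>T y z\<close> is left.\<close>

lemma nn_integral_pair_count:
  assumes P: "P \<in> sets (borel \<Otimes>\<^sub>M borel)"
    and T: "{(y, z, w). w \<in> T y z} \<in> sets (borel \<Otimes>\<^sub>M (borel \<Otimes>\<^sub>M borel))"
    and irrefl: "\<And>y z. (y, z) \<in> P \<Longrightarrow> y \<noteq> z \<and> y \<notin> T y z \<and> z \<notin> T y z"
  shows "(\<integral>\<^sup>+ \<omega>. pair_count P T (X \<omega>) \<partial>M) =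
    (\<integral>\<^sup>+ y. \<integral>\<^sup>+ z. indicator P (y, z) * ennreal (exp (- measure intensity (T y z))) \<partial>intensity \<partial>intensity)"
proof -
  let ?F = "\<lambda>\<phi> y. \<Sum>z\<in>\<phi>. indicator P (y, z) * of_bool (\<phi> \<inter> T y z = {}) :: ennreal"
  let ?G = "\<lambda>y \<phi> z. indicator P (y, z) * of_bool (\<phi> \<inter> T y z = {}) :: ennreal"
  have T1: "T y z \<in> sets borel" for y z
  proof -
    have "(\<lambda>w. (y, z, w)) \<in> measurable borel (borel \<Otimes>\<^sub>M (borel \<Otimes>\<^sub>M borel))" by measurable
    from measurable_sets[OF this T] show ?thesis by (simp add: vimage_def)
  qed
  have G: "case_prod (?G y) \<in> borel_measurable (conf \<Otimes>\<^sub>M borel)" for y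
  proof -
    let ?Q = "conf \<Otimes>\<^sub>M borel :: ('a set \<times> 'a) measure"
    have proj: "(\<lambda>q. (y, snd (fst q), snd q)) \<in>
        measurable (?Q \<Otimes>\<^sub>M borel) (borel \<Otimes>\<^sub>M (borel \<Otimes>\<^sub>M borel))"
      by measurable
    have "{(q, w) \<in> space ?Q \<times> UNIV. w \<in> T y (snd q)} =
        (\<lambda>q. (y, snd (fst q), snd q)) -` {(y, z, w). w \<in> T y z} \<inter> space (?Q \<Otimes>\<^sub>M borel)"
      by (auto simp: space_pair_measure)
    then have set: "{(q, w) \<in> space ?Q \<times> UNIV. w \<in> T y (snd q)}
        \<in> sets (?Q \<Otimes>\<^sub>M borel)"
      using measurable_sets[OF proj T] by simp
    have "(\<lambda>q. of_bool (fst q \<inter> T y (snd q) = {}) :: ennreal) \<in> borel_measurable ?Q"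
      by (rule borel_measurable_void_conf[OF _ set]) measurable
    moreover have "(\<lambda>q. indicator P (y, snd q) :: ennreal) \<in> borel_measurable ?Q"
      using P by measurable
    ultimately show ?thesis by (simp add: split_def)
  qed
  have inner: "?F (insert y (X \<omega>)) y = (\<Sum>z\<in>X \<omega>. ?G y (X \<omega>) z)" if w: "\<omega> \<in> space M" for y \<omega>
  proof -
    have "?F (insert y (X \<omega>)) y = (\<Sum>z\<in>insert y (X \<omega>). ?G y (X \<omega>) z)"
      using irrefl by (intro sum.cong refl) (auto split: split_indicator)
    also have "\<dots> = (\<Sum>z\<in>X \<omega>. ?G y (X \<omega>) z)"
      using irrefl finite_X[OF w] by (intro sum.mono_neutral_right) (auto split: split_indicator)
    finally show ?thesis .
  qed
  have void: "(\<integral>\<^sup>+ \<omega>. ?G y (insert z (X \<omega>)) z \<partial>M) =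
      indicator P (y, z) * ennreal (exp (- measure intensity (T y z)))" for y z
  proof -
    have "(\<integral>\<^sup>+ \<omega>. ?G y (insert z (X \<omega>)) z \<partial>M) =
        (\<integral>\<^sup>+ \<omega>. indicator P (y, z) * indicator {\<omega> \<in> space M. X \<omega> \<inter> T y z = {}} \<omega> \<partial>M)"
      using irrefl by (intro nn_integral_cong) (auto split: split_indicator)
    then show ?thesis
      using sets_void[OF T1] prob_void[OF T1] by (simp add: nn_integral_cmult_indicator emeasure_eq_measure)
  qed
  have "(\<integral>\<^sup>+ \<omega>. pair_count P T (X \<omega>) \<partial>M) = (\<integral>\<^sup>+ y. \<integral>\<^sup>+ \<omega>. ?F (insert y (X \<omega>)) y \<partial>M \<partial>intensity)"
    unfolding pair_count_def by (rule mecke[OF borel_measurable_inner_pair_count[OF P T]])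
  also have "\<dots> = (\<integral>\<^sup>+ y. \<integral>\<^sup>+ \<omega>. (\<Sum>z\<in>X \<omega>. ?G y (X \<omega>) z) \<partial>M \<partial>intensity)"
    by (intro nn_integral_cong inner)
  also have "\<dots> = (\<integral>\<^sup>+ y. \<integral>\<^sup>+ z. indicator P (y, z) * ennreal (exp (- measure intensity (T y z))) \<partial>intensity \<partial>intensity)"
    unfolding mecke[OF G] void ..
  finally show ?thesis .
qed

end

section \<open>The navigation\<close>

lemma less_fun_total:
  fixes f g :: "'d::{finite,linorder} \<Rightarrow> 'b::linorder"
  assumes "f \<noteq> g"
  shows "less_fun f g \<or> less_fun g f"
proof -
  let ?K = "{k. f k \<noteq> g k}"
  have ne: "?K \<noteq> {}" using assms by auto
  then have "Min ?K \<in> ?K" by (intro Min_in) auto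
  moreover have "f k = g k" if "k < Min ?K" for k
  proof (rule ccontr)
    assume "f k \<noteq> g k"
    then have "Min ?K \<le> k" by (intro Min_le) auto
    then show False using that by simp
  qed
  ultimately show ?thesis unfolding less_fun_def
    by (metis (mono_tags, lifting) mem_Collect_eq neqE)
qed

lemma finite_less_fun_minimum:
  fixes S :: "(real ^ 'd::{finite,linorder}) set"
  assumes "finite S" "S \<noteq> {}"
  shows "\<exists>z\<in>S. \<forall>w\<in>S. w = z \<or> less_fun (vec_nth z) (vec_nth w)"
  using assms
proof (induct rule: finite_ne_induct)
  case (insert x F)
  then obtain z where z: "z \<in> F" "\<forall>w\<in>F. w = z \<or> less_fun (vec_nth z) (vec_nth w)" by auto
  have "vec_nth x \<noteq> vec_nth z" using z(1) insert(3) by (metis vec_nth_inject)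
  then consider "less_fun (vec_nth x) (vec_nth z)" | "less_fun (vec_nth z) (vec_nth x)"
    using less_fun_total by blast
  then show ?case
  proof cases
    case 1
    then have "less_fun (vec_nth x) (vec_nth w)" if "w \<in> F" for w
      using z(2) that less_fun_trans[OF 1] by auto
    then show ?thesis by auto
  next
    case 2
    then show ?thesis using z by (intro bexI[of _ z]) auto
  qed
qed auto

text \<open>The lexicographic tie-break belongs to the region. Hence the description of edges by
  void regions is exact for every finite configuration and not merely almost surely.\<close>

definition preferred :: "real ^ 'd::{finite,linorder} \<Rightarrow> (real, 'd) vec \<Rightarrow> ((real, 'd) vec) set" where
  "preferred y z = {w. proj1 y < proj1 w \<and>
     (dist y w < dist y z \<or> dist y w = dist y z \<and> less_fun (vec_nth w) (vec_nth z))}"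

lemma dst_nav_eqI:
  assumes z: "z \<in> \<phi>" "proj1 y < proj1 z" "\<phi> \<inter> preferred y z = {}"
  shows "dst_nav y \<phi> = z"
proof -
  have za: "z \<in> points_ahead y \<phi>" using z by (auto simp: points_ahead_def)
  have *: "dist y z \<le> dist y w" "dist y w = dist y z \<Longrightarrow> w = z \<or> less_fun (vec_nth z) (vec_nth w)"
    if "w \<in> points_ahead y \<phi>" for w
    using that z(3) less_fun_total[of "vec_nth z" "vec_nth w"]
    by (fastforce simp: points_ahead_def preferred_def vec_nth_inject)+
  have "(THE z. z \<in> points_ahead y \<phi> \<and> (\<forall>w \<in> points_ahead y \<phi>. dist y z \<le> dist y w) \<and>
      (\<forall>w \<in> points_ahead y \<phi>. dist y w = dist y z \<longrightarrow> w = z \<or> less_fun (vec_nth z) (vec_nth w))) = z"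
  proof (rule the_equality)
    fix v assume v: "v \<in> points_ahead y \<phi> \<and> (\<forall>w \<in> points_ahead y \<phi>. dist y v \<le> dist y w) \<and>
      (\<forall>w \<in> points_ahead y \<phi>. dist y w = dist y v \<longrightarrow> w = v \<or> less_fun (vec_nth v) (vec_nth w))"
    then have "dist y v = dist y z" using za * by (intro antisym) auto
    then show "v = z" using v za *(2)[of v] less_fun_asym by metis
  qed (use za * in auto)
  then show ?thesis using za by (auto simp: dst_nav_def)
qed

text \<open>Finiteness provides a smallest distance and, among the points that attain it, a
  lexicographic minimum, so the definite description in \<open>dst_nav\<close> denotes a
  point.\<close>

lemma dst_nav_ahead:
  assumes "finite \<phi>" "points_ahead y \<phi> \<noteq> {}"
  shows "dst_nav y \<phi> \<in> \<phi>" "proj1 y < proj1 (dst_nav y \<phi>)" "\<phi> \<inter> preferred y (dst_nav y \<phi>) = {}"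
proof -
  let ?A = "points_ahead y \<phi>"
  define m where "m = Min (dist y ` ?A)"
  have fin: "finite ?A" using assms(1) by (simp add: points_ahead_def)
  have "m \<in> dist y ` ?A" using fin assms(2) by (simp add: m_def)
  then have ne: "{z \<in> ?A. dist y z = m} \<noteq> {}" by auto
  obtain z where z: "z \<in> ?A" "dist y z = m"
      "\<And>w. w \<in> ?A \<Longrightarrow> dist y w = m \<Longrightarrow> w = z \<or> less_fun (vec_nth z) (vec_nth w)"
    using finite_less_fun_minimum[OF _ ne] fin by auto
  have "m \<le> dist y w" if "w \<in> ?A" for w using fin that by (simp add: m_def)
  then have "\<phi> \<inter> preferred y z = {}"
    using z less_fun_asym less_fun_irrefl unfolding preferred_def points_ahead_def
    by (auto simp: not_less[symmetric])
  moreover have "z \<in> \<phi>" "proj1 y < proj1 z" using z(1) by (auto simp: points_ahead_def)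
  ultimately show "dst_nav y \<phi> \<in> \<phi>" "proj1 y < proj1 (dst_nav y \<phi>)" "\<phi> \<inter> preferred y (dst_nav y \<phi>) = {}"
    using dst_nav_eqI by metis+
qed

text \<open>By \<open>dst_nav_eqI\<close> a nonzero term forces \<open>z\<close> to be the successor
  of \<open>y\<close>, so every inner sum has at most one nonzero term.\<close>

lemma pair_count_preferred:
  assumes fin: "finite \<phi>" and P: "\<And>y z. (y, z) \<in> P \<Longrightarrow> proj1 y < proj1 z"
  shows "pair_count P preferred \<phi> =
    of_nat (card {y \<in> \<phi>. points_ahead y \<phi> \<noteq> {} \<and> (y, dst_nav y \<phi>) \<in> P})"
proof -
  have "(\<Sum>z\<in>\<phi>. indicator P (y, z) * of_bool (\<phi> \<inter> preferred y z = {}) :: ennreal) =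
     of_bool (points_ahead y \<phi> \<noteq> {} \<and> (y, dst_nav y \<phi>) \<in> P)" for y
  proof (cases "points_ahead y \<phi> \<noteq> {}")
    case True
    note nav = dst_nav_ahead[OF fin True]
    have "(\<Sum>z\<in>\<phi>. indicator P (y, z) * of_bool (\<phi> \<inter> preferred y z = {}) :: ennreal) =
       (\<Sum>z\<in>{dst_nav y \<phi>}. indicator P (y, z) * of_bool (\<phi> \<inter> preferred y z = {}))"
    proof (intro sum.mono_neutral_right fin ballI)
      fix z assume z: "z \<in> \<phi> - {dst_nav y \<phi>}"
      then have "\<not> (proj1 y < proj1 z \<and> \<phi> \<inter> preferred y z = {})"
        using dst_nav_eqI[of z \<phi> y] by auto
      then show "indicator P (y, z) * of_bool (\<phi> \<inter> preferred y z = {}) = (0 :: ennreal)"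
        using P by (auto split: split_indicator)
    qed (use nav(1) in auto)
    then show ?thesis using nav True by (auto split: split_indicator)
  next
    case False
    then have "(y, z) \<notin> P" if "z \<in> \<phi>" for z
      using that P by (auto simp: points_ahead_def)
    then show ?thesis using False by simp
  qed
  then show ?thesis using fin by (simp add: pair_count_def Int_def of_bool_def sum.If_cases)
qed

section \<open>Crossings expressed through pair counts\<close>

definition edges_meeting :: "(real ^ 'd::{finite,linorder}) set \<Rightarrow> (((real, 'd) vec) \<times> ((real, 'd) vec)) set" where
  "edges_meeting I = {(y, z). proj1 y < proj1 z \<and> closed_segment y z \<inter> I \<noteq> {}}"

text \<open>The second sum stems from the convention that a point with nothing ahead navigates to
  itself. Its degenerate segment meets the section iff the point lies on it, and
  \<open>edges_meeting\<close> misses such pairs because it demands strict progress.\<close>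

lemma card_crossing_points:
  assumes fin: "finite \<phi>"
  shows "of_nat (card (crossing_points g s x \<phi>)) =
    pair_count (edges_meeting (cross_section g s x)) preferred \<phi> +
    (\<Sum>y\<in>\<phi>. indicator (cross_section g s x) y * of_bool (\<phi> \<inter> {z. proj1 y < proj1 z} = {}))"
proof -
  let ?I = "cross_section g s x"
  let ?A = "{y \<in> \<phi>. points_ahead y \<phi> \<noteq> {} \<and> (y, dst_nav y \<phi>) \<in> edges_meeting ?I}"
  let ?B = "{y \<in> \<phi>. points_ahead y \<phi> = {} \<and> y \<in> ?I}"
  have "crossing_points g s x \<phi> = ?A \<union> ?B"
    using dst_nav_ahead(2)[OF fin]
    by (auto simp: crossing_points_def edges_meeting_def dst_nav_def)
  then have "card (crossing_points g s x \<phi>) = card ?A + card ?B"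
    using fin by (simp add: card_Un_disjoint disjoint_iff)
  moreover have "pair_count (edges_meeting ?I) preferred \<phi> = of_nat (card ?A)"
    by (rule pair_count_preferred[OF fin]) (auto simp: edges_meeting_def)
  moreover have "(\<Sum>y\<in>\<phi>. indicator ?I y * of_bool (\<phi> \<inter> {z. proj1 y < proj1 z} = {}) :: ennreal) =
      (\<Sum>y\<in>\<phi>. of_bool (points_ahead y \<phi> = {} \<and> y \<in> ?I))"
    by (intro sum.cong refl) (auto simp: points_ahead_def split: split_indicator)
  moreover have "(\<Sum>y\<in>\<phi>. of_bool (points_ahead y \<phi> = {} \<and> y \<in> ?I)) = (of_nat (card ?B) :: ennreal)"
    using fin by (simp add: of_bool_def sum.If_cases Int_def)
  ultimately show ?thesis by simp
qed

lemma borel_measurable_proj1 [measurable]: "proj1 \<in> borel_measurable borel"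
  unfolding proj1_def[abs_def] by (intro borel_measurable_continuous_onI continuous_intros)

lemma sets_preferred:
  "{(y, z, w). w \<in> preferred y z} \<in> sets (borel \<Otimes>\<^sub>M (borel \<Otimes>\<^sub>M (borel :: (real ^ 'd::{finite,linorder}) measure)))"
proof -
  have nth[measurable]: "(\<lambda>v :: (real, 'd) vec. v $ i) \<in> borel_measurable borel" for i
    by (intro borel_measurable_continuous_onI continuous_intros)
  have "{(y, z, w). w \<in> preferred y (z :: (real, 'd) vec)} =
    {p \<in> space (borel \<Otimes>\<^sub>M (borel \<Otimes>\<^sub>M borel)). proj1 (fst p) < proj1 (snd (snd p)) \<and>
     (dist (fst p) (snd (snd p)) < dist (fst p) (fst (snd p)) \<or>
      dist (fst p) (snd (snd p)) = dist (fst p) (fst (snd p)) \<and>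
       (\<exists>k. snd (snd p) $ k < fst (snd p) $ k \<and> (\<forall>k'\<in>{..<k}. snd (snd p) $ k' = fst (snd p) $ k')))}"
    by (auto simp: preferred_def less_fun_def space_pair_measure)
  also have "\<dots> \<in> sets (borel \<Otimes>\<^sub>M (borel \<Otimes>\<^sub>M borel))" by measurable
  finally show ?thesis .
qed

lemma proj1_add [simp]: "proj1 (x + y) = proj1 x + proj1 y"
  and proj1_diff [simp]: "proj1 (x - y) = proj1 x - proj1 y"
  and proj1_scaleR [simp]: "proj1 (c *\<^sub>R x) = c * proj1 x"
  and proj1_zero [simp]: "proj1 0 = 0"
  by (simp_all add: proj1_def)

text \<open>A segment that moves ahead meets the hyperplane of the cross-section in at most one point.\<close>

lemma edges_meeting_cross_section:
  "(y, z) \<in> edges_meeting (cball a r \<inter> {v. proj1 v = proj1 a}) \<longleftrightarrow>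
    proj1 y < proj1 z \<and> proj1 y \<le> proj1 a \<and> proj1 a \<le> proj1 z \<and>
    dist a (y + ((proj1 a - proj1 y) / (proj1 z - proj1 y)) *\<^sub>R (z - y)) \<le> r"
proof (cases "proj1 y < proj1 z")
  case True
  let ?t = "(proj1 a - proj1 y) / (proj1 z - proj1 y)"
  have "closed_segment y z \<inter> (cball a r \<inter> {v. proj1 v = proj1 a}) \<noteq> {} \<longleftrightarrow>
     (\<exists>t. 0 \<le> t \<and> t \<le> 1 \<and> proj1 (y + t *\<^sub>R (z - y)) = proj1 a \<and> dist a (y + t *\<^sub>R (z - y)) \<le> r)"
  proof -
    have "closed_segment y z = (\<lambda>t. y + t *\<^sub>R (z - y)) ` {0..1}"
      unfolding closed_segment_image_interval by (rule image_cong) (auto simp: algebra_simps)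
    then show ?thesis by (auto simp del: proj1_add proj1_diff proj1_scaleR simp: disjoint_iff)
  qed
  also have "\<dots> \<longleftrightarrow> (\<exists>t. 0 \<le> t \<and> t \<le> 1 \<and> t = ?t \<and> dist a (y + t *\<^sub>R (z - y)) \<le> r)"
    using True by (intro ex_cong1 conj_cong refl) (auto simp: field_simps)
  also have "\<dots> \<longleftrightarrow> 0 \<le> ?t \<and> ?t \<le> 1 \<and> dist a (y + ?t *\<^sub>R (z - y)) \<le> r" by auto
  also have "\<dots> \<longleftrightarrow> proj1 y \<le> proj1 a \<and> proj1 a \<le> proj1 z \<and> dist a (y + ?t *\<^sub>R (z - y)) \<le> r"
    using True by (simp add: divide_le_eq zero_le_divide_iff)
  finally show ?thesis using True by (simp add: edges_meeting_def)
qed (simp add: edges_meeting_def)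

lemma cross_section_eq: "cross_section g s x = cball (s *\<^sub>R x) (g s) \<inter> {v. proj1 v = proj1 (s *\<^sub>R x)}"
  by (simp add: cross_section_def)

lemma sets_edges_meeting:
  "edges_meeting (cball a r \<inter> {v. proj1 v = proj1 a}) \<in> sets (borel \<Otimes>\<^sub>M borel)"
proof -
  have "edges_meeting (cball a r \<inter> {v. proj1 v = proj1 a}) =
    {p \<in> space (borel \<Otimes>\<^sub>M borel). proj1 (fst p) < proj1 (snd p) \<and> proj1 (fst p) \<le> proj1 a \<and> proj1 a \<le> proj1 (snd p) \<and>
    dist a (fst p + ((proj1 a - proj1 (fst p)) / (proj1 (snd p) - proj1 (fst p))) *\<^sub>R (snd p - fst p)) \<le> r}"
    by (auto simp: edges_meeting_cross_section space_pair_measure simp del: proj1_scaleR)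
  also have "\<dots> \<in> sets (borel \<Otimes>\<^sub>M borel)" by measurable
  finally show ?thesis .
qed

lemma sets_ahead: "{(y, w). proj1 y < proj1 w} \<in> sets (borel \<Otimes>\<^sub>M borel)"
proof -
  have "{(y, w). proj1 y < proj1 w} = {p \<in> space (borel \<Otimes>\<^sub>M borel). proj1 (fst p) < proj1 (snd p)}"
    by (auto simp: space_pair_measure)
  also have "\<dots> \<in> sets (borel \<Otimes>\<^sub>M borel)" by measurable
  finally show ?thesis .
qed

lemma borel_measurable_card_crossing_points:
  fixes x :: "real ^ 'd::{finite,linorder}"
  shows "(\<lambda>\<phi>. of_nat (card (crossing_points g s x \<phi>)) :: ennreal) \<in> borel_measurable conf"
proof -
  let ?I = "cross_section g s x"
  have I[measurable]: "?I \<in> sets borel"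
    unfolding cross_section_def by measurable
  have "pair_count (edges_meeting ?I) preferred \<in> borel_measurable conf"
    unfolding cross_section_eq by (intro borel_measurable_pair_count sets_preferred sets_edges_meeting)
  moreover have "(\<lambda>\<phi>. \<Sum>y\<in>\<phi>. indicator ?I y * of_bool (\<phi> \<inter> {z. proj1 y < proj1 z} = {}) :: ennreal)
      \<in> borel_measurable conf"
  proof (rule borel_measurable_sum_conf)
    let ?Q = "conf \<Otimes>\<^sub>M borel :: (((real, 'd) vec) set \<times> ((real, 'd) vec)) measure"
    have proj: "(\<lambda>q. (snd (fst q), snd q)) \<in> measurable (?Q \<Otimes>\<^sub>M borel) (borel \<Otimes>\<^sub>M borel)"
      by measurable
    have eq: "{(q, w) \<in> space ?Q \<times> UNIV. w \<in> {z. proj1 (snd q) < proj1 z}} =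
        (\<lambda>q. (snd (fst q), snd q)) -` {(y, w). proj1 y < proj1 w} \<inter> space (?Q \<Otimes>\<^sub>M borel)"
      by (auto simp: space_pair_measure)
    have set: "{(q, w) \<in> space ?Q \<times> UNIV. w \<in> {z. proj1 (snd q) < proj1 z}} \<in> sets (?Q \<Otimes>\<^sub>M borel)"
      unfolding eq by (rule measurable_sets[OF proj sets_ahead])
    have "(\<lambda>q. of_bool (fst q \<inter> {z. proj1 (snd q) < proj1 z} = {}) :: ennreal) \<in> borel_measurable ?Q"
      by (rule borel_measurable_void_conf[OF _ set]) measurable
    then show "(\<lambda>(\<phi>, y). indicator ?I y * of_bool (\<phi> \<inter> {z. proj1 y < proj1 z} = {}) :: ennreal)
      \<in> borel_measurable ?Q"
      by (simp add: split_def)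
  qed simp
  ultimately have "(\<lambda>\<phi>. pair_count (edges_meeting ?I) preferred \<phi> +
      (\<Sum>y\<in>\<phi>. indicator ?I y * of_bool (\<phi> \<inter> {z. proj1 y < proj1 z} = {}))) \<in> borel_measurable conf"
    by measurable
  then show ?thesis
    by (rule measurable_cong[THEN iffD1, rotated]) (simp add: card_crossing_points)
qed

section \<open>Hausdorff measure of the cross-section\<close>

lemma ennreal_mult_divide_cancel:
  assumes "0 < b"
  shows "ennreal b * (a / ennreal b) = a"
  using assms by (metis ennreal_eq_0_iff ennreal_mult_divide_eq ennreal_neq_top ennreal_times_divide
      mult.commute not_less)

lemma hausdorff_content_affine_le:
  fixes A :: "'a::real_normed_vector set"
  assumes r: "0 < r"
  shows "hausdorff_content k (r * \<delta>) ((\<lambda>x. a + r *\<^sub>R x) ` A) \<le> ennreal (r ^ k) * hausdorff_content k \<delta> A"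
proof -
  let ?f = "\<lambda>x. a + r *\<^sub>R x"
  let ?t = "\<lambda>V. if V = {} then 0 else ennreal (unit_ball_vol (real k) * (diameter V / 2) ^ k)"
  \<comment> \<open>With the factor divided off on the left, each single cover can be compared, and
    no constant has to be moved through the infimum.\<close>
  have "hausdorff_content k (r * \<delta>) (?f ` A) / ennreal (r ^ k) \<le> hausdorff_content k \<delta> A"
    unfolding hausdorff_content_def[of k \<delta>]
  proof (rule INF_greatest)
    fix U :: "nat \<Rightarrow> 'a set"
    assume "U \<in> {U. A \<subseteq> (\<Union>i. U i) \<and> (\<forall>i. bounded (U i) \<and> diameter (U i) \<le> \<delta>)}"
    then have U: "A \<subseteq> (\<Union>i. U i)" "\<And>i. bounded (U i)" "\<And>i. diameter (U i) \<le> \<delta>" by auto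
    have diam: "diameter (?f ` U i) \<le> r * diameter (U i)" for i
    proof (rule diameter_le)
      show "?f ` U i \<noteq> {} \<or> 0 \<le> r * diameter (U i)" using r U(2) by (simp add: diameter_ge_0)
      fix x y assume "x \<in> ?f ` U i" "y \<in> ?f ` U i"
      then obtain x' y' where xy: "x = ?f x'" "y = ?f y'" "x' \<in> U i" "y' \<in> U i" by auto
      have "x - y = r *\<^sub>R (x' - y')" by (simp add: xy algebra_simps)
      then have "norm (x - y) = r * dist x' y'" using r by (simp add: dist_norm)
      also have "\<dots> \<le> r * diameter (U i)"
        using r diameter_bounded_bound[OF U(2) xy(3,4)] by (intro mult_left_mono) auto
      finally show "norm (x - y) \<le> r * diameter (U i)" .
    qed
    have bd: "bounded (?f ` U i)" for i
      using bounded_translation[OF bounded_scaling[OF U(2)], of a r i] by (simp add: image_image)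
    have "hausdorff_content k (r * \<delta>) (?f ` A) \<le> (\<Sum>i. ?t (?f ` U i))"
      unfolding hausdorff_content_def
    proof (rule INF_lower, intro CollectI conjI allI)
      show "?f ` A \<subseteq> (\<Union>i. ?f ` U i)" using U(1) by blast
      show "diameter (?f ` U i) \<le> r * \<delta>" for i
        using diam[of i] mult_left_mono[OF U(3), of r i] r by linarith
    qed (rule bd)
    also have "\<dots> \<le> (\<Sum>i. ennreal (r ^ k) * ?t (U i))"
    proof (intro suminf_le summableI)
      fix i
      have "(diameter (?f ` U i) / 2) ^ k \<le> r ^ k * (diameter (U i) / 2) ^ k"
        unfolding power_mult_distrib[symmetric]
        using diam[of i] by (intro power_mono) (auto intro: diameter_ge_0 bd)
      then have "unit_ball_vol (real k) * (diameter (?f ` U i) / 2) ^ k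
          \<le> r ^ k * (unit_ball_vol (real k) * (diameter (U i) / 2) ^ k)"
        using mult_left_mono[of _ _ "unit_ball_vol (real k)"] by (simp add: mult.left_commute)
      then show "?t (?f ` U i) \<le> ennreal (r ^ k) * ?t (U i)"
        using r by (simp add: ennreal_mult'[symmetric] ennreal_leI)
    qed
    also have "\<dots> = ennreal (r ^ k) * (\<Sum>i. ?t (U i))" by (rule ennreal_suminf_cmult)
    finally show "hausdorff_content k (r * \<delta>) (?f ` A) / ennreal (r ^ k) \<le> (\<Sum>i. ?t (U i))"
      using r by (simp add: divide_le_posI_ennreal mult.commute)
  qed
  then have "ennreal (r ^ k) * (hausdorff_content k (r * \<delta>) (?f ` A) / ennreal (r ^ k)) \<le>
      ennreal (r ^ k) * hausdorff_content k \<delta> A"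
    by (rule mult_left_mono) simp
  then show ?thesis using r by (simp add: ennreal_mult_divide_cancel)
qed

lemma hausdorff_measure_affine_le:
  fixes A :: "'a::real_normed_vector set"
  assumes r: "0 < r"
  shows "hausdorff_measure k ((\<lambda>x. a + r *\<^sub>R x) ` A) \<le> ennreal (r ^ k) * hausdorff_measure k A"
  unfolding hausdorff_measure_def[of k "(\<lambda>x. a + r *\<^sub>R x) ` A"]
proof (rule SUP_least)
  fix \<delta> :: real assume \<delta>: "\<delta> \<in> {0<..}"
  have "hausdorff_content k \<delta> ((\<lambda>x. a + r *\<^sub>R x) ` A) \<le> ennreal (r ^ k) * hausdorff_content k (\<delta> / r) A"
    using hausdorff_content_affine_le[OF r, of k "\<delta> / r" a A] r by simp
  also have "\<dots> \<le> ennreal (r ^ k) * hausdorff_measure k A"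
    unfolding hausdorff_measure_def using \<delta> r by (intro mult_left_mono SUP_upper) auto
  finally show "hausdorff_content k \<delta> ((\<lambda>x. a + r *\<^sub>R x) ` A) \<le> ennreal (r ^ k) * hausdorff_measure k A" .
qed

text \<open>The reverse inequality is the same estimate for the inverse affine map.\<close>

lemma hausdorff_measure_affine:
  fixes A :: "'a::real_normed_vector set"
  assumes r: "0 < r"
  shows "hausdorff_measure k ((\<lambda>x. a + r *\<^sub>R x) ` A) = ennreal (r ^ k) * hausdorff_measure k A"
proof (rule antisym[OF hausdorff_measure_affine_le[OF r]])
  let ?B = "(\<lambda>x. a + r *\<^sub>R x) ` A"
  have "(\<lambda>x. - (a /\<^sub>R r) + inverse r *\<^sub>R x) ` ?B = A"
    using r by (simp add: image_image scaleR_add_right)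
  then have "hausdorff_measure k A \<le> ennreal (inverse r ^ k) * hausdorff_measure k ?B"
    using hausdorff_measure_affine_le[of "inverse r" k "- (a /\<^sub>R r)" ?B] r by simp
  then have "ennreal (r ^ k) * hausdorff_measure k A \<le>
      ennreal (r ^ k) * (ennreal (inverse r ^ k) * hausdorff_measure k ?B)"
    by (rule mult_left_mono) simp
  also have "\<dots> = hausdorff_measure k ?B"
    using r by (simp add: mult.assoc[symmetric] ennreal_mult'[symmetric] power_mult_distrib[symmetric])
  finally show "ennreal (r ^ k) * hausdorff_measure k A \<le> hausdorff_measure k ?B" .
qed

lemma hausdorff_content_finite_cover_le:
  fixes A :: "'a::metric_space set"
  assumes "finite F" "A \<subseteq> \<Union>F" "0 \<le> \<delta>'" "\<delta>' \<le> \<delta>"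
    and F: "\<And>V. V \<in> F \<Longrightarrow> bounded V \<and> diameter V \<le> \<delta>'"
  shows "hausdorff_content k \<delta> A \<le> ennreal (real (card F) * (unit_ball_vol (real k) * (\<delta>' / 2) ^ k))"
proof -
  let ?t = "\<lambda>V. if V = {} then 0 else ennreal (unit_ball_vol (real k) * (diameter V / 2) ^ k)"
  obtain h where h: "bij_betw h {..<card F} F"
    using ex_bij_betw_nat_finite[OF assms(1)] by (auto simp: atLeast0LessThan)
  \<comment> \<open>Padding by empty sets is free, also for \<open>k = 0\<close>, where every
    nonempty set would cost \<open>1\<close>.\<close>
  define U where "U i = (if i < card F then h i else {})" for i
  have hF: "h i \<in> F" if "i < card F" for i using h that by (auto simp: bij_betw_def)
  have "hausdorff_content k \<delta> A \<le> (\<Sum>i. ?t (U i))"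
    unfolding hausdorff_content_def
  proof (rule INF_lower, intro CollectI conjI allI)
    show "A \<subseteq> (\<Union>i. U i)"
    proof
      fix x assume "x \<in> A"
      then obtain V where "V \<in> F" "x \<in> V" using assms(2) by auto
      then show "x \<in> (\<Union>i. U i)" using h unfolding bij_betw_def U_def by (force simp: image_iff)
    qed
    show "bounded (U i)" "diameter (U i) \<le> \<delta>" for i
      using F hF assms(3,4) by (auto simp: U_def intro: order_trans)
  qed
  also have "\<dots> = (\<Sum>i<card F. ?t (U i))"
    by (rule suminf_finite) (auto simp: U_def)
  also have "\<dots> \<le> (\<Sum>i<card F. ennreal (unit_ball_vol (real k) * (\<delta>' / 2) ^ k))"
    using F hF by (intro sum_mono)
      (auto simp: U_def intro!: ennreal_leI mult_left_mono power_mono diameter_ge_0)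
  also have "\<dots> = ennreal (real (card F) * (unit_ball_vol (real k) * (\<delta>' / 2) ^ k))"
    using assms(3) by (simp add: ennreal_mult ennreal_of_nat_eq_real_of_nat)
  finally show ?thesis .
qed

section \<open>Upper bound for the measure of the unit section, by grids\<close>

definition unit_section :: "(real ^ 'd::{finite,linorder}) set" where
  "unit_section = cball 0 1 \<inter> {v. proj1 v = 0}"

lemma cross_section_affine:
  assumes "0 < g s"
  shows "cross_section g s x = (\<lambda>v. s *\<^sub>R x + g s *\<^sub>R v) ` unit_section"
proof (intro set_eqI iffI)
  fix v assume v: "v \<in> cross_section g s x"
  let ?w = "(v - s *\<^sub>R x) /\<^sub>R g s"
  have "v = s *\<^sub>R x + g s *\<^sub>R ?w" using assms by simp
  moreover have "norm ?w \<le> 1"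
    unfolding norm_scaleR using v assms
    by (simp add: cross_section_def dist_norm norm_minus_commute field_simps)
  then have "?w \<in> unit_section"
    using v assms by (simp add: cross_section_def unit_section_def)
  ultimately show "v \<in> (\<lambda>v. s *\<^sub>R x + g s *\<^sub>R v) ` unit_section" by blast
next
  fix v assume "v \<in> (\<lambda>v. s *\<^sub>R x + g s *\<^sub>R v) ` unit_section"
  then show "v \<in> cross_section g s x"
    using assms by (auto simp: cross_section_def unit_section_def dist_norm mult_left_le)
qed

text \<open>On an interval of length \<open>n\<close> the floor function takes fewer than
  \<open>n + 2\<close> values, and the coordinates multiply. The bound serves twice: for covering
  the unit section and for packing the starting points of long edges.\<close>

lemma card_vec_cells_le:
  fixes S :: "(real ^ 'd::finite) set"
  assumes n: "\<And>i. 0 \<le> n i" and lo: "\<And>v i. v \<in> S \<Longrightarrow> lo i \<le> c * v $ i \<and> c * v $ i \<le> lo i + n i"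
  shows "finite ((\<lambda>v i. \<lfloor>c * v $ i\<rfloor>) ` S)" "real (card ((\<lambda>v i. \<lfloor>c * v $ i\<rfloor>) ` S)) \<le> (\<Prod>i\<in>UNIV. n i + 2)"
proof -
  let ?P = "PiE UNIV (\<lambda>i. {\<lfloor>lo i\<rfloor>..\<lfloor>lo i + n i\<rfloor>})"
  have sub: "(\<lambda>v i. \<lfloor>c * v $ i\<rfloor>) ` S \<subseteq> ?P"
    using lo by (auto simp: PiE_iff intro!: floor_mono)
  have fin: "finite ?P" by (intro finite_PiE) auto
  show "finite ((\<lambda>v i. \<lfloor>c * v $ i\<rfloor>) ` S)" using finite_subset[OF sub fin] .
  have "real (card ((\<lambda>v i. \<lfloor>c * v $ i\<rfloor>) ` S)) \<le> real (card ?P)"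
    using card_mono[OF fin sub] by simp
  also have "\<dots> = (\<Prod>i\<in>UNIV. real (card {\<lfloor>lo i\<rfloor>..\<lfloor>lo i + n i\<rfloor>}))"
    by (simp add: card_PiE)
  also have "\<dots> \<le> (\<Prod>i\<in>UNIV. n i + 2)"
  proof (intro prod_mono conjI)
    fix i
    have "\<lfloor>lo i\<rfloor> \<le> \<lfloor>lo i + n i\<rfloor>" using n[of i] by (intro floor_mono) simp
    then show "real (card {\<lfloor>lo i\<rfloor>..\<lfloor>lo i + n i\<rfloor>}) \<le> n i + 2" by simp linarith
  qed simp
  finally show "real (card ((\<lambda>v i. \<lfloor>c * v $ i\<rfloor>) ` S)) \<le> (\<Prod>i\<in>UNIV. n i + 2)" .
qed

lemma norm_lt_if_same_cell:
  fixes v w :: "real ^ 'd::finite"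
  assumes "0 < c" "\<And>i. \<lfloor>c * v $ i\<rfloor> = \<lfloor>c * w $ i\<rfloor>"
  shows "norm (v - w) < real CARD('d) / c"
proof -
  have "\<bar>(v - w) $ i\<bar> < 1 / c" for i
  proof -
    have "\<bar>c * v $ i - c * w $ i\<bar> < 1" using assms(2)[of i] by linarith
    then have "c * \<bar>(v - w) $ i\<bar> < 1" using assms(1)
      by (simp add: right_diff_distrib[symmetric] abs_mult)
    then show ?thesis using assms(1) by (simp add: field_simps)
  qed
  then have "(\<Sum>i\<in>UNIV. \<bar>(v - w) $ i\<bar>) < (\<Sum>i\<in>(UNIV :: 'd set). 1 / c)"
    by (intro sum_strict_mono) auto
  then show ?thesis using norm_le_l1_cart[of "v - w"] by simp
qed

lemma prod_Min_UNIV: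
  "(\<Prod>i\<in>(UNIV :: 'd::{finite,linorder} set). if i = Min UNIV then a else b) = a * b ^ (CARD('d) - 1)"
    for a b :: "'c::comm_monoid_mult"
  by (subst prod.remove[of _ "Min UNIV"]) (auto simp: prod.If_cases Compl_eq_Diff_UNIV card_Diff_singleton
    intro!: prod.cong[of _ _ _ "\<lambda>_. b", THEN trans])

text \<open>A grid of mesh \<open>1 / n\<close> needs of the order of \<open>n\<close> to the power
  \<open>?k\<close> cells, and each has diameter of the order \<open>1 / n\<close>; the powers of
  \<open>n\<close> cancel, which leaves a bound uniform in \<open>\<delta>\<close>.\<close>

lemma hausdorff_measure_unit_section_finite:
  "hausdorff_measure (CARD('d) - 1) (unit_section :: (real ^ 'd::{finite,linorder}) set) < \<infinity>"
proof -
  let ?k = "CARD('d) - 1" and ?d = "real CARD('d)"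
  let ?S = "unit_section :: ((real, 'd) vec) set"
  let ?C = "2 * (unit_ball_vol (real ?k) * (2 * ?d) ^ ?k)"
  have "hausdorff_content ?k \<delta> ?S \<le> ennreal ?C" if \<delta>: "0 < \<delta>" for \<delta>
  proof -
    \<comment> \<open>Points in a common cell are closer than \<open>?d / n\<close>, which this
      choice puts below \<open>\<delta>\<close>.\<close>
    obtain n :: nat where n: "?d / \<delta> < real n" using reals_Archimedean2 by blast
    have n0: "0 < real n" using n \<delta> by (smt (verit) divide_nonneg_pos of_nat_0_le_iff)
    then have n1: "1 \<le> real n" by simp
    let ?cell = "\<lambda>v i. \<lfloor>real n * v $ i\<rfloor>"
    let ?F = "(\<lambda>q. {v \<in> ?S. ?cell v = q}) ` (?cell ` ?S)"
    \<comment> \<open>The first coordinate is \<open>0\<close> on the section, so its range has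
      length \<open>0\<close>. It costs merely a factor \<open>2\<close>, and one power of
      \<open>n\<close> is saved.\<close>
    let ?m = "\<lambda>i::'d. if i = Min UNIV then 0 else 2 * real n"
    let ?lo = "\<lambda>i::'d. if i = Min UNIV then 0 else - real n"
    have lo: "?lo i \<le> real n * v $ i \<and> real n * v $ i \<le> ?lo i + ?m i" if "v \<in> ?S" for v i
    proof -
      have "\<bar>v $ i\<bar> \<le> 1" using that component_le_norm_cart[of v i] by (simp add: unit_section_def)
      then have "\<bar>real n * v $ i\<bar> \<le> real n" using n0 by (simp add: abs_mult mult_left_le)
      then show ?thesis using that by (auto simp: unit_section_def proj1_def abs_le_iff)
    qed
    note cells = card_vec_cells_le[of ?m ?S ?lo "real n", OF _ lo]
    have fin: "finite ?F" by (intro finite_imageI cells(1)) auto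
    have "real (card ?F) \<le> real (card (?cell ` ?S))"
      by (intro of_nat_mono card_image_le cells(1)) auto
    also have "\<dots> \<le> (\<Prod>i\<in>UNIV. ?m i + 2)" by (intro cells(2)) auto
    also have "\<dots> = (\<Prod>i\<in>(UNIV :: 'd set). if i = Min UNIV then 2 else 2 * real n + 2)"
      by (intro prod.cong) auto
    also have "\<dots> = 2 * (2 * real n + 2) ^ ?k" by (rule prod_Min_UNIV)
    also have "\<dots> \<le> 2 * (4 * real n) ^ ?k" using n1 by (intro mult_left_mono power_mono) auto
    finally have card: "real (card ?F) \<le> 2 * (4 * real n) ^ ?k" .
    have "hausdorff_content ?k \<delta> ?S \<le>
        ennreal (real (card ?F) * (unit_ball_vol (real ?k) * (?d / real n / 2) ^ ?k))"
    proof (rule hausdorff_content_finite_cover_le[OF fin])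
      show "?d / real n \<le> \<delta>" using n n0 \<delta> by (simp add: field_simps)
      fix V assume "V \<in> ?F"
      then obtain q where V: "V = {v \<in> ?S. ?cell v = q}" by auto
      have "bounded ?S" unfolding unit_section_def by (intro bounded_Int) auto
      then have "bounded V" unfolding V by (rule bounded_subset) auto
      moreover have "diameter V \<le> ?d / real n"
      proof (rule diameter_le)
        fix v w assume "v \<in> V" "w \<in> V"
        then have "?cell v = ?cell w" by (simp add: V)
        then have "norm (v - w) < ?d / real n"
          by (intro norm_lt_if_same_cell n0) metis
        then show "norm (v - w) \<le> ?d / real n" by simp
      qed simp
      ultimately show "bounded V \<and> diameter V \<le> ?d / real n" ..
    qed auto
    also have "\<dots> \<le> ennreal (2 * (4 * real n) ^ ?k * (unit_ball_vol (real ?k) * (?d / real n / 2) ^ ?k))"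
      by (intro ennreal_leI mult_right_mono card) auto
    also have "2 * (4 * real n) ^ ?k * (unit_ball_vol (real ?k) * (?d / real n / 2) ^ ?k) =
        2 * (unit_ball_vol (real ?k) * ((4 * real n) * (?d / real n / 2)) ^ ?k)"
      unfolding power_mult_distrib[of "4 * real n"] by simp
    also have "4 * real n * (?d / real n / 2) = 2 * ?d" using n0 by simp
    finally show ?thesis .
  qed
  then have "hausdorff_measure ?k ?S \<le> ennreal ?C"
    unfolding hausdorff_measure_def by (intro SUP_least) auto
  then show ?thesis by (rule le_less_trans) simp
qed

section \<open>Cylinders\<close>

abbreviation first_axis :: "real ^ 'd::{finite,linorder}" where
  "first_axis \<equiv> axis (Min UNIV) 1"

text \<open>It extends backwards from the hyperplane through \<open>a\<close>, since that is where
  the edges crossing the hyperplane start.\<close>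

definition cylinder :: "real ^ 'd::{finite,linorder} \<Rightarrow> real \<Rightarrow> real \<Rightarrow> ((real, 'd) vec) set" where
  "cylinder a h r = {y. proj1 a - h \<le> proj1 y \<and> proj1 y \<le> proj1 a \<and>
     norm (y - a - proj1 (y - a) *\<^sub>R first_axis) \<le> r}"

lemma continuous_on_proj1 [continuous_intros]:
  "continuous_on S f \<Longrightarrow> continuous_on S (\<lambda>x. proj1 (f x))"
  unfolding proj1_def by (intro continuous_intros)

lemma closed_cylinder: "closed (cylinder a h r)"
  unfolding cylinder_def
  by (intro closed_Collect_conj closed_Collect_le continuous_intros)

lemma borel_cylinder [measurable]: "cylinder a h r \<in> sets borel"
  by (rule borel_closed[OF closed_cylinder])

lemma bounded_cylinder:
  fixes a :: "real ^ 'd::{finite,linorder}"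
  shows "bounded (cylinder a h r)"
proof (rule bounded_subset[OF bounded_cball])
  show "cylinder a h r \<subseteq> cball a (\<bar>h\<bar> + r)"
  proof
    fix y assume y: "y \<in> cylinder a h r"
    have "norm (y - a) \<le> norm (y - a - proj1 (y - a) *\<^sub>R first_axis) + norm (proj1 (y - a) *\<^sub>R (first_axis :: (real, 'd) vec))"
      using norm_triangle_sub[of "y - a" "proj1 (y - a) *\<^sub>R first_axis"] by (simp only: add.commute)
    moreover have "\<bar>proj1 (y - a)\<bar> \<le> \<bar>h\<bar>" using y by (auto simp: cylinder_def)
    ultimately show "y \<in> cball a (\<bar>h\<bar> + r)"
      using y by (simp add: cylinder_def dist_norm norm_minus_commute norm_axis_1)
  qed
qed

lemma emeasure_cylinder_finite: "emeasure lborel (cylinder a h r) < \<infinity>"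
  using emeasure_bounded_finite[OF bounded_cylinder] by simp

lemma Basis_cart: "(Basis :: (real ^ 'n) set) = (\<lambda>i. axis i 1) ` UNIV"
  by (auto simp: Basis_vec_def)

text \<open>A diagonal map that stretches the first axis by \<open>h\<close> and all others by
  \<open>r\<close>, followed by a translation, carries the unit cylinder onto the given one.\<close>

lemma emeasure_cylinder:
  fixes a :: "real ^ 'd::{finite,linorder}"
  assumes h: "0 < h" and r: "0 < r"
  shows "emeasure lborel (cylinder a h r) =
    ennreal (h * r ^ (CARD('d) - 1)) * emeasure lborel (cylinder 0 1 1 :: ((real, 'd) vec) set)"
proof -
  let ?e = "first_axis :: (real, 'd) vec"
  define c where "c = (\<lambda>j :: (real, 'd) vec. if j = ?e then h else r)"
  define T where "T = (\<lambda>x. a + (\<Sum>j\<in>Basis. (c j * (x \<bullet> j)) *\<^sub>R j))"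
  have T: "T x $ i = a $ i + (if i = Min UNIV then h else r) * x $ i" for x i
  proof -
    have "T x $ i = T x \<bullet> axis i 1" by (simp add: inner_axis)
    also have "\<dots> = a \<bullet> axis i 1 + c (axis i 1) * (x \<bullet> axis i 1)"
      unfolding T_def inner_add_left by (subst inner_sum_left_Basis) (auto simp: Basis_cart)
    finally show ?thesis by (simp add: inner_axis c_def axis_eq_axis)
  qed
  have cn: "c j \<noteq> 0" for j using h r by (simp add: c_def)
  have meas: "T \<in> measurable lborel borel" unfolding T_def by measurable
  have "(\<Prod>j\<in>Basis. \<bar>c j\<bar>) = (\<Prod>i\<in>(UNIV :: 'd set). if i = Min UNIV then h else r)"
    unfolding Basis_cart using h r
    by (subst prod.reindex) (auto simp: inj_on_def axis_eq_axis c_def intro!: prod.cong)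
  then have prod: "(\<Prod>j\<in>Basis. \<bar>c j\<bar>) = h * r ^ (CARD('d) - 1)" by (simp add: prod_Min_UNIV)
  have proj: "proj1 (T x) = proj1 a + h * proj1 x" for x by (simp add: proj1_def T)
  have orth: "T x - a - (h * proj1 x) *\<^sub>R ?e = r *\<^sub>R (x - proj1 x *\<^sub>R ?e)" for x
    by (simp add: vec_eq_iff T proj1_def axis_def algebra_simps)
  have pre: "T -` cylinder a h r = (cylinder 0 1 1 :: ((real, 'd) vec) set)"
  proof (rule set_eqI)
    fix x
    have "norm (r *\<^sub>R (x - proj1 x *\<^sub>R ?e)) \<le> r \<longleftrightarrow> norm (x - proj1 x *\<^sub>R ?e) \<le> 1"
      using r by simp
    moreover have "- h \<le> h * proj1 x \<longleftrightarrow> -1 \<le> proj1 x" "h * proj1 x \<le> 0 \<longleftrightarrow> proj1 x \<le> 0"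
      using h mult_le_cancel_left_pos[of h "-1" "proj1 x"] by (auto simp: mult_le_0_iff)
    ultimately show "x \<in> T -` cylinder a h r \<longleftrightarrow> x \<in> cylinder 0 1 1"
      using orth[of x] by (simp add: cylinder_def proj)
  qed
  have "emeasure lborel (cylinder a h r) =
      emeasure (density (distr lborel borel T) (\<lambda>_. ennreal (\<Prod>j\<in>Basis. \<bar>c j\<bar>))) (cylinder a h r)"
    unfolding T_def by (subst lborel_affine_euclidean[of c a]) (auto simp: cn)
  also have "\<dots> = ennreal (h * r ^ (CARD('d) - 1)) * emeasure (distr lborel borel T) (cylinder a h r)"
    unfolding prod by (simp add: emeasure_density_const)
  also have "emeasure (distr lborel borel T) (cylinder a h r) = emeasure lborel (cylinder 0 1 1 :: ((real, 'd) vec) set)"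
    using meas by (simp add: emeasure_distr pre)
  finally show ?thesis .
qed

definition unit_cylinder_vol :: "'d::{finite,linorder} itself \<Rightarrow> real" where
  "unit_cylinder_vol _ = measure lborel (cylinder 0 1 1 :: ((real, 'd) vec) set)"

lemma emeasure_unit_cylinder:
  "emeasure lborel (cylinder 0 1 1 :: (real ^ 'd::{finite,linorder}) set) = ennreal (unit_cylinder_vol TYPE('d))"
  unfolding unit_cylinder_vol_def
  using emeasure_cylinder_finite by (intro emeasure_eq_ennreal_measure) (simp add: less_top)

lemma norm_orthogonal_part_le:
  fixes v :: "real ^ 'd::{finite,linorder}"
  shows "norm (v - proj1 v *\<^sub>R first_axis) \<le> norm v"
  by (rule norm_le_componentwise_cart) (auto simp: proj1_def axis_def)

lemma unit_cylinder_vol_pos: "0 < unit_cylinder_vol TYPE('d::{finite,linorder})"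
proof -
  let ?e = "first_axis :: (real, 'd) vec"
  \<comment> \<open>A ball inscribed halfway along the axis of the unit cylinder.\<close>
  let ?b = "ball (- (1/2) *\<^sub>R ?e) (1/2)"
  have "?b \<subseteq> cylinder 0 1 1"
  proof
    fix y assume y: "y \<in> ?b"
    let ?z = "y + (1/2) *\<^sub>R ?e"
    have z: "norm ?z < 1/2" using y by (simp add: dist_norm norm_minus_commute add.commute)
    have pz: "proj1 ?z = proj1 y + 1/2" unfolding proj1_def by simp
    have "\<bar>proj1 ?z\<bar> \<le> norm ?z" unfolding proj1_def by (rule component_le_norm_cart)
    then have "-1 \<le> proj1 y \<and> proj1 y \<le> 0" using z pz by linarith
    moreover have "?z - proj1 ?z *\<^sub>R ?e = y - proj1 y *\<^sub>R ?e" unfolding pz by (simp add: scaleR_add_left)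
    then have "norm (y - proj1 y *\<^sub>R ?e) \<le> norm ?z" using norm_orthogonal_part_le[of ?z] by (simp only:)
    then have "norm (y - proj1 y *\<^sub>R ?e) \<le> 1" using z by linarith
    ultimately show "y \<in> cylinder 0 1 1" by (simp add: cylinder_def)
  qed
  then have "measure lborel ?b \<le> unit_cylinder_vol TYPE('d)"
    unfolding unit_cylinder_vol_def using emeasure_cylinder_finite[of "0 :: (real, 'd) vec"]
    by (intro measure_mono_fmeasurable) (auto simp: fmeasurable_def)
  moreover have "0 < measure lborel ?b" by (rule content_ball_pos) simp
  ultimately show ?thesis by linarith
qed

text \<open>Covers of the section are fattened to covers of the unit cylinder: a nonempty covering
  set becomes a box with first side \<open>1\<close> and all other sides twice its diameter.
  Subadditivity of Lebesgue measure then bounds the sum of the powers of the diameters from below. A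
  single scale \<open>\<delta> = 1\<close> is enough, because the measure is a supremum over
  scales.\<close>

lemma hausdorff_measure_unit_section_pos:
  "0 < hausdorff_measure (CARD('d) - 1) (unit_section :: (real ^ 'd::{finite,linorder}) set)"
proof -
  let ?k = "CARD('d) - 1"
  let ?S = "unit_section :: ((real, 'd) vec) set"
  let ?Z = "cylinder 0 1 1 :: ((real, 'd) vec) set"
  let ?c = "unit_ball_vol (real ?k)"
  let ?t = "\<lambda>V :: ((real, 'd) vec) set. if V = {} then 0 else ennreal (?c * (diameter V / 2) ^ ?k)"
  have "ennreal (?c * unit_cylinder_vol TYPE('d) / 4 ^ ?k) \<le> hausdorff_content ?k 1 ?S"
    unfolding hausdorff_content_def
  proof (rule INF_greatest)
    fix U :: "nat \<Rightarrow> ((real, 'd) vec) set"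
    assume "U \<in> {U. ?S \<subseteq> (\<Union>i. U i) \<and> (\<forall>i. bounded (U i) \<and> diameter (U i) \<le> 1)}"
    then have U: "?S \<subseteq> (\<Union>i. U i)" "\<And>i. bounded (U i)" by auto
    define p where "p i = (SOME p. p \<in> U i)" for i
    have p: "p i \<in> U i" if "U i \<noteq> {}" for i using that unfolding p_def by (simp add: some_in_eq)
    \<comment> \<open>Corners of the box over \<open>U i\<close>: the first coordinate runs through
      the height of the cylinder, the others stay within the diameter of a chosen point of
      \<open>U i\<close>.\<close>
    define l where "l i = (\<chi> j. if j = Min UNIV then -1 else p i $ j - diameter (U i))" for i
    define u where "u i = (\<chi> j. if j = Min UNIV then 0 else p i $ j + diameter (U i))" for i
    define B where "B i = (if U i = {} then {} else cbox (l i) (u i))" for i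
    have "?Z \<subseteq> (\<Union>i. B i)"
    proof
      fix y assume y: "y \<in> ?Z"
      let ?w = "y - proj1 y *\<^sub>R first_axis"
      have "?w \<in> ?S" using y by (simp add: cylinder_def unit_section_def) (simp add: proj1_def)
      then obtain i where i: "?w \<in> U i" using U(1) by auto
      have "\<bar>y $ j - p i $ j\<bar> \<le> diameter (U i)" if "j \<noteq> Min UNIV" for j
      proof -
        have "y $ j - p i $ j = (?w - p i) $ j" using that by (simp add: axis_def)
        also have "\<bar>\<dots>\<bar> \<le> dist ?w (p i)" unfolding dist_norm by (rule component_le_norm_cart)
        also have "\<dots> \<le> diameter (U i)"
          using diameter_bounded_bound[OF U(2) i] p i by blast
        finally show ?thesis .
      qed
      moreover have "-1 \<le> y $ Min UNIV \<and> y $ Min UNIV \<le> 0"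
        using y by (simp add: cylinder_def proj1_def)
      ultimately have "l i $ j \<le> y $ j \<and> y $ j \<le> u i $ j" for j
        by (cases "j = Min UNIV") (simp_all add: l_def u_def abs_le_iff algebra_simps)
      then have "y \<in> cbox (l i) (u i)" by (simp add: mem_box_cart)
      then show "y \<in> (\<Union>i. B i)" using i by (auto simp: B_def)
    qed
    then have "emeasure lborel ?Z \<le> emeasure lborel (\<Union>i. B i)"
      by (intro emeasure_mono) (auto simp: B_def)
    also have "\<dots> \<le> (\<Sum>i. emeasure lborel (B i))"
      by (intro emeasure_subadditive_countably) (auto simp: B_def)
    finally have "ennreal ?c * emeasure lborel ?Z \<le> ennreal ?c * (\<Sum>i. emeasure lborel (B i))"
      by (rule mult_left_mono) simp
    also have "\<dots> = (\<Sum>i. ennreal ?c * emeasure lborel (B i))" by (rule ennreal_suminf_cmult[symmetric])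
    also have "\<dots> \<le> (\<Sum>i. ennreal (4 ^ ?k) * ?t (U i))"
    proof (intro suminf_le summableI)
      fix i
      show "ennreal ?c * emeasure lborel (B i) \<le> ennreal (4 ^ ?k) * ?t (U i)"
      proof (cases "U i = {}")
        case False
        have D: "0 \<le> diameter (U i)" by (rule diameter_ge_0[OF U(2)])
        then have "cbox (l i) (u i) \<noteq> {}" by (auto simp: interval_ne_empty_cart l_def u_def)
        then have "measure lborel (cbox (l i) (u i)) = (\<Prod>j\<in>UNIV. u i $ j - l i $ j)"
          by (rule content_cbox_cart)
        also have "\<dots> = (\<Prod>j\<in>(UNIV :: 'd set). if j = Min UNIV then 1 else 2 * diameter (U i))"
          by (intro prod.cong) (auto simp: u_def l_def)
        finally have "measure lborel (cbox (l i) (u i)) = (2 * diameter (U i)) ^ ?k"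
          by (simp add: prod_Min_UNIV)
        then have "emeasure lborel (B i) = ennreal ((2 * diameter (U i)) ^ ?k)"
          using False by (simp add: B_def emeasure_eq_ennreal_measure[OF emeasure_lborel_cbox_finite[THEN less_imp_neq, unfolded infinity_ennreal_def]])
        \<comment> \<open>The ratio between the box side \<open>2 * diameter\<close> and the
          normalised \<open>diameter / 2\<close> is \<open>4\<close>, whence the factor
          \<open>4 ^ ?k\<close>.\<close>
        moreover have "?c * (2 * diameter (U i)) ^ ?k = 4 ^ ?k * (?c * (diameter (U i) / 2) ^ ?k)"
          unfolding mult.left_commute[of "4 ^ ?k"] power_mult_distrib[symmetric] by simp
        ultimately show ?thesis using False
          by (simp only: if_False ennreal_mult'[symmetric] unit_ball_vol_nonneg zero_le_power zero_le_numeral order_refl)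
      qed (simp add: B_def)
    qed
    also have "\<dots> = ennreal (4 ^ ?k) * (\<Sum>i. ?t (U i))" by (rule ennreal_suminf_cmult)
    finally have "ennreal ?c * emeasure lborel ?Z \<le> ennreal (4 ^ ?k) * (\<Sum>i. ?t (U i))" .
    then have "ennreal (4 ^ ?k) * ennreal (?c * unit_cylinder_vol TYPE('d) / 4 ^ ?k) \<le> ennreal (4 ^ ?k) * (\<Sum>i. ?t (U i))"
      using unit_cylinder_vol_pos[where 'd='d]
      by (simp add: emeasure_unit_cylinder ennreal_mult[symmetric])
    then show "ennreal (?c * unit_cylinder_vol TYPE('d) / 4 ^ ?k) \<le> (\<Sum>i. ?t (U i))"
      by (subst (asm) ennreal_mult_le_mult_iff) auto
  qed
  also have "\<dots> \<le> hausdorff_measure ?k ?S" unfolding hausdorff_measure_def by (rule SUP_upper) auto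
  finally have "ennreal (?c * unit_cylinder_vol TYPE('d) / 4 ^ ?k) \<le> hausdorff_measure ?k ?S" .
  moreover have "0 < ennreal (?c * unit_cylinder_vol TYPE('d) / 4 ^ ?k)"
    using unit_cylinder_vol_pos[where 'd='d] by simp
  ultimately show ?thesis by (rule order_less_le_trans[rotated])
qed

text \<open>The point where the segment crosses the hyperplane and the orthogonal projection of
  \<open>y\<close> to it differ by \<open>t\<close> times the orthogonal part of \<open>v\<close>,
  where \<open>0 \<le> t \<le> 1\<close>. This is at most \<open>R\<close>, so changing the radius
  by \<open>R\<close> absorbs the slant.\<close>

lemma edges_translate_bounds:
  fixes a :: "real ^ 'd::{finite,linorder}"
  assumes v: "0 < proj1 v" "norm v \<le> R"
  shows "cylinder a (proj1 v) (r - R) \<subseteq> {y. (y, y + v) \<in> edges_meeting (cball a r \<inter> {w. proj1 w = proj1 a})}"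
    and "{y. (y, y + v) \<in> edges_meeting (cball a r \<inter> {w. proj1 w = proj1 a})} \<subseteq> cylinder a (proj1 v) (r + R)"
proof -
  let ?P = "edges_meeting (cball a r \<inter> {w. proj1 w = proj1 a})"
  let ?t = "\<lambda>y. (proj1 a - proj1 y) / proj1 v"
  \<comment> \<open>The orthogonal projection of \<open>y\<close> to the hyperplane, seen from
    \<open>a\<close>.\<close>
  let ?o = "\<lambda>y. y - a - proj1 (y - a) *\<^sub>R first_axis"
  have iff: "(y, y + v) \<in> ?P \<longleftrightarrow> proj1 a - proj1 v \<le> proj1 y \<and> proj1 y \<le> proj1 a \<and> norm (y + ?t y *\<^sub>R v - a) \<le> r" for y
    using v(1) by (auto simp: edges_meeting_cross_section dist_norm norm_minus_commute)
  have diff: "norm ((y + ?t y *\<^sub>R v - a) - ?o y) \<le> R" if "proj1 a - proj1 v \<le> proj1 y" "proj1 y \<le> proj1 a" for y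
  proof -
    have "proj1 (y - a) = - (?t y * proj1 v)" using v(1) by simp
    then have "(y + ?t y *\<^sub>R v - a) - ?o y = ?t y *\<^sub>R (v - proj1 v *\<^sub>R first_axis)"
      by (simp only:) (simp add: algebra_simps)
    moreover have "\<bar>?t y\<bar> \<le> 1" using that v(1) by (simp add: divide_le_eq)
    then have "\<bar>?t y\<bar> * norm (v - proj1 v *\<^sub>R first_axis) \<le> 1 * norm (v - proj1 v *\<^sub>R first_axis)"
      by (rule mult_right_mono) simp
    moreover have "norm (v - proj1 v *\<^sub>R first_axis) \<le> R"
      using norm_orthogonal_part_le[of v] v(2) by linarith
    ultimately show ?thesis by simp
  qed
  show "cylinder a (proj1 v) (r - R) \<subseteq> {y. (y, y + v) \<in> ?P}"
  proof
    fix y assume y: "y \<in> cylinder a (proj1 v) (r - R)"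
    then have b: "proj1 a - proj1 v \<le> proj1 y" "proj1 y \<le> proj1 a" "norm (?o y) \<le> r - R"
      by (auto simp: cylinder_def)
    have "norm (y + ?t y *\<^sub>R v - a) \<le> norm (?o y) + norm ((y + ?t y *\<^sub>R v - a) - ?o y)"
      by (rule norm_triangle_sub)
    then show "y \<in> {y. (y, y + v) \<in> ?P}" using b diff[OF b(1,2)] by (simp add: iff)
  qed
  show "{y. (y, y + v) \<in> ?P} \<subseteq> cylinder a (proj1 v) (r + R)"
  proof
    fix y assume "y \<in> {y. (y, y + v) \<in> ?P}"
    then have b: "proj1 a - proj1 v \<le> proj1 y" "proj1 y \<le> proj1 a" "norm (y + ?t y *\<^sub>R v - a) \<le> r"
      by (auto simp: iff)
    have "norm (?o y) \<le> norm (y + ?t y *\<^sub>R v - a) + norm (?o y - (y + ?t y *\<^sub>R v - a))"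
      by (rule norm_triangle_sub)
    then show "y \<in> cylinder a (proj1 v) (r + R)"
      using b diff[OF b(1,2)] norm_minus_commute[of "?o y" "y + ?t y *\<^sub>R v - a"]
      unfolding cylinder_def mem_Collect_eq by linarith
  qed
qed

section \<open>Packing of long edges\<close>

definition long_edges :: "(real ^ 'd::{finite,linorder}) set \<Rightarrow> real \<Rightarrow> (((real, 'd) vec) \<times> ((real, 'd) vec)) set" where
  "long_edges I R = edges_meeting I \<inter> {(y, z). R < dist y z}"

definition short_edges :: "(real ^ 'd::{finite,linorder}) set \<Rightarrow> real \<Rightarrow> (((real, 'd) vec) \<times> ((real, 'd) vec)) set" where
  "short_edges I R = edges_meeting I \<inter> {(y, z). dist y z \<le> R}"

lemma edges_meeting_bounds:
  assumes "(y, z) \<in> edges_meeting (cball a g \<inter> {w. proj1 w = proj1 a})" "dist y z \<le> r"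
  shows "dist a y \<le> g + r" "dist a z \<le> g + r" "proj1 a - r \<le> proj1 y" "proj1 y \<le> proj1 a"
proof -
  have E: "proj1 y \<le> proj1 a" "proj1 a \<le> proj1 z"
    using assms(1) by (auto simp: edges_meeting_cross_section)
  obtain p where p: "p \<in> closed_segment y z" "dist a p \<le> g"
    using assms(1) by (auto simp: edges_meeting_def)
  have "dist y p \<le> dist y z" "dist z p \<le> dist y z"
    using dist_in_closed_segment[OF p(1)] by (simp_all add: dist_commute)
  then show "dist a y \<le> g + r" "dist a z \<le> g + r"
    using p(2) assms(2) dist_triangle[of a y p] dist_triangle[of a z p] by (simp_all add: dist_commute)
  have "\<bar>proj1 (z - y)\<bar> \<le> norm (z - y)" unfolding proj1_def by (rule component_le_norm_cart)
  then show "proj1 a - r \<le> proj1 y" "proj1 y \<le> proj1 a"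
    using E assms(2) by (auto simp: dist_norm norm_minus_commute)
qed

text \<open>Two starting points in a common cell of diameter below \<open>r\<close> would be ahead of one another
  within distance \<open>r\<close>, so each cell contains at most one starting point of an edge longer than \<open>r\<close>.\<close>

lemma card_dyadic_edges_le:
  fixes a :: "real ^ 'd::{finite,linorder}"
  assumes fin: "finite \<phi>" and inj: "inj_on proj1 \<phi>" and r: "0 < r" and g: "0 < g"
    and S: "S = {y \<in> \<phi>. points_ahead y \<phi> \<noteq> {} \<and> (y, dst_nav y \<phi>) \<in> edges_meeting (cball a g \<inter> {w. proj1 w = proj1 a}) \<and>
      r < dist y (dst_nav y \<phi>) \<and> dist y (dst_nav y \<phi>) \<le> 2 * r}"
  shows "real (card S) \<le> 6 * real CARD('d) * (6 * real CARD('d) * (g / r + 1)) ^ (CARD('d) - 1)"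
proof -
  let ?d = "real CARD('d)"
  \<comment> \<open>Cells of side \<open>r / ?d\<close> have all mutual distances below
    \<open>r\<close>, by comparison with the sum of the coordinate distances.\<close>
  let ?c = "?d / r"
  let ?cell = "\<lambda>v i. \<lfloor>?c * v $ i\<rfloor>"
  have d1: "1 \<le> ?d" by (simp add: Suc_le_eq)
  have c: "0 < ?c" using r d1 by simp
  have aux: "dist v w < r" if "?cell v = ?cell w" for v w :: "(real, 'd) vec"
  proof -
    have "norm (v - w) < ?d / ?c" using fun_cong[OF that] by (intro norm_lt_if_same_cell c) auto
    then show ?thesis using r by (simp add: dist_norm)
  qed
  have neq: "\<not> proj1 v < proj1 w" if "v \<in> S" "w \<in> S" "?cell v = ?cell w" for v w
  proof
    assume less: "proj1 v < proj1 w"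
    have ahead: "points_ahead v \<phi> \<noteq> {}" using that(1) by (simp add: S)
    have "w \<in> \<phi>" using that(2) by (simp add: S)
    then have "w \<notin> preferred v (dst_nav v \<phi>)" using dst_nav_ahead(3)[OF fin ahead] by auto
    then have "dist v (dst_nav v \<phi>) \<le> dist v w" using less by (auto simp: preferred_def)
    then show False using that(1) aux[OF that(3)] by (auto simp: S)
  qed
  have "inj_on ?cell S"
  proof (rule inj_onI)
    fix v w assume vw: "v \<in> S" "w \<in> S" "?cell v = ?cell w"
    have "proj1 v = proj1 w" using neq[OF vw] neq[OF vw(2,1) vw(3)[symmetric]] by linarith
    then show "v = w" using inj vw(1,2) by (auto simp: S dest: inj_onD)
  qed
  then have card: "card S = card (?cell ` S)" by (rule card_image[symmetric])
  \<comment> \<open>The edge has length at most \<open>2 * r\<close>: its starting point is at most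
    \<open>2 * r\<close> behind the hyperplane and within \<open>g + 2 * r\<close> of
    \<open>a\<close>. In the first direction the number of cells is therefore independent of
    \<open>g\<close>, and only \<open>CARD('d) - 1\<close> directions see the ratio
    \<open>g / r\<close>.\<close>
  let ?lo = "\<lambda>i. if i = Min UNIV then ?c * (a $ i - 2 * r) else ?c * (a $ i - (g + 2 * r))"
  let ?n = "\<lambda>i::'d. if i = Min UNIV then ?c * (2 * r) else ?c * (2 * (g + 2 * r))"
  have lo: "?lo i \<le> ?c * v $ i \<and> ?c * v $ i \<le> ?lo i + ?n i" if "v \<in> S" for v i
  proof -
    have b: "dist a v \<le> g + 2 * r" "proj1 a - 2 * r \<le> proj1 v" "proj1 v \<le> proj1 a"
      using that edges_meeting_bounds[of v "dst_nav v \<phi>" a g "2 * r"] by (auto simp: S)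
    show ?thesis
    proof (cases "i = Min UNIV")
      case True
      then have "a $ i - 2 * r \<le> v $ i" "v $ i \<le> (a $ i - 2 * r) + 2 * r" using b by (auto simp: proj1_def)
      then have "?c * (a $ i - 2 * r) \<le> ?c * v $ i" "?c * v $ i \<le> ?c * ((a $ i - 2 * r) + 2 * r)"
        using c by (auto intro!: mult_left_mono simp del: times_divide_eq_left)
      then show ?thesis using True unfolding distrib_left[of ?c "_ - _"] by simp
    next
      case False
      have "\<bar>(a - v) $ i\<bar> \<le> dist a v" unfolding dist_norm by (rule component_le_norm_cart)
      then have "a $ i - (g + 2 * r) \<le> v $ i" "v $ i \<le> (a $ i - (g + 2 * r)) + 2 * (g + 2 * r)"
        using b(1) by auto
      then have "?c * (a $ i - (g + 2 * r)) \<le> ?c * v $ i"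
        "?c * v $ i \<le> ?c * ((a $ i - (g + 2 * r)) + 2 * (g + 2 * r))"
        using c by (auto intro!: mult_left_mono simp del: times_divide_eq_left)
      then show ?thesis using False unfolding distrib_left[of ?c "_ - _"] by simp
    qed
  qed
  have "real (card (?cell ` S)) \<le> (\<Prod>i\<in>UNIV. ?n i + 2)"
    by (rule card_vec_cells_le(2)[OF _ lo]) (use c r g in \<open>auto intro!: mult_nonneg_nonneg\<close>)
  also have "\<dots> = (\<Prod>i\<in>(UNIV :: 'd set). if i = Min UNIV then ?c * (2 * r) + 2 else ?c * (2 * (g + 2 * r)) + 2)"
    by (intro prod.cong) auto
  also have "\<dots> = (?c * (2 * r) + 2) * (?c * (2 * (g + 2 * r)) + 2) ^ (CARD('d) - 1)"
    by (rule prod_Min_UNIV)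
  \<comment> \<open>The constant \<open>6\<close> is generous: since \<open>1 \<le> ?d\<close>, both
    \<open>2 * ?d + 2\<close> and \<open>4 * ?d + 2\<close> are at most
    \<open>6 * ?d\<close>.\<close>
  also have "\<dots> \<le> (6 * ?d) * (6 * ?d * (g / r + 1)) ^ (CARD('d) - 1)"
  proof (intro mult_mono power_mono)
    have eq: "?c * (2 * r) = 2 * ?d" using r by simp
    show "?c * (2 * r) + 2 \<le> 6 * ?d" unfolding eq using d1 by linarith
    have "?c * (2 * (g + 2 * r)) + 2 = 2 * (?d * (g / r)) + 4 * ?d + 2"
      using r by (simp add: field_simps)
    also have "\<dots> \<le> 6 * (?d * (g / r)) + 6 * ?d"
    proof -
      have aux: "2 * q + 4 * D + 2 \<le> 6 * q + 6 * D" if "0 \<le> q" "1 \<le> D" for q D :: real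
        using that by linarith
      show ?thesis by (rule aux[OF _ d1]) (use r g in simp)
    qed
    finally show "?c * (2 * (g + 2 * r)) + 2 \<le> 6 * ?d * (g / r + 1)" by (simp add: algebra_simps)
  qed (use r g in auto)
  finally show ?thesis unfolding card .
qed

lemma card_long_edges_le_sum:
  fixes a :: "real ^ 'd::{finite,linorder}"
  assumes fin: "finite \<phi>" and inj: "inj_on proj1 \<phi>" and R: "0 < R" and g: "0 < g"
  shows "real (card {y \<in> \<phi>. points_ahead y \<phi> \<noteq> {} \<and>
      (y, dst_nav y \<phi>) \<in> edges_meeting (cball a g \<inter> {w. proj1 w = proj1 a}) \<and>
      R < dist y (dst_nav y \<phi>) \<and> dist y (dst_nav y \<phi>) \<le> R * 2 ^ n})
    \<le> (\<Sum>k<n. 6 * real CARD('d) * (6 * real CARD('d) * (g / (R * 2 ^ k) + 1)) ^ (CARD('d) - 1))"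
    (is "real (card (?T n)) \<le> (\<Sum>k<n. ?B k)")
proof (induction n)
  case 0
  have "?T 0 = {}" by auto
  then have "card (?T 0) = 0" by (simp only: card.empty)
  then show ?case by simp
next
  case (Suc n)
  let ?S = "{y \<in> \<phi>. points_ahead y \<phi> \<noteq> {} \<and>
      (y, dst_nav y \<phi>) \<in> edges_meeting (cball a g \<inter> {w. proj1 w = proj1 a}) \<and>
      R * 2 ^ n < dist y (dst_nav y \<phi>) \<and> dist y (dst_nav y \<phi>) \<le> 2 * (R * 2 ^ n)}"
  have "?T (Suc n) \<subseteq> ?T n \<union> ?S" by (auto simp: not_le mult.commute mult.left_commute)
  then have "card (?T (Suc n)) \<le> card (?T n \<union> ?S)" by (rule card_mono[rotated]) (use fin in auto)
  also have "\<dots> \<le> card (?T n) + card ?S" by (rule card_Un_le)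
  finally have "real (card (?T (Suc n))) \<le> real (card (?T n)) + real (card ?S)" by linarith
  also have "\<dots> \<le> (\<Sum>k<n. ?B k) + ?B n"
    using R by (intro add_mono Suc.IH card_dyadic_edges_le[OF fin inj _ g refl]) auto
  finally show ?case by simp
qed

text \<open>The diameter bound leaves \<open>n\<close> dyadic scales above \<open>R\<close>. Taking
  \<open>g\<close> out of the base, scale \<open>k\<close> contributes a power of
  \<open>(1 / R) * (1 / 2) ^ k + 1 / g\<close>. The first summands form a geometric series with sum
  at most \<open>2 / R\<close>, the second ones add up to \<open>n / g\<close>.\<close>

lemma pair_count_long_edges_le:
  fixes a :: "real ^ 'd::{finite,linorder}"
  assumes fin: "finite \<phi>" and inj: "inj_on proj1 \<phi>" and R: "2 \<le> R" and g: "2 \<le> g"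
    and d: "2 \<le> CARD('d)" and diam: "\<And>y z. y \<in> \<phi> \<Longrightarrow> z \<in> \<phi> \<Longrightarrow> dist y z \<le> 2 ^ n"
  shows "pair_count (long_edges (cball a g \<inter> {w. proj1 w = proj1 a}) R) preferred \<phi>
    \<le> ennreal ((6 * real CARD('d)) ^ CARD('d) * g ^ (CARD('d) - 1) * (2 / R + real n / g))"
proof -
  let ?k = "CARD('d) - 1" and ?C = "6 * real CARD('d)"
  let ?I = "cball a g \<inter> {w. proj1 w = proj1 a}"
  let ?T = "{y \<in> \<phi>. points_ahead y \<phi> \<noteq> {} \<and> (y, dst_nav y \<phi>) \<in> long_edges ?I R}"
  have "?T \<subseteq> {y \<in> \<phi>. points_ahead y \<phi> \<noteq> {} \<and> (y, dst_nav y \<phi>) \<in> edges_meeting ?I \<and>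
      R < dist y (dst_nav y \<phi>) \<and> dist y (dst_nav y \<phi>) \<le> R * 2 ^ n}" (is "_ \<subseteq> ?T'")
  proof
    fix y assume "y \<in> ?T"
    then have y: "y \<in> \<phi>" "points_ahead y \<phi> \<noteq> {}" "(y, dst_nav y \<phi>) \<in> long_edges ?I R" by auto
    have "dist y (dst_nav y \<phi>) \<le> 1 * 2 ^ n" using diam[OF y(1) dst_nav_ahead(1)[OF fin y(2)]] by simp
    also have "\<dots> \<le> R * 2 ^ n" using R by (intro mult_right_mono) auto
    finally show "y \<in> ?T'" using y by (simp add: long_edges_def)
  qed
  then have "real (card ?T) \<le> real (card ?T')"
    using fin by (intro of_nat_mono card_mono) auto
  also have "\<dots> \<le> (\<Sum>k<n. ?C * (?C * (g / (R * 2 ^ k) + 1)) ^ ?k)"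
    using R g by (intro card_long_edges_le_sum fin inj) auto
  also have "\<dots> \<le> (\<Sum>k<n. ?C ^ CARD('d) * g ^ ?k * ((1 / R) * (1 / 2) ^ k + 1 / g))"
  proof (intro sum_mono)
    fix k
    let ?q = "(1 / R) * (1 / 2) ^ k + 1 / g"
    have "g / (R * 2 ^ k) + 1 = g * ?q" using g by (simp add: field_simps power_one_over)
    then have "?C * (?C * (g / (R * 2 ^ k) + 1)) ^ ?k = ?C * ?C ^ ?k * g ^ ?k * ?q ^ ?k"
      by (simp only: power_mult_distrib mult.assoc)
    also have "?C * ?C ^ ?k = ?C ^ CARD('d)" by (metis power_Suc Suc_diff_1 zero_less_card_finite)
    \<comment> \<open>The base is at most \<open>1\<close> because both \<open>R\<close> and
      \<open>g\<close> are at least \<open>2\<close>, and the exponent is at least \<open>1\<close>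
      because the dimension is at least two. For exponent \<open>0\<close> there would be no decay
      in \<open>k\<close>.\<close>
    also have "?q ^ ?k \<le> ?q ^ 1"
    proof (rule power_decreasing)
      have "(1 / R) * (1 / 2) ^ k \<le> (1 / 2) * 1"
        using R by (intro mult_mono power_le_one) (auto simp: field_simps)
      moreover have "1 / g \<le> 1 / 2" using g by (simp add: field_simps)
      ultimately show "?q \<le> 1" by linarith
    qed (use R g d in auto)
    finally show "?C * (?C * (g / (R * 2 ^ k) + 1)) ^ ?k \<le> ?C ^ CARD('d) * g ^ ?k * ?q"
      using g by (simp add: mult_left_mono)
  qed
  also have "\<dots> = ?C ^ CARD('d) * g ^ ?k * ((1 / R) * (\<Sum>k<n. (1 / 2) ^ k) + real n / g)"
    unfolding sum_distrib_left[symmetric] sum.distrib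
    by (simp only: sum_constant card_lessThan times_divide_eq_right mult_1_right)
  also have "\<dots> \<le> ?C ^ CARD('d) * g ^ ?k * (2 / R + real n / g)"
  proof (intro mult_left_mono add_right_mono)
    have "(\<Sum>k<n. (1 / 2) ^ k) = 2 - 2 * (1 / 2 :: real) ^ n" by (induction n) auto
    then have "(\<Sum>k<n. (1 / 2) ^ k) \<le> (2 :: real)" by simp
    then have "(1 / R) * (\<Sum>k<n. (1 / 2) ^ k) \<le> (1 / R) * 2" using R by (intro mult_left_mono) auto
    then show "(1 / R) * (\<Sum>k<n. (1 / 2) ^ k) \<le> 2 / R" by simp
  qed (use g in auto)
  finally have card: "real (card ?T) \<le> ?C ^ CARD('d) * g ^ ?k * (2 / R + real n / g)" .
  have "pair_count (long_edges ?I R) preferred \<phi> = of_nat (card ?T)"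
    by (rule pair_count_preferred[OF fin]) (auto simp: long_edges_def edges_meeting_def)
  then show ?thesis using card by (simp add: ennreal_of_nat_eq_real_of_nat ennreal_leI)
qed

section \<open>Short edges\<close>

lemma preferred_translate: "preferred y z = (\<lambda>w. w - y) -` preferred 0 (z - y)"
proof -
  have "less_fun (vec_nth (w - y)) (vec_nth (z - y)) \<longleftrightarrow> less_fun (vec_nth w) (vec_nth z)" for w
    by (simp add: less_fun_def)
  then show ?thesis
    by (auto simp: preferred_def dist_norm norm_minus_commute)
qed

lemma sets_preferred_section: "preferred y z \<in> sets borel"
proof -
  have "(\<lambda>w. (y, z, w)) \<in> measurable borel (borel \<Otimes>\<^sub>M (borel \<Otimes>\<^sub>M borel))" by measurable
  from measurable_sets[OF this sets_preferred] show ?thesis by (simp add: vimage_def)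
qed

lemma preferred_subset_cball: "preferred y z \<subseteq> cball y (dist y z)"
  by (auto simp: preferred_def)

definition preferred_vol :: "real ^ 'd::{finite,linorder} \<Rightarrow> real" where
  "preferred_vol v = measure lborel (preferred 0 v)"

lemma emeasure_preferred: "emeasure lborel (preferred y z) = ennreal (preferred_vol (z - y))"
proof -
  have fin: "emeasure lborel (preferred 0 v) < \<infinity>" for v :: "real ^ 'd::{finite,linorder}"
    using emeasure_bounded_finite[OF bounded_subset[OF bounded_cball preferred_subset_cball]] by simp
  have "emeasure lborel (preferred 0 (z - y)) = emeasure (distr lborel borel ((+) (- y))) (preferred 0 (z - y))"
    by (simp add: lborel_distr_plus)
  also have "\<dots> = emeasure lborel (preferred y z)"
    using sets_preferred_section by (subst emeasure_distr) (auto simp: preferred_translate[of y z] vimage_def)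
  finally have eq: "emeasure lborel (preferred 0 (z - y)) = emeasure lborel (preferred y z)" .
  show ?thesis
    unfolding preferred_vol_def eq[symmetric] using fin[of "z - y"]
    by (intro emeasure_eq_ennreal_measure) (simp add: less_top)
qed

lemma preferred_vol_nonneg: "0 \<le> preferred_vol v"
  by (simp add: preferred_vol_def)

lemma preferred_vol_le:
  fixes v :: "real ^ 'd::{finite,linorder}"
  assumes "norm v \<le> R"
  shows "preferred_vol v \<le> measure lborel (cball (0 :: (real, 'd) vec) R)"
  unfolding preferred_vol_def using assms preferred_subset_cball[of 0 v] sets_preferred_section
  by (intro measure_mono_fmeasurable) (auto simp: dist_norm fmeasurable_def emeasure_bounded_finite[unfolded infinity_ennreal_def])

lemma borel_measurable_preferred_vol [measurable]: "preferred_vol \<in> borel_measurable borel"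
proof -
  let ?Q = "{(v, w). w \<in> preferred 0 (v :: real ^ 'd::{finite,linorder})}"
  have "(\<lambda>p. (0, fst p, snd p)) \<in> measurable (borel \<Otimes>\<^sub>M lborel) (borel \<Otimes>\<^sub>M (borel \<Otimes>\<^sub>M borel))"
    by measurable
  from measurable_sets[OF this sets_preferred] have "?Q \<in> sets (borel \<Otimes>\<^sub>M lborel)"
    by (simp add: vimage_def space_pair_measure split_def)
  from lborel.measurable_emeasure_Pair[OF this] 
  have "(\<lambda>v. emeasure lborel (preferred 0 v)) \<in> borel_measurable (borel :: (real ^ 'd::{finite,linorder}) measure)"
    by (simp add: vimage_def)
  then show ?thesis unfolding preferred_vol_def[abs_def] measure_def by measurable
qed

lemma sets_short_edges:
  fixes a :: "real ^ 'd::{finite,linorder}"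
  shows "short_edges (cball a g \<inter> {w. proj1 w = proj1 a}) R \<in> sets (borel \<Otimes>\<^sub>M borel)"
proof -
  have "{(y, z). dist y z \<le> R} = {p \<in> space (borel \<Otimes>\<^sub>M borel). dist (fst p) (snd p :: (real, 'd) vec) \<le> R}"
    by (auto simp: space_pair_measure)
  also have "\<dots> \<in> sets (borel \<Otimes>\<^sub>M borel)" by measurable
  finally show ?thesis unfolding short_edges_def by (rule sets.Int[OF sets_edges_meeting])
qed

text \<open>The weight \<open>proj1 v\<close> is the height of the cylinder of starting points whose
  edge with displacement \<open>v\<close> crosses the section; the exponential is the void
  probability at constant intensity \<open>b\<close>.\<close>

definition edge_integral :: "real \<Rightarrow> real \<Rightarrow> 'd::{finite,linorder} itself \<Rightarrow> ennreal" where
  "edge_integral b R _ = (\<integral>\<^sup>+ v. of_bool (0 < proj1 v \<and> norm v \<le> R) *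
     ennreal (proj1 v * exp (- b * preferred_vol v)) \<partial>(lborel :: ((real, 'd) vec) measure))"

text \<open>Fubini and the substitution \<open>z = y + v\<close>; for each displacement \<open>v\<close> the admissible starting
  points form a slanted cylinder, which is squeezed between two straight ones.\<close>

lemma nn_integral_short_edges_bounds:
  fixes a :: "real ^ 'd::{finite,linorder}" and b :: real
  assumes R: "0 < R" "R < g"
  defines "W \<equiv> (\<integral>\<^sup>+ y. \<integral>\<^sup>+ z. indicator (short_edges (cball a g \<inter> {w. proj1 w = proj1 a}) R) (y, z) *
      ennreal (exp (- b * preferred_vol (z - y))) \<partial>lborel \<partial>lborel)"
  shows "ennreal (unit_cylinder_vol TYPE('d) * (g - R) ^ (CARD('d) - 1)) * edge_integral b R TYPE('d) \<le> W"
    and "W \<le> ennreal (unit_cylinder_vol TYPE('d) * (g + R) ^ (CARD('d) - 1)) * edge_integral b R TYPE('d)"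
proof -
  let ?k = "CARD('d) - 1" and ?\<zeta> = "unit_cylinder_vol TYPE('d)"
  let ?E = "edges_meeting (cball a g \<inter> {w. proj1 w = proj1 a})"
  let ?S = "short_edges (cball a g \<inter> {w. proj1 w = proj1 a}) R"
  let ?h = "\<lambda>v. of_bool (0 < proj1 v \<and> norm v \<le> R) * ennreal (proj1 v * exp (- b * preferred_vol v))"
  have E: "?E \<in> sets (borel \<Otimes>\<^sub>M borel)" by (rule sets_edges_meeting)
  have S[measurable]: "?S \<in> sets (borel \<Otimes>\<^sub>M borel)" by (rule sets_short_edges)
  have Ev: "{y. (y, y + v) \<in> ?E} \<in> sets borel" for v
  proof -
    have "(\<lambda>y. (y, y + v)) \<in> measurable borel (borel \<Otimes>\<^sub>M borel)" by measurable
    from measurable_sets[OF this E] show ?thesis by (simp add: vimage_def)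
  qed
  have meas1: "(\<lambda>z. indicator ?S (y, z) * ennreal (exp (- b * preferred_vol (z - y)))) \<in> borel_measurable borel" for y
    by measurable
  have "W = (\<integral>\<^sup>+ y. \<integral>\<^sup>+ v. indicator ?S (y, y + v) * ennreal (exp (- b * preferred_vol v)) \<partial>lborel \<partial>lborel)"
    unfolding W_def
  proof (rule nn_integral_cong)
    fix y
    have "(\<integral>\<^sup>+ z. indicator ?S (y, z) * ennreal (exp (- b * preferred_vol (z - y))) \<partial>lborel) =
      (\<integral>\<^sup>+ z. indicator ?S (y, z) * ennreal (exp (- b * preferred_vol (z - y))) \<partial>distr lborel borel ((+) y))"
      by (simp add: lborel_distr_plus)
    also have "\<dots> = (\<integral>\<^sup>+ v. indicator ?S (y, y + v) * ennreal (exp (- b * preferred_vol v)) \<partial>lborel)"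
      using meas1 by (subst nn_integral_distr) auto
    finally show "(\<integral>\<^sup>+ z. indicator ?S (y, z) * ennreal (exp (- b * preferred_vol (z - y))) \<partial>lborel) =
      (\<integral>\<^sup>+ v. indicator ?S (y, y + v) * ennreal (exp (- b * preferred_vol v)) \<partial>lborel)" .
  qed
  also have "\<dots> = (\<integral>\<^sup>+ v. \<integral>\<^sup>+ y. indicator ?S (y, y + v) * ennreal (exp (- b * preferred_vol v)) \<partial>lborel \<partial>lborel)"
    by (rule lborel_pair.Fubini') measurable
  also have "\<dots> = (\<integral>\<^sup>+ v. of_bool (0 < proj1 v \<and> norm v \<le> R) * (ennreal (exp (- b * preferred_vol v)) *
      emeasure lborel {y. (y, y + v) \<in> ?E}) \<partial>lborel)"
  proof (rule nn_integral_cong)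
    fix v :: "(real, 'd) vec"
    have "(y, y + v) \<in> ?S \<longleftrightarrow> norm v \<le> R \<and> (y, y + v) \<in> ?E" for y
      by (auto simp: short_edges_def dist_norm)
    moreover have "\<not> 0 < proj1 v \<Longrightarrow> (y, y + v) \<notin> ?E" for y by (simp add: edges_meeting_def)
    ultimately have "(\<integral>\<^sup>+ y. indicator ?S (y, y + v) * ennreal (exp (- b * preferred_vol v)) \<partial>lborel) =
      (\<integral>\<^sup>+ y. (of_bool (0 < proj1 v \<and> norm v \<le> R) * ennreal (exp (- b * preferred_vol v))) *
        indicator {y. (y, y + v) \<in> ?E} y \<partial>lborel)"
      by (intro nn_integral_cong) (auto split: split_indicator)
    also have "\<dots> = of_bool (0 < proj1 v \<and> norm v \<le> R) * (ennreal (exp (- b * preferred_vol v)) *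
      emeasure lborel {y. (y, y + v) \<in> ?E})"
      using Ev by (subst nn_integral_cmult_indicator) (auto simp: mult.assoc)
    finally show "(\<integral>\<^sup>+ y. indicator ?S (y, y + v) * ennreal (exp (- b * preferred_vol v)) \<partial>lborel) =
      of_bool (0 < proj1 v \<and> norm v \<le> R) * (ennreal (exp (- b * preferred_vol v)) *
      emeasure lborel {y. (y, y + v) \<in> ?E})" .
  qed
  finally have W: "W = (\<integral>\<^sup>+ v. of_bool (0 < proj1 v \<and> norm v \<le> R) * (ennreal (exp (- b * preferred_vol v)) *
      emeasure lborel {y. (y, y + v) \<in> ?E}) \<partial>lborel)" .
  have cyl: "emeasure lborel (cylinder a (proj1 v) \<rho>) = ennreal (?\<zeta> * \<rho> ^ ?k) * ennreal (proj1 v)"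
    if "0 < proj1 v" "0 < \<rho>" for v :: "(real, 'd) vec" and \<rho>
    using that unit_cylinder_vol_pos[where 'd='d]
    by (simp add: emeasure_cylinder emeasure_unit_cylinder ennreal_mult[symmetric] mult_ac)
  have J: "ennreal C * edge_integral b R TYPE('d) =
      (\<integral>\<^sup>+ v. ennreal C * ?h (v :: (real, 'd) vec) \<partial>lborel)" for C
    unfolding edge_integral_def by (rule nn_integral_cmult[symmetric]) measurable
  show "ennreal (?\<zeta> * (g - R) ^ ?k) * edge_integral b R TYPE('d) \<le> W"
    unfolding J W
  proof (rule nn_integral_mono)
    fix v :: "(real, 'd) vec"
    show "ennreal (?\<zeta> * (g - R) ^ ?k) * ?h v \<le>
      of_bool (0 < proj1 v \<and> norm v \<le> R) * (ennreal (exp (- b * preferred_vol v)) * emeasure lborel {y. (y, y + v) \<in> ?E})"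
    proof (cases "0 < proj1 v \<and> norm v \<le> R")
      case True
      then have v: "0 < proj1 v" "norm v \<le> R" by auto
      have "ennreal (?\<zeta> * (g - R) ^ ?k) * ennreal (proj1 v) \<le> emeasure lborel {y. (y, y + v) \<in> ?E}"
      proof -
        have "emeasure lborel (cylinder a (proj1 v) (g - R)) \<le> emeasure lborel {y. (y, y + v) \<in> ?E}"
          by (rule emeasure_mono[OF edges_translate_bounds(1)[OF v]]) (use Ev in simp)
        then show ?thesis using cyl[OF v(1), of "g - R"] R by simp
      qed
      then have "ennreal (exp (- b * preferred_vol v)) * (ennreal (?\<zeta> * (g - R) ^ ?k) * ennreal (proj1 v)) \<le>
        ennreal (exp (- b * preferred_vol v)) * emeasure lborel {y. (y, y + v) \<in> ?E}"
        by (rule mult_left_mono) simp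
      then show ?thesis using v by (simp add: ennreal_mult mult_ac)
    qed auto
  qed
  show "W \<le> ennreal (?\<zeta> * (g + R) ^ ?k) * edge_integral b R TYPE('d)"
    unfolding J W
  proof (rule nn_integral_mono)
    fix v :: "(real, 'd) vec"
    show "of_bool (0 < proj1 v \<and> norm v \<le> R) * (ennreal (exp (- b * preferred_vol v)) * emeasure lborel {y. (y, y + v) \<in> ?E})
      \<le> ennreal (?\<zeta> * (g + R) ^ ?k) * ?h v"
    proof (cases "0 < proj1 v \<and> norm v \<le> R")
      case True
      then have v: "0 < proj1 v" "norm v \<le> R" by auto
      have "emeasure lborel {y. (y, y + v) \<in> ?E} \<le> ennreal (?\<zeta> * (g + R) ^ ?k) * ennreal (proj1 v)"
      proof -
        have "emeasure lborel {y. (y, y + v) \<in> ?E} \<le> emeasure lborel (cylinder a (proj1 v) (g + R))"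
          by (rule emeasure_mono[OF edges_translate_bounds(2)[OF v]]) simp
        then show ?thesis using cyl[OF v(1), of "g + R"] R by simp
      qed
      then have "ennreal (exp (- b * preferred_vol v)) * emeasure lborel {y. (y, y + v) \<in> ?E} \<le>
        ennreal (exp (- b * preferred_vol v)) * (ennreal (?\<zeta> * (g + R) ^ ?k) * ennreal (proj1 v))"
        by (rule mult_left_mono) simp
      then show ?thesis using v by (simp add: ennreal_mult mult_ac)
    qed auto
  qed
qed

lemma edge_integral_le:
  assumes "0 \<le> b" "0 \<le> R"
  shows "edge_integral b R TYPE('d::{finite,linorder}) \<le> ennreal (R * measure lborel (cball (0 :: (real, 'd) vec) R))"
proof -
  have "edge_integral b R TYPE('d) \<le> (\<integral>\<^sup>+ v. ennreal R * indicator (cball (0 :: (real, 'd) vec) R) v \<partial>lborel)"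
    unfolding edge_integral_def
  proof (rule nn_integral_mono)
    fix v :: "(real, 'd) vec"
    show "of_bool (0 < proj1 v \<and> norm v \<le> R) * ennreal (proj1 v * exp (- b * preferred_vol v))
      \<le> ennreal R * indicator (cball 0 R) v"
    proof (cases "0 < proj1 v \<and> norm v \<le> R")
      case True
      have "proj1 v * exp (- b * preferred_vol v) \<le> R * 1"
      proof (rule mult_mono)
        show "proj1 v \<le> R" using True component_le_norm_cart[of v "Min UNIV"] by (simp add: proj1_def)
        show "exp (- b * preferred_vol v) \<le> 1" using assms(1) preferred_vol_nonneg[of v] by simp
      qed (use assms in auto)
      then show ?thesis using True by (auto intro: ennreal_leI)
    qed auto
  qed
  also have "\<dots> = ennreal R * emeasure lborel (cball (0 :: (real, 'd) vec) R)"
    by (rule nn_integral_cmult_indicator) simp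
  also have "\<dots> = ennreal (R * measure lborel (cball (0 :: (real, 'd) vec) R))"
    using assms emeasure_bounded_finite[OF bounded_cball, of "0 :: (real, 'd) vec" R]
    by (simp add: emeasure_eq_ennreal_measure less_top ennreal_mult)
  finally show ?thesis .
qed

text \<open>For \<open>norm v \<le> R\<close> the preferred region lies in a ball of radius
  \<open>R\<close>, so raising the intensity from \<open>b\<close> to \<open>b'\<close> lowers the
  void probability by at most the factor in front. For fixed \<open>R\<close> this factor tends to
  \<open>1\<close> as the intensities approach each other.\<close>

lemma edge_integral_mono:
  fixes b b' R :: real
  assumes "b \<le> b'" "0 \<le> R"
  defines "\<mu> \<equiv> measure lborel (cball (0 :: real ^ 'd::{finite,linorder}) R)"
  shows "edge_integral b R TYPE('d) \<le> ennreal (exp ((b' - b) * \<mu>)) * edge_integral b' R TYPE('d)"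
proof -
  have "edge_integral b R TYPE('d) \<le> (\<integral>\<^sup>+ v. ennreal (exp ((b' - b) * \<mu>)) * (of_bool (0 < proj1 v \<and> norm v \<le> R) *
     ennreal (proj1 v * exp (- b' * preferred_vol v))) \<partial>(lborel :: ((real, 'd) vec) measure))"
    unfolding edge_integral_def
  proof (rule nn_integral_mono)
    fix v :: "(real, 'd) vec"
    show "of_bool (0 < proj1 v \<and> norm v \<le> R) * ennreal (proj1 v * exp (- b * preferred_vol v)) \<le>
      ennreal (exp ((b' - b) * \<mu>)) * (of_bool (0 < proj1 v \<and> norm v \<le> R) * ennreal (proj1 v * exp (- b' * preferred_vol v)))"
    proof (cases "0 < proj1 v \<and> norm v \<le> R")
      case True
      have "(b' - b) * preferred_vol v \<le> (b' - b) * \<mu>"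
        unfolding \<mu>_def using assms(1) True by (intro mult_left_mono preferred_vol_le) auto
      then have "exp (- b * preferred_vol v) \<le> exp ((b' - b) * \<mu>) * exp (- b' * preferred_vol v)"
        by (simp add: exp_add[symmetric] algebra_simps)
      then have "proj1 v * exp (- b * preferred_vol v) \<le> exp ((b' - b) * \<mu>) * (proj1 v * exp (- b' * preferred_vol v))"
        using True mult_left_mono[of _ _ "proj1 v"] by (simp add: mult.left_commute)
      then show ?thesis using True by (simp add: ennreal_mult'[symmetric] ennreal_leI)
    qed auto
  qed
  also have "\<dots> = ennreal (exp ((b' - b) * \<mu>)) * edge_integral b' R TYPE('d)"
    unfolding edge_integral_def by (rule nn_integral_cmult) measurable
  finally show ?thesis .
qed

lemma edge_integral_pos:
  assumes "0 < R"
  shows "0 < edge_integral b R TYPE('d::{finite,linorder})"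
proof (rule ccontr)
  let ?h = "\<lambda>v :: (real, 'd) vec. of_bool (0 < proj1 v \<and> norm v \<le> R) * ennreal (proj1 v * exp (- b * preferred_vol v))"
  \<comment> \<open>This ball touches the origin from ahead, so on it the integrand does not
    vanish.\<close>
  let ?b = "ball ((R / 2) *\<^sub>R first_axis :: (real, 'd) vec) (R / 2)"
  assume "\<not> 0 < edge_integral b R TYPE('d)"
  then have "(\<integral>\<^sup>+ v. ?h v \<partial>lborel) = 0" unfolding edge_integral_def by simp
  then have "AE v in lborel. ?h v = 0" by (subst (asm) nn_integral_0_iff_AE) auto
  moreover have "?h v \<noteq> 0" if "v \<in> ?b" for v
  proof -
    let ?w = "v - (R / 2) *\<^sub>R first_axis"
    have w: "norm ?w < R / 2" using that by (simp add: dist_norm norm_minus_commute)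
    have "\<bar>proj1 ?w\<bar> \<le> norm ?w" unfolding proj1_def by (rule component_le_norm_cart)
    moreover have "proj1 ?w = proj1 v - R / 2" by (simp add: proj1_def)
    ultimately have "0 < proj1 v" using w by linarith
    moreover have "norm v \<le> norm ((R / 2) *\<^sub>R (first_axis :: (real, 'd) vec)) + norm ?w"
      by (rule norm_triangle_sub)
    then have "norm v \<le> R" using w assms by (simp add: norm_axis_1)
    ultimately show ?thesis by (simp add: zero_less_mult_iff not_le)
  qed
  ultimately have "AE v in lborel. v \<notin> ?b"
    by (auto elim!: eventually_mono)
  then have "?b \<in> null_sets lborel"
    by (simp add: AE_iff_null_sets)
  then have "measure lborel ?b = 0"
    by (simp add: null_setsD1 measure_def)
  moreover have "0 < measure lborel ?b"
    using assms by (intro content_ball_pos) simp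
  ultimately show False by simp
qed

section \<open>Comparison of the intensity with Lebesgue measure\<close>

context bounded_poisson_process
begin

lemma nn_integral_intensity_bounds:
  assumes h: "h \<in> borel_measurable borel" and supp: "\<And>y. y \<notin> V \<Longrightarrow> h y = 0"
    and V: "V \<subseteq> U" and c: "\<And>y. y \<in> V \<Longrightarrow> c1 \<le> f y \<and> f y \<le> c2"
  shows "ennreal c1 * (\<integral>\<^sup>+ y. h y \<partial>lborel) \<le> (\<integral>\<^sup>+ y. h y \<partial>intensity)"
    and "(\<integral>\<^sup>+ y. h y \<partial>intensity) \<le> ennreal c2 * (\<integral>\<^sup>+ y. h y \<partial>lborel)"
proof -
  have "ennreal c1 * h y \<le> ennreal (f y) * indicator U y * h y \<and> ennreal (f y) * indicator U y * h y \<le> ennreal c2 * h y" for y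
    using c[of y] supp[of y] V by (cases "y \<in> V") (auto intro!: mult_right_mono ennreal_leI simp: indicator_def)
  then show "ennreal c1 * (\<integral>\<^sup>+ y. h y \<partial>lborel) \<le> (\<integral>\<^sup>+ y. h y \<partial>intensity)"
    "(\<integral>\<^sup>+ y. h y \<partial>intensity) \<le> ennreal c2 * (\<integral>\<^sup>+ y. h y \<partial>lborel)"
    unfolding nn_integral_intensity[OF h] using h
    by (subst nn_integral_cmult[symmetric], simp, intro nn_integral_mono, simp)+
qed

lemma measure_intensity_bounds:
  assumes B: "B \<in> sets borel" "B \<subseteq> U" and c: "\<And>y. y \<in> B \<Longrightarrow> c1 \<le> f y \<and> f y \<le> c2" "0 \<le> c2"
    and fin: "emeasure lborel B = ennreal m" "0 \<le> m"
  shows "c1 * m \<le> measure intensity B" "measure intensity B \<le> c2 * m"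
proof -
  have supp: "y \<notin> B \<Longrightarrow> indicator B y = (0 :: ennreal)" for y by simp
  have "ennreal c1 * (\<integral>\<^sup>+ y. indicator B y \<partial>lborel) \<le> (\<integral>\<^sup>+ y. indicator B y \<partial>intensity)"
    "(\<integral>\<^sup>+ y. indicator B y \<partial>intensity) \<le> ennreal c2 * (\<integral>\<^sup>+ y. indicator B y \<partial>lborel)"
    using B c by (intro nn_integral_intensity_bounds[where V=B and ?c1.0=c1 and ?c2.0=c2]; simp)+
  then have "ennreal (c1 * m) \<le> ennreal (measure intensity B)" "ennreal (measure intensity B) \<le> ennreal (c2 * m)"
    using B fin c(2) by (simp_all add: ennreal_mult'' ennreal_mult intensity.emeasure_eq_measure)
  then show "c1 * m \<le> measure intensity B" "measure intensity B \<le> c2 * m"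
    using c(2) fin(2) by (auto simp: ennreal_le_iff2 intro: order_trans)
qed

end

lemma pair_count_Un:
  assumes "P \<inter> Q = {}"
  shows "pair_count (P \<union> Q) T \<phi> = pair_count P T \<phi> + pair_count Q T \<phi>"
proof -
  have "indicator (P \<union> Q) p = indicator P p + (indicator Q p :: ennreal)" for p
    using assms by (auto split: split_indicator)
  then show ?thesis by (simp add: pair_count_def distrib_right sum.distrib)
qed

lemma not_in_preferred: "y \<notin> preferred y z" "z \<notin> preferred y z"
  by (auto simp: preferred_def less_fun_irrefl)

locale cartesian_poisson_process = bounded_poisson_process M U f X
  for M :: "'w measure" and U :: "(real ^ 'd::{finite,linorder}) set" and f X
begin

text \<open>The two endpoints contribute the square of an intensity bound. Void probabilities
  decrease with the intensity, so the lower bound combines \<open>c1\<close> in front with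
  \<open>c2\<close> in the exponent, and the upper bound does the opposite.\<close>

lemma nn_integral_short_edges:
  fixes a :: "real ^ 'd::{finite,linorder}"
  assumes R: "0 < R" "R < g" and c: "0 \<le> c1" "0 \<le> c2"
    and f: "\<And>y. dist a y \<le> g + 2 * R \<Longrightarrow> y \<in> U \<and> c1 \<le> f y \<and> f y \<le> c2"
  defines "N \<equiv> \<integral>\<^sup>+ \<omega>. pair_count (short_edges (cball a g \<inter> {w. proj1 w = proj1 a}) R) preferred (X \<omega>) \<partial>M"
  shows "ennreal (c1\<^sup>2 * unit_cylinder_vol TYPE('d) * (g - R) ^ (CARD('d) - 1)) * edge_integral c2 R TYPE('d) \<le> N"
    and "N \<le> ennreal (c2\<^sup>2 * unit_cylinder_vol TYPE('d) * (g + R) ^ (CARD('d) - 1)) * edge_integral c1 R TYPE('d)"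
proof -
  let ?S = "short_edges (cball a g \<inter> {w. proj1 w = proj1 a}) R"
  let ?V = "cball a (g + R)"
  let ?\<zeta> = "unit_cylinder_vol TYPE('d)"
  let ?h = "\<lambda>b y z. indicator ?S (y, z) * ennreal (exp (- b * preferred_vol (z - y)))"
  have S[measurable]: "?S \<in> sets (borel \<Otimes>\<^sub>M borel)" by (rule sets_short_edges)
  have in_V: "dist a y \<le> g + R" "dist a z \<le> g + R" "dist y z \<le> R" if "(y, z) \<in> ?S" for y z
    using that edges_meeting_bounds[of y z a g R] by (auto simp: short_edges_def)
  have pref: "c1 * preferred_vol (z - y) \<le> measure intensity (preferred y z)"
    "measure intensity (preferred y z) \<le> c2 * preferred_vol (z - y)" if "(y, z) \<in> ?S" for y z
  proof -
    \<comment> \<open>Starting points reach out to \<open>g + R\<close>, and the preferred region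
      lies within a further \<open>R\<close>; this explains the window \<open>g + 2 * R\<close> in
      the hypothesis.\<close>
    have near: "dist a w \<le> g + 2 * R" if "w \<in> preferred y z" for w
    proof -
      have "dist y w \<le> R" using that preferred_subset_cball[of y z] in_V(3)[OF \<open>(y, z) \<in> ?S\<close>] by auto
      then show ?thesis using in_V(1)[OF \<open>(y, z) \<in> ?S\<close>] dist_triangle[of a w y] by simp
    qed
    show "c1 * preferred_vol (z - y) \<le> measure intensity (preferred y z)"
      "measure intensity (preferred y z) \<le> c2 * preferred_vol (z - y)"
      using near f c sets_preferred_section
      by (intro measure_intensity_bounds[where ?c1.0=c1 and ?c2.0=c2] emeasure_preferred preferred_vol_nonneg; blast)+
  qed
  have N: "N = (\<integral>\<^sup>+ y. \<integral>\<^sup>+ z. indicator ?S (y, z) * ennreal (exp (- measure intensity (preferred y z))) \<partial>intensity \<partial>intensity)"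
    unfolding N_def
    by (rule nn_integral_pair_count[OF S sets_preferred])
      (auto simp: short_edges_def edges_meeting_def not_in_preferred)
  have h[measurable]: "(\<lambda>(y, z). ?h b y z) \<in> borel_measurable (borel \<Otimes>\<^sub>M borel)" for b
    by measurable
  have V: "?V \<subseteq> U" "\<And>y. y \<in> ?V \<Longrightarrow> c1 \<le> f y \<and> f y \<le> c2" using f R by auto
  have h0: "?h b y z = 0" if "y \<notin> ?V \<or> z \<notin> ?V" for b y z
    using that in_V(1,2)[of y z] by (auto split: split_indicator)
  have hy: "?h b y \<in> borel_measurable borel" for b y
    using measurable_compose[OF measurable_Pair1' h, of y b] by simp
  have hi: "(\<lambda>y. \<integral>\<^sup>+ z. ?h b y z \<partial>lborel) \<in> borel_measurable borel" for b
    by measurable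
  \<comment> \<open>The intensity replaces Lebesgue measure in one variable at a time: in none, in
    the outer one, in both.\<close>
  let ?LL = "\<lambda>b. \<integral>\<^sup>+ y. \<integral>\<^sup>+ z. ?h b y z \<partial>lborel \<partial>lborel"
  let ?LI = "\<lambda>b. \<integral>\<^sup>+ y. \<integral>\<^sup>+ z. ?h b y z \<partial>lborel \<partial>intensity"
  let ?II = "\<lambda>b. \<integral>\<^sup>+ y. \<integral>\<^sup>+ z. ?h b y z \<partial>intensity \<partial>intensity"
  have double: "ennreal (c1\<^sup>2) * ?LL b \<le> ?II b"
    "?II b \<le> ennreal (c2\<^sup>2) * ?LL b" for b
  proof -
    have inner: "ennreal c1 * (\<integral>\<^sup>+ z. ?h b y z \<partial>lborel) \<le> (\<integral>\<^sup>+ z. ?h b y z \<partial>intensity)"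
      "(\<integral>\<^sup>+ z. ?h b y z \<partial>intensity) \<le> ennreal c2 * (\<integral>\<^sup>+ z. ?h b y z \<partial>lborel)" for y
      by (intro nn_integral_intensity_bounds[OF hy _ V] h0; simp)+
    have hi0: "(\<integral>\<^sup>+ z. ?h b y z \<partial>lborel) = 0" if "y \<notin> ?V" for y
      using h0 that by (intro nn_integral_zero') (auto simp del: mult_eq_0_iff)
    have outer: "ennreal c1 * ?LL b \<le> ?LI b"
      "?LI b \<le> ennreal c2 * ?LL b"
      by (intro nn_integral_intensity_bounds[OF hi hi0 V]; simp)+
    have meas: "(\<lambda>y. \<integral>\<^sup>+ z. ?h b y z \<partial>lborel) \<in> borel_measurable intensity" using hi[of b] by simp
    have "ennreal (c1\<^sup>2) * ?LL b =
        ennreal c1 * (ennreal c1 * ?LL b)"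
      using c by (simp add: power2_eq_square ennreal_mult mult.assoc)
    also have "\<dots> \<le> ennreal c1 * ?LI b"
      by (rule mult_left_mono[OF outer(1)]) simp
    also have "\<dots> = (\<integral>\<^sup>+ y. ennreal c1 * (\<integral>\<^sup>+ z. ?h b y z \<partial>lborel) \<partial>intensity)"
      by (rule nn_integral_cmult[OF meas, symmetric])
    also have "\<dots> \<le> ?II b"
      by (rule nn_integral_mono) (rule inner(1))
    finally show "ennreal (c1\<^sup>2) * ?LL b \<le> ?II b" .
    have "?II b \<le> (\<integral>\<^sup>+ y. ennreal c2 * (\<integral>\<^sup>+ z. ?h b y z \<partial>lborel) \<partial>intensity)"
      by (rule nn_integral_mono) (rule inner(2))
    also have "\<dots> = ennreal c2 * ?LI b"
      by (rule nn_integral_cmult[OF meas])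
    also have "\<dots> \<le> ennreal c2 * (ennreal c2 * ?LL b)"
      by (rule mult_left_mono[OF outer(2)]) simp
    also have "\<dots> = ennreal (c2\<^sup>2) * ?LL b"
      using c by (simp add: power2_eq_square ennreal_mult mult.assoc)
    finally show "?II b \<le> ennreal (c2\<^sup>2) * ?LL b" .
  qed
  have "ennreal (c1\<^sup>2 * ?\<zeta> * (g - R) ^ (CARD('d) - 1)) * edge_integral c2 R TYPE('d) =
      ennreal (c1\<^sup>2) * (ennreal (?\<zeta> * (g - R) ^ (CARD('d) - 1)) * edge_integral c2 R TYPE('d))"
    by (simp add: ennreal_mult' mult.assoc)
  also have "\<dots> \<le> ennreal (c1\<^sup>2) * ?LL c2"
    by (rule mult_left_mono[OF nn_integral_short_edges_bounds(1)[OF R]]) simp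
  also have "\<dots> \<le> ?II c2" by (rule double(1))
  also have "\<dots> \<le> N" unfolding N
    using pref(2) by (intro nn_integral_mono) (auto split: split_indicator intro!: ennreal_leI)
  finally show "ennreal (c1\<^sup>2 * ?\<zeta> * (g - R) ^ (CARD('d) - 1)) * edge_integral c2 R TYPE('d) \<le> N" .
  have "N \<le> ?II c1" unfolding N
    using pref(1) by (intro nn_integral_mono) (auto split: split_indicator intro!: ennreal_leI)
  also have "\<dots> \<le> ennreal (c2\<^sup>2) * ?LL c1" by (rule double(2))
  also have "\<dots> \<le> ennreal (c2\<^sup>2) * (ennreal (?\<zeta> * (g + R) ^ (CARD('d) - 1)) * edge_integral c1 R TYPE('d))"
    by (rule mult_left_mono[OF nn_integral_short_edges_bounds(2)[OF R]]) simp
  also have "\<dots> = ennreal (c2\<^sup>2 * ?\<zeta> * (g + R) ^ (CARD('d) - 1)) * edge_integral c1 R TYPE('d)"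
    by (simp add: ennreal_mult' mult.assoc)
  finally show "N \<le> ennreal (c2\<^sup>2 * ?\<zeta> * (g + R) ^ (CARD('d) - 1)) * edge_integral c1 R TYPE('d)" .
qed

section \<open>Null events\<close>

lemma null_hyperplane: "{w :: real ^ 'd::{finite,linorder}. proj1 w = c} \<in> null_sets lborel"
proof -
  have "axis (Min UNIV) 1 \<in> (Basis :: ((real, 'd) vec) set)" by (simp add: Basis_cart)
  from negligible_standard_hyperplane[OF this, of c]
  have "negligible {w :: (real, 'd) vec. proj1 w = c}" by (simp add: inner_axis proj1_def)
  moreover have "{w :: (real, 'd) vec. proj1 w = c} \<in> sets borel" by measurable
  ultimately show ?thesis by (auto simp: negligible_iff_null_sets null_sets_completion_iff)
qed

lemma emeasure_intensity_null: "B \<in> null_sets lborel \<Longrightarrow> emeasure intensity B = 0"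
  using density_borel unfolding intensity_def
  by (subst emeasure_density) (auto intro: nn_integral_null_set)

text \<open>A pair count with empty regions: its mean is a double integral whose inner integral runs
  over a hyperplane, so the number of pairs with equal first coordinate has mean
  \<open>0\<close>.\<close>

lemma AE_inj_on_proj1: "AE \<omega> in M. inj_on proj1 (X \<omega>)"
proof -
  let ?P = "{(y, z :: real ^ 'd::{finite,linorder}). proj1 y = proj1 z \<and> y \<noteq> z}"
  have "?P = {p \<in> space (borel \<Otimes>\<^sub>M borel). proj1 (fst p) = proj1 (snd p) \<and> fst p \<noteq> snd p}"
    by (auto simp: space_pair_measure)
  also have "\<dots> \<in> sets (borel \<Otimes>\<^sub>M borel)" by measurable
  finally have P: "?P \<in> sets (borel \<Otimes>\<^sub>M borel)" .
  have T: "{(y, z, w). w \<in> ({} :: (real ^ 'd::{finite,linorder}) set)} \<in> sets (borel \<Otimes>\<^sub>M (borel \<Otimes>\<^sub>M borel))"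
    by (simp add: case_prod_unfold)
  have meas: "(\<lambda>\<omega>. pair_count ?P (\<lambda>_ _. {}) (X \<omega>)) \<in> borel_measurable M"
    by (rule measurable_compose[OF measurable_X borel_measurable_pair_count[OF P T]])
  have "(\<integral>\<^sup>+ \<omega>. pair_count ?P (\<lambda>_ _. {}) (X \<omega>) \<partial>M) =
      (\<integral>\<^sup>+ y. \<integral>\<^sup>+ z. indicator ?P (y, z) * ennreal (exp (- measure intensity {})) \<partial>intensity \<partial>intensity)"
    by (rule nn_integral_pair_count[OF P T]) auto
  also have "\<dots> = (\<integral>\<^sup>+ y. 0 \<partial>intensity)"
  proof (rule nn_integral_cong)
    fix y :: "real ^ 'd::{finite,linorder}"
    have B: "{z :: real ^ 'd::{finite,linorder}. proj1 z = proj1 y} \<in> sets intensity" by measurable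
    have "(\<integral>\<^sup>+ z. indicator ?P (y, z) * ennreal (exp (- measure intensity {})) \<partial>intensity) \<le>
      (\<integral>\<^sup>+ z. indicator {z. proj1 z = proj1 y} z \<partial>intensity)"
      by (intro nn_integral_mono) (auto split: split_indicator)
    also have "\<dots> = 0" using B emeasure_intensity_null[OF null_hyperplane] by simp
    finally show "(\<integral>\<^sup>+ z. indicator ?P (y, z) * ennreal (exp (- measure intensity {})) \<partial>intensity) = 0" by simp
  qed
  finally have "AE \<omega> in M. pair_count ?P (\<lambda>_ _. {}) (X \<omega>) = 0"
    using nn_integral_0_iff_AE[OF meas] by simp
  then show ?thesis
  proof (rule AE_mp, intro AE_I2 impI)
    fix \<omega> assume w: "\<omega> \<in> space M" "pair_count ?P (\<lambda>_ _. {}) (X \<omega>) = 0"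
    then show "inj_on proj1 (X \<omega>)"
      using finite_X[OF w(1)] by (auto simp: pair_count_def inj_on_def indicator_def)
  qed
qed

lemma AE_avoids_null:
  assumes "B \<in> null_sets lborel"
  shows "AE \<omega> in M. X \<omega> \<inter> B = {}"
proof -
  have B: "B \<in> sets borel" using assms by auto
  have "measure intensity B = 0" using emeasure_intensity_null[OF assms] by (simp add: measure_def)
  then have "prob {\<omega> \<in> space M. X \<omega> \<inter> B = {}} = 1" using prob_void[OF B] by simp
  then have "AE \<omega> in M. \<omega> \<in> {\<omega> \<in> space M. X \<omega> \<inter> B = {}}"
    using prob_eq_1[OF sets_void[OF B]] by blast
  then show ?thesis by (rule eventually_mono) simp
qed

end

section \<open>The limit\<close>

definition edge_const :: "real \<Rightarrow> real \<Rightarrow> 'd::{finite,linorder} itself \<Rightarrow> real" where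
  "edge_const b R d = enn2real (edge_integral b R d)"

lemma edge_integral_eq_const:
  assumes "0 \<le> b" "0 \<le> R"
  shows "edge_integral b R TYPE('d::{finite,linorder}) = ennreal (edge_const b R TYPE('d))"
proof -
  have "edge_integral b R TYPE('d) < \<infinity>"
    using edge_integral_le[OF assms, where 'd='d] by (rule le_less_trans) simp
  then show ?thesis by (simp add: edge_const_def)
qed

lemma edge_const_nonneg: "0 \<le> edge_const b R d"
  by (simp add: edge_const_def)

lemma edge_const_pos: "0 \<le> b \<Longrightarrow> 0 < R \<Longrightarrow> 0 < edge_const b R TYPE('d::{finite,linorder})"
  using edge_integral_pos[of R b, where 'd='d] edge_integral_eq_const[of b R, where 'd='d] by simp

lemma edge_const_mono:
  fixes b b' R :: real
  assumes "0 \<le> b" "b \<le> b'" "0 \<le> R"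
  shows "edge_const b R TYPE('d::{finite,linorder}) \<le>
    exp ((b' - b) * measure lborel (cball (0 :: (real, 'd) vec) R)) * edge_const b' R TYPE('d)"
  using edge_integral_mono[OF assms(2,3), where 'd='d] assms
  by (simp add: edge_integral_eq_const ennreal_mult'[symmetric] edge_const_nonneg)

lemma edges_meeting_split: "edges_meeting I = short_edges I R \<union> long_edges I R" "short_edges I R \<inter> long_edges I R = {}"
  by (auto simp: short_edges_def long_edges_def)

context cartesian_poisson_process
begin

text \<open>The section lies in a hyperplane, so almost surely it carries no point of the process
  and the frontmost points contribute nothing.\<close>

lemma nn_integral_crossing_points:
  "(\<integral>\<^sup>+ \<omega>. ennreal (real (card (crossing_points g s x (X \<omega>)))) \<partial>M) =
    (\<integral>\<^sup>+ \<omega>. pair_count (edges_meeting (cross_section g s x)) preferred (X \<omega>) \<partial>M)"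
proof (rule nn_integral_cong_AE)
  have "cross_section g s x \<in> sets borel" unfolding cross_section_def by measurable
  then have "cross_section g s x \<in> null_sets lborel"
    by (intro null_sets_subset[OF null_hyperplane[of "proj1 (s *\<^sub>R x)"]]) (auto simp: cross_section_def)
  from AE_avoids_null[OF this]
  show "AE \<omega> in M. ennreal (real (card (crossing_points g s x (X \<omega>)))) =
      pair_count (edges_meeting (cross_section g s x)) preferred (X \<omega>)"
  proof (rule AE_mp, intro AE_I2 impI)
    fix \<omega> assume w: "\<omega> \<in> space M" "X \<omega> \<inter> cross_section g s x = {}"
    have "(\<Sum>y\<in>X \<omega>. indicator (cross_section g s x) y * of_bool (X \<omega> \<inter> {z. proj1 y < proj1 z} = {}) :: ennreal) = 0"
      using w(2) by (intro sum.neutral) (auto simp: indicator_def)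
    then show "ennreal (real (card (crossing_points g s x (X \<omega>)))) =
        pair_count (edges_meeting (cross_section g s x)) preferred (X \<omega>)"
      using card_crossing_points[OF finite_X[OF w(1)], of g s x]
      by (simp add: ennreal_of_nat_eq_real_of_nat)
  qed
qed

lemma expectation_crossing_points:
  "expectation (\<lambda>\<omega>. real (card (crossing_points g s x (X \<omega>)))) =
    enn2real (\<integral>\<^sup>+ \<omega>. ennreal (real (card (crossing_points g s x (X \<omega>)))) \<partial>M)"
proof (rule integral_eq_nn_integral)
  have "(\<lambda>\<omega>. of_nat (card (crossing_points g s x (X \<omega>))) :: ennreal) \<in> borel_measurable M"
    by (rule measurable_compose[OF measurable_X borel_measurable_card_crossing_points])
  then have "(\<lambda>\<omega>. enn2real (of_nat (card (crossing_points g s x (X \<omega>))))) \<in> borel_measurable M"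
    by measurable
  then show "(\<lambda>\<omega>. real (card (crossing_points g s x (X \<omega>)))) \<in> borel_measurable M" by simp
qed simp

text \<open>The lower bound discards the long edges; the upper bound adds their packing bound, a
  constant that is valid for almost every outcome and can be integrated directly. The number
  \<open>n\<close> limits the dyadic scales.\<close>

lemma expectation_crossing_bounds:
  fixes g :: "real \<Rightarrow> real" and x :: "(real, 'd) vec"
  assumes d: "2 \<le> CARD('d)" and R: "2 \<le> R" "R < g s" and c: "0 \<le> c1" "0 \<le> c2"
    and f: "\<And>y. dist (s *\<^sub>R x) y \<le> g s + 2 * R \<Longrightarrow> y \<in> U \<and> c1 \<le> f y \<and> f y \<le> c2"
    and diam: "\<And>y z. y \<in> U \<Longrightarrow> z \<in> U \<Longrightarrow> dist y z \<le> 2 ^ n"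
  defines "EN \<equiv> expectation (\<lambda>\<omega>. real (card (crossing_points g s x (X \<omega>))))"
  shows "c1\<^sup>2 * unit_cylinder_vol TYPE('d) * (g s - R) ^ (CARD('d) - 1) * edge_const c2 R TYPE('d) \<le> EN"
    and "EN \<le> c2\<^sup>2 * unit_cylinder_vol TYPE('d) * (g s + R) ^ (CARD('d) - 1) * edge_const c1 R TYPE('d) +
      (6 * real CARD('d)) ^ CARD('d) * g s ^ (CARD('d) - 1) * (2 / R + real n / g s)"
proof -
  let ?I = "cball (s *\<^sub>R x) (g s) \<inter> {w. proj1 w = proj1 (s *\<^sub>R x)}"
  let ?k = "CARD('d) - 1"
  let ?l = "c1\<^sup>2 * unit_cylinder_vol TYPE('d) * (g s - R) ^ ?k * edge_const c2 R TYPE('d)"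
  let ?u = "c2\<^sup>2 * unit_cylinder_vol TYPE('d) * (g s + R) ^ ?k * edge_const c1 R TYPE('d)"
  let ?e = "(6 * real CARD('d)) ^ CARD('d) * g s ^ ?k * (2 / R + real n / g s)"
  have R0: "0 < R" using R by simp
  have \<zeta>: "0 \<le> unit_cylinder_vol TYPE('d)" using unit_cylinder_vol_pos less_imp_le by blast
  have nonneg: "0 \<le> ?u" "0 \<le> ?e"
    using R c by (intro mult_nonneg_nonneg add_nonneg_nonneg edge_const_nonneg \<zeta>; simp)+
  let ?N = "\<integral>\<^sup>+ \<omega>. pair_count (edges_meeting ?I) preferred (X \<omega>) \<partial>M"
  let ?NS = "\<integral>\<^sup>+ \<omega>. pair_count (short_edges ?I R) preferred (X \<omega>) \<partial>M"
  have S: "ennreal ?l \<le> ?NS" "?NS \<le> ennreal ?u"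
    unfolding ennreal_mult''[OF edge_const_nonneg] edge_integral_eq_const[OF c(1) less_imp_le[OF R0], symmetric]
      edge_integral_eq_const[OF c(2) less_imp_le[OF R0], symmetric]
    by (rule nn_integral_short_edges[OF R0 R(2) c f], assumption)+
  have meas: "(\<lambda>\<omega>. pair_count (short_edges ?I R) preferred (X \<omega>)) \<in> borel_measurable M"
    by (rule measurable_compose[OF measurable_X borel_measurable_pair_count[OF sets_short_edges sets_preferred]])
  have split: "pair_count (edges_meeting ?I) preferred \<phi> =
      pair_count (short_edges ?I R) preferred \<phi> + pair_count (long_edges ?I R) preferred \<phi>" for \<phi>
    by (subst edges_meeting_split(1)[of _ R], rule pair_count_Un[OF edges_meeting_split(2)])
  have "?NS \<le> ?N" unfolding split by (intro nn_integral_mono add_increasing2) auto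
  have "?N \<le> (\<integral>\<^sup>+ \<omega>. pair_count (short_edges ?I R) preferred (X \<omega>) + ennreal ?e \<partial>M)"
  proof (rule nn_integral_mono_AE, rule AE_mp[OF AE_inj_on_proj1], intro AE_I2 impI)
    fix \<omega> assume w: "\<omega> \<in> space M" "inj_on proj1 (X \<omega>)"
    have "pair_count (long_edges ?I R) preferred (X \<omega>) \<le> ennreal ?e"
      using R X_subset[OF w(1)]
      by (intro pair_count_long_edges_le finite_X w d diam) auto
    then show "pair_count (edges_meeting ?I) preferred (X \<omega>) \<le> pair_count (short_edges ?I R) preferred (X \<omega>) + ennreal ?e"
      unfolding split by (rule add_left_mono)
  qed
  also have "\<dots> = ?NS + ennreal ?e"
    using meas by (subst nn_integral_add) (simp_all add: emeasure_space_1)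
  also have "\<dots> \<le> ennreal ?u + ennreal ?e" by (rule add_right_mono[OF S(2)])
  also have "\<dots> = ennreal (?u + ?e)" using nonneg by simp
  finally have upper: "?N \<le> ennreal (?u + ?e)" .
  have lower: "ennreal ?l \<le> ?N" using S(1) \<open>?NS \<le> ?N\<close> by (rule order_trans)
  have EN: "EN = enn2real ?N"
    unfolding EN_def expectation_crossing_points nn_integral_crossing_points cross_section_eq ..
  have "?N < \<top>" using upper by (rule le_less_trans) simp
  then have N: "?N = ennreal EN" unfolding EN by simp
  have "0 \<le> EN" by (simp add: EN)
  then show "?l \<le> EN" "EN \<le> ?u + ?e"
    using lower upper nonneg unfolding N by (auto simp: ennreal_le_iff2)
qed

end

text \<open>Comparing two truncations at a common \<open>s\<close> gives
  \<open>L R \<le> L R' + K / R'\<close>. Hence \<open>L\<close> is bounded above, and its supremum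
  lies between \<open>L R\<close> and \<open>L R + K / R\<close> for every \<open>R\<close>. The
  limit need not be known beforehand, and being at least each \<open>L R\<close> it inherits
  positivity.\<close>

lemma convergent_if_sandwiched_up_to:
  fixes F :: "real \<Rightarrow> real" and L :: "real \<Rightarrow> real"
  assumes K: "0 \<le> K" and ev: "\<And>R \<delta>. 2 \<le> R \<Longrightarrow> 0 < \<delta> \<Longrightarrow>
    eventually (\<lambda>s. L R - \<delta> \<le> F s \<and> F s \<le> L R + K / R + \<delta>) at_top"
  shows "\<exists>l. (F \<longlongrightarrow> l) at_top \<and> (\<forall>R\<ge>2. L R \<le> l)"
proof -
  have compare: "L R \<le> L R' + K / R'" if "2 \<le> R" "2 \<le> R'" for R R'
  proof (rule field_le_epsilon)
    fix e :: real assume "0 < e"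
    then have "eventually (\<lambda>s. (L R - e / 2 \<le> F s \<and> F s \<le> L R + K / R + e / 2) \<and>
        (L R' - e / 2 \<le> F s \<and> F s \<le> L R' + K / R' + e / 2)) at_top"
      by (intro eventually_conj ev that) auto
    then obtain s where "L R - e / 2 \<le> F s" "F s \<le> L R' + K / R' + e / 2"
      using eventually_happens by fastforce
    then show "L R \<le> L R' + K / R' + e" by linarith
  qed
  define l where "l = (SUP R\<in>{2..}. L R)"
  have bdd: "bdd_above (L ` {2..})" using compare[of _ 2] by (intro bdd_aboveI[of _ "L 2 + K / 2"]) auto
  have low: "L R \<le> l" if "2 \<le> R" for R unfolding l_def using bdd that by (intro cSUP_upper) auto
  have up: "l \<le> L R + K / R" if "2 \<le> R" for R
    unfolding l_def using compare[OF _ that] by (intro cSUP_least) auto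
  have "(F \<longlongrightarrow> l) at_top"
  proof (rule tendstoI)
    fix e :: real assume e: "0 < e"
    \<comment> \<open>Chosen so that \<open>K / R\<close> stays below \<open>e / 2\<close>; the
      other half of \<open>e\<close> is spent on \<open>\<delta>\<close>.\<close>
    define R where "R = max 2 (2 * K / e + 1)"
    have R: "2 \<le> R" "2 * K / e < R" by (auto simp: R_def)
    then have KR: "K / R < e / 2" using e by (simp add: field_simps)
    show "eventually (\<lambda>s. dist (F s) l < e) at_top"
      using ev[OF R(1), of "e / 2"]
    proof (rule eventually_mono)
      fix s assume "L R - e / 2 \<le> F s \<and> F s \<le> L R + K / R + e / 2"
      then have "L R - e / 2 \<le> F s" "F s \<le> L R + K / R + e / 2" by auto
      then show "dist (F s) l < e" using low[OF R(1)] up[OF R(1)] KR unfolding dist_real_def by linarith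
    qed (use e in simp)
  qed
  then show ?thesis using low by blast
qed

section \<open>Passage to the limit in dimension at least two\<close>

lemma log_over_powr_tendsto_0:
  assumes "0 < b" "0 < \<xi>"
  shows "((\<lambda>s::real. (log 2 (2 * b * s) + 1) / s powr \<xi>) \<longlongrightarrow> 0) at_top"
  using assms by real_asymp

definition section_const :: "'d::{finite,linorder} itself \<Rightarrow> real" where
  "section_const _ = enn2real (hausdorff_measure (CARD('d) - 1) (unit_section :: ((real, 'd) vec) set))"

lemma section_const_pos: "0 < section_const TYPE('d::{finite,linorder})"
  unfolding section_const_def
  using hausdorff_measure_unit_section_pos[where 'd='d] hausdorff_measure_unit_section_finite[where 'd='d]
  by (simp add: enn2real_positive_iff)

lemma hausdorff_measure_cross_section:
  fixes x :: "real ^ 'd::{finite,linorder}"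
  assumes "0 < g s"
  shows "enn2real (hausdorff_measure (CARD('d) - 1) (cross_section g s x)) =
    g s ^ (CARD('d) - 1) * section_const TYPE('d)"
  using assms by (simp add: cross_section_affine hausdorff_measure_affine enn2real_mult section_const_def)

lemma cartesian_poisson_process_scaled:
  fixes D :: "(real ^ 'd::{finite,linorder}) set"
  assumes D: "open D" "bounded D" and lam: "continuous_on D lam" and s: "0 < s"
    and pp: "poisson_process M ((\<lambda>x. s *\<^sub>R x) ` D) (\<lambda>y. lam (y /\<^sub>R s)) X"
  shows "cartesian_poisson_process M ((\<lambda>x. s *\<^sub>R x) ` D) (\<lambda>y. lam (y /\<^sub>R s)) X"
proof unfold_locales
  show "bounded ((\<lambda>x. s *\<^sub>R x) ` D)" using D(2) by (rule bounded_scaling)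
  have "open ((\<lambda>x. s *\<^sub>R x) ` D)" using D(1) s by (intro open_scaling) auto
  then show "(\<lambda>x. s *\<^sub>R x) ` D \<in> sets borel" by simp
  have "(\<lambda>y. indicator D y *\<^sub>R lam y) \<in> borel_measurable borel"
    using D(1) lam by (intro borel_measurable_continuous_on_indicator) auto
  then have "(\<lambda>y. ennreal (indicator D (y /\<^sub>R s) *\<^sub>R lam (y /\<^sub>R s))) \<in> borel_measurable borel"
    by measurable
  also have "(\<lambda>y. ennreal (indicator D (y /\<^sub>R s) *\<^sub>R lam (y /\<^sub>R s))) =
      (\<lambda>y. ennreal (lam (y /\<^sub>R s)) * indicator ((\<lambda>x. s *\<^sub>R x) ` D) y)"
  proof
    fix y
    have "y /\<^sub>R s \<in> D \<longleftrightarrow> y \<in> (\<lambda>x. s *\<^sub>R x) ` D"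
      using s by (auto simp: image_iff intro: bexI[of _ "y /\<^sub>R s"])
    then show "ennreal (indicator D (y /\<^sub>R s) *\<^sub>R lam (y /\<^sub>R s)) =
        ennreal (lam (y /\<^sub>R s)) * indicator ((\<lambda>x. s *\<^sub>R x) ` D) y"
      by (simp add: indicator_def)
  qed
  finally show "(\<lambda>y. ennreal (lam (y /\<^sub>R s)) * indicator ((\<lambda>x. s *\<^sub>R x) ` D) y) \<in> borel_measurable borel" .
qed (rule pp)

abbreviation crossing_ratio ::
    "(real \<Rightarrow> 'w measure) \<Rightarrow> (real \<Rightarrow> 'w \<Rightarrow> (real ^ 'd::{finite,linorder}) set) \<Rightarrow> real \<Rightarrow> (real, 'd) vec \<Rightarrow> real \<Rightarrow> real"
  where
  "crossing_ratio M X \<xi> x \<equiv> \<lambda>s. inverse (enn2real (hausdorff_measure (CARD('d) - 1) (cross_section (\<lambda>s. s powr \<xi>) s x))) *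
     prob_space.expectation (M s) (\<lambda>\<omega>. real (card (crossing_points (\<lambda>s. s powr \<xi>) s x (X s \<omega>))))"

lemma crossing_intensity_limit:
  fixes D :: "(real ^ 'd::{finite,linorder}) set" and lam :: "(real, 'd) vec \<Rightarrow> real"
    and M :: "real \<Rightarrow> 'w measure" and X :: "real \<Rightarrow> 'w \<Rightarrow> ((real, 'd) vec) set"
  assumes D: "open D" "bounded D" and nonneg: "\<And>y. y \<in> D \<Longrightarrow> 0 \<le> lam y" and lam: "continuous_on D lam"
    and pp: "\<And>s. 1 \<le> s \<Longrightarrow> poisson_process (M s) ((\<lambda>x. s *\<^sub>R x) ` D) (\<lambda>y. lam (y /\<^sub>R s)) (X s)"
    and \<xi>: "0 < \<xi>" "\<xi> < 1" and x: "x \<in> D" and d: "2 \<le> CARD('d)"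
  shows "\<exists>l. 0 \<le> l \<and> (0 < lam x \<longrightarrow> 0 < l) \<and>
    (crossing_ratio M X \<xi> x \<longlongrightarrow> l) at_top"
proof -
  let ?g = "\<lambda>s. s powr \<xi>"
  let ?k = "CARD('d) - 1" and ?\<zeta> = "unit_cylinder_vol TYPE('d)" and ?\<eta> = "section_const TYPE('d)"
  define c where "c = lam x"
  define C where "C = (6 * real CARD('d)) ^ CARD('d)"
  define J where "J = (\<lambda>b R. edge_const b R TYPE('d))"
  define EN where "EN = (\<lambda>s. prob_space.expectation (M s) (\<lambda>\<omega>. real (card (crossing_points ?g s x (X s \<omega>)))))"
  define F where "F = (\<lambda>s. inverse (enn2real (hausdorff_measure ?k (cross_section ?g s x))) * EN s)"
  \<comment> \<open>The limiting contribution of the edges of length at most \<open>R\<close>. The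
    two endpoints yield the square, the geometry of the cylinder and of the section yields the
    quotient.\<close>
  define L where "L = (\<lambda>R. c\<^sup>2 * (?\<zeta> / ?\<eta>) * J c R)"
  have \<eta>: "0 < ?\<eta>" and \<zeta>: "0 < ?\<zeta>" by (rule section_const_pos, rule unit_cylinder_vol_pos)
  have c: "0 \<le> c" using nonneg[OF x] by (simp add: c_def)
  have C: "0 \<le> C" by (simp add: C_def)
  obtain b where b: "0 < b" "\<And>y. y \<in> D \<Longrightarrow> norm y \<le> b"
    using D(2) by (auto simp: bounded_pos)
  have ev: "eventually (\<lambda>s. L R - \<delta> \<le> F s \<and> F s \<le> L R + (2 * C / ?\<eta>) / R + \<delta>) at_top"
    if R: "2 \<le> R" and \<delta>: "0 < \<delta>" for R \<delta>
  proof -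
    define \<mu> where "\<mu> = measure lborel (cball (0 :: (real, 'd) vec) R)"
    \<comment> \<open>The normalised bounds when the local intensity is off by at most
      \<open>\<epsilon>\<close> and \<open>R / g\<close> is at most \<open>\<epsilon>\<close>. The
      maximum with \<open>0\<close> matters because the lower intensity is squared and
      \<open>c\<close> may be smaller than \<open>\<epsilon>\<close>.\<close>
    define lo where "lo = (\<lambda>\<epsilon>. (max 0 (c - \<epsilon>))\<^sup>2 * (?\<zeta> / ?\<eta>) * (1 - \<epsilon>) ^ ?k * (exp (- \<epsilon> * \<mu>) * J c R))"
    define up where "up = (\<lambda>\<epsilon>. (c + \<epsilon>)\<^sup>2 * (?\<zeta> / ?\<eta>) * (1 + \<epsilon>) ^ ?k * (exp (\<epsilon> * \<mu>) * J c R))"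
    have "(lo \<longlongrightarrow> (max 0 (c - 0))\<^sup>2 * (?\<zeta> / ?\<eta>) * (1 - 0) ^ ?k * (exp (- 0 * \<mu>) * J c R)) (at_right 0)"
      unfolding lo_def by (intro tendsto_intros)
    then have lo: "(lo \<longlongrightarrow> L R) (at_right 0)" using c by (simp add: L_def)
    have "(up \<longlongrightarrow> (c + 0)\<^sup>2 * (?\<zeta> / ?\<eta>) * (1 + 0) ^ ?k * (exp (0 * \<mu>) * J c R)) (at_right 0)"
      unfolding up_def by (intro tendsto_intros)
    then have up: "(up \<longlongrightarrow> L R) (at_right 0)" by (simp add: L_def)
    \<comment> \<open>The upper side is granted only \<open>\<delta> / 2\<close>, since the
      logarithmic term of the packing bound takes the other half.\<close>
    have "eventually (\<lambda>\<epsilon>. L R - \<delta> < lo \<epsilon> \<and> up \<epsilon> < L R + \<delta> / 2 \<and> 0 < \<epsilon> \<and> \<epsilon> < 1) (at_right (0::real))"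
      using \<delta> by (intro eventually_conj order_tendstoD[OF lo] order_tendstoD[OF up]
          eventually_at_right_less eventually_at_right_real[of 0 1, THEN eventually_mono]) auto
    then obtain \<epsilon> where \<epsilon>: "L R - \<delta> < lo \<epsilon>" "up \<epsilon> < L R + \<delta> / 2" "0 < \<epsilon>" "\<epsilon> < 1"
      using eventually_happens by force
    have "isCont lam x" using lam D(1) x by (simp add: continuous_on_eq_continuous_at)
    then obtain \<rho>1 where \<rho>1: "0 < \<rho>1" "\<And>y. dist y x < \<rho>1 \<Longrightarrow> dist (lam y) (lam x) < \<epsilon>"
      using \<epsilon>(3) unfolding continuous_at by (auto simp: tendsto_iff eventually_at) (metis dist_self)
    obtain \<rho>2 where \<rho>2: "0 < \<rho>2" "ball x \<rho>2 \<subseteq> D" using D(1) x by (meson openE)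
    define \<rho> where "\<rho> = min \<rho>1 \<rho>2"
    have \<rho>: "0 < \<rho>" using \<rho>1(1) \<rho>2(1) by (simp add: \<rho>_def)
    have near: "y \<in> D \<and> \<bar>lam y - c\<bar> \<le> \<epsilon>" if "dist x y < \<rho>" for y
      using that \<rho>1(2)[of y] \<rho>2(2) by (auto simp: \<rho>_def c_def dist_commute dist_real_def subset_iff)
    \<comment> \<open>Here \<open>\<xi> < 1\<close> enters: seen at the scale of \<open>D\<close>,
      the window around the section shrinks to \<open>x\<close>, so continuity of \<open>lam\<close>
      at \<open>x\<close> controls the intensity.\<close>
    have ev1: "eventually (\<lambda>s. (s powr \<xi> + 2 * R) / s < \<rho>) at_top"
    proof -
      have "((\<lambda>s::real. (s powr \<xi> + 2 * R) / s) \<longlongrightarrow> 0) at_top" using \<xi> by real_asymp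
      then show ?thesis using \<rho> by (rule order_tendstoD)
    qed
    \<comment> \<open>Here \<open>0 < \<xi>\<close> enters: the section outgrows the truncation
      length, and the slant of short edges becomes negligible.\<close>
    have ev2: "eventually (\<lambda>s. R / s powr \<xi> < \<epsilon>) at_top"
    proof -
      have "((\<lambda>s::real. R / s powr \<xi>) \<longlongrightarrow> 0) at_top" using \<xi> by real_asymp
      then show ?thesis using \<epsilon>(3) by (rule order_tendstoD)
    qed
    \<comment> \<open>The logarithm bounds the number of dyadic edge lengths up to the diameter of
      the scaled domain.\<close>
    have ev3: "eventually (\<lambda>s. C / ?\<eta> * ((log 2 (2 * b * s) + 1) / s powr \<xi>) < \<delta> / 2) at_top"
    proof -
      have "((\<lambda>s. C / ?\<eta> * ((log 2 (2 * b * s) + 1) / s powr \<xi>)) \<longlongrightarrow> C / ?\<eta> * 0) at_top"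
        by (intro tendsto_mult tendsto_const log_over_powr_tendsto_0 b \<xi>)
      then show ?thesis using \<delta> by (intro order_tendstoD(2)) auto
    qed
    \<comment> \<open>Makes the logarithm nonnegative, so that its ceiling survives the conversion
      to \<open>nat\<close>.\<close>
    have ev4: "eventually (\<lambda>s. 1 \<le> 2 * b * s) at_top"
      using b(1) by real_asymp
    show ?thesis using ev1 ev2 ev3 ev4 eventually_ge_at_top[of 1]
    proof eventually_elim
      case (elim s)
      define g where "g = s powr \<xi>"
      \<comment> \<open>The scaled domain has diameter at most \<open>2 * b * s\<close>, so this
        \<open>n\<close> is large enough for the dyadic scales.\<close>
      define n where "n = nat \<lceil>log 2 (2 * b * s)\<rceil>"
      have s: "0 < s" using elim by simp
      have g: "0 < g" using s by (simp add: g_def)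
      have Rg: "R < g" using elim(2) \<epsilon>(4) g R by (simp add: g_def[symmetric] divide_less_eq) (smt (verit) mult_left_le_one_le mult_le_cancel_right1)
      interpret cartesian_poisson_process "M s" "(\<lambda>x. s *\<^sub>R x) ` D" "\<lambda>y. lam (y /\<^sub>R s)" "X s"
        using elim(5) by (intro cartesian_poisson_process_scaled D lam s pp)
      let ?c1 = "max 0 (c - \<epsilon>)" and ?c2 = "c + \<epsilon>"
      have c12: "0 \<le> ?c1" "0 \<le> ?c2" using c \<epsilon> by auto
      have f: "y \<in> (\<lambda>x. s *\<^sub>R x) ` D \<and> ?c1 \<le> lam (y /\<^sub>R s) \<and> lam (y /\<^sub>R s) \<le> ?c2"
        if "dist (s *\<^sub>R x) y \<le> s powr \<xi> + 2 * R" for y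
      proof -
        have "s *\<^sub>R x - y = s *\<^sub>R (x - y /\<^sub>R s)" using s by (simp add: scaleR_diff_right)
        then have "dist (s *\<^sub>R x) y = s * dist x (y /\<^sub>R s)" using s by (simp add: dist_norm)
        then have "dist x (y /\<^sub>R s) \<le> (s powr \<xi> + 2 * R) / s" using that s by (simp add: field_simps)
        then have "dist x (y /\<^sub>R s) < \<rho>" using elim(1) by linarith
        from near[OF this] have "y /\<^sub>R s \<in> D" "\<bar>lam (y /\<^sub>R s) - c\<bar> \<le> \<epsilon>" by auto
        moreover have "y \<in> (\<lambda>x. s *\<^sub>R x) ` D"
          by (rule image_eqI[where x="y /\<^sub>R s"]) (use s \<open>y /\<^sub>R s \<in> D\<close> in simp_all)
        ultimately show ?thesis using nonneg[of "y /\<^sub>R s"] by (auto simp: abs_le_iff)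
      qed
      have diam: "dist y z \<le> 2 ^ n" if yz: "y \<in> (\<lambda>x. s *\<^sub>R x) ` D" "z \<in> (\<lambda>x. s *\<^sub>R x) ` D" for y z
      proof -
        obtain y' where y': "y = s *\<^sub>R y'" "y' \<in> D" using yz(1) by (rule imageE)
        obtain z' where z': "z = s *\<^sub>R z'" "z' \<in> D" using yz(2) by (rule imageE)
        have "norm y \<le> s * b" "norm z \<le> s * b" using s b(2) y' z' by auto
        then have "dist y z \<le> s * b + s * b" using norm_triangle_ineq4[of y z] unfolding dist_norm by linarith
        also have "\<dots> = 2 * b * s" by simp
        also have "2 * b * s = 2 powr (log 2 (2 * b * s))" using s b by simp
        also have "\<dots> \<le> 2 powr (real n)" unfolding n_def by (intro powr_mono) (auto intro: real_nat_ceiling_ge)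
        finally show ?thesis by (simp add: powr_realpow)
      qed
      have n: "real n \<le> log 2 (2 * b * s) + 1"
        using elim(4) s b unfolding n_def by (simp add: of_nat_nat)
      note bounds = expectation_crossing_bounds[of R "\<lambda>s. s powr \<xi>" s ?c1 ?c2 x n, OF d R _ c12 f diam, folded g_def]
      have l: "?c1\<^sup>2 * ?\<zeta> * (g - R) ^ ?k * J ?c2 R \<le> EN s"
        unfolding J_def EN_def g_def by (rule bounds(1)[unfolded g_def]) (use Rg in \<open>simp_all add: g_def\<close>)
      have u: "EN s \<le> ?c2\<^sup>2 * ?\<zeta> * (g + R) ^ ?k * J ?c1 R + C * g ^ ?k * (2 / R + real n / g)"
        unfolding J_def EN_def g_def C_def by (rule bounds(2)[unfolded g_def]) (use Rg in \<open>simp_all add: g_def\<close>)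
      have F: "F s = EN s / (g ^ ?k * ?\<eta>)"
        unfolding F_def using hausdorff_measure_cross_section[of ?g s x] s
        by (simp add: g_def divide_inverse mult.commute)
      have gk: "0 < g ^ ?k * ?\<eta>" using g \<eta> by simp
      have J1: "exp (- \<epsilon> * \<mu>) * J c R \<le> J ?c2 R"
      proof -
        have "J c R \<le> exp (\<epsilon> * \<mu>) * J ?c2 R"
          using edge_const_mono[of c ?c2 R, where 'd='d] c \<epsilon> R by (simp add: J_def \<mu>_def)
        then have "exp (- \<epsilon> * \<mu>) * J c R \<le> exp (- \<epsilon> * \<mu>) * (exp (\<epsilon> * \<mu>) * J ?c2 R)"
          by (rule mult_left_mono) simp
        then show ?thesis by (simp add: mult.assoc[symmetric] exp_add[symmetric])
      qed
      \<comment> \<open>The difference \<open>c - ?c1\<close> is at most \<open>\<epsilon>\<close>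
        even when the maximum cuts off at \<open>0\<close>.\<close>
      have J2: "J ?c1 R \<le> exp (\<epsilon> * \<mu>) * J c R"
      proof -
        have "J ?c1 R \<le> exp ((c - ?c1) * \<mu>) * J c R"
          using edge_const_mono[of ?c1 c R, where 'd='d] c \<epsilon> R by (simp add: J_def \<mu>_def)
        also have "\<dots> \<le> exp (\<epsilon> * \<mu>) * J c R"
          using c \<epsilon> by (intro mult_right_mono) (auto simp: J_def \<mu>_def edge_const_nonneg intro!: mult_right_mono)
        finally show ?thesis .
      qed
      have Jn: "0 \<le> J c R" "0 \<le> J ?c1 R" "0 \<le> J ?c2 R" by (simp_all add: J_def edge_const_nonneg)
      have q: "0 \<le> ?\<zeta> / ?\<eta>" using \<zeta> \<eta> by simp
      have Rge: "R / g \<le> \<epsilon>" using elim(2) by (simp add: g_def)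
      have e1: "(g - R) ^ ?k = g ^ ?k * (1 - R / g) ^ ?k" and e2: "(g + R) ^ ?k = g ^ ?k * (1 + R / g) ^ ?k"
        using g by (simp_all add: power_mult_distrib[symmetric] right_diff_distrib distrib_left)
      have "lo \<epsilon> \<le> ?c1\<^sup>2 * (?\<zeta> / ?\<eta>) * (1 - R / g) ^ ?k * J ?c2 R"
        unfolding lo_def using q Rge \<epsilon> J1 Jn
        by (intro mult_mono mult_left_mono power_mono mult_nonneg_nonneg) auto
      also have "\<dots> = ?c1\<^sup>2 * ?\<zeta> * (g - R) ^ ?k * J ?c2 R / (g ^ ?k * ?\<eta>)"
        unfolding e1 using g \<eta> by simp
      also have "\<dots> \<le> F s" unfolding F using l gk by (intro divide_right_mono) auto
      finally have low: "L R - \<delta> \<le> F s" using \<epsilon>(1) by linarith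
      have "F s \<le> (?c2\<^sup>2 * ?\<zeta> * (g + R) ^ ?k * J ?c1 R + C * g ^ ?k * (2 / R + real n / g)) / (g ^ ?k * ?\<eta>)"
        unfolding F using u gk by (intro divide_right_mono) auto
      also have "\<dots> = ?c2\<^sup>2 * (?\<zeta> / ?\<eta>) * (1 + R / g) ^ ?k * J ?c1 R + (2 * C / ?\<eta>) / R + C / ?\<eta> * (real n / g)"
        unfolding e2 using g \<eta> R by (simp add: add_divide_distrib distrib_left mult_ac)
      also have "\<dots> \<le> up \<epsilon> + (2 * C / ?\<eta>) / R + C / ?\<eta> * ((log 2 (2 * b * s) + 1) / g)"
        unfolding up_def using q Rge \<epsilon> J2 Jn c C \<eta> g R n
        by (intro add_mono order_refl mult_mono mult_left_mono power_mono mult_nonneg_nonneg divide_right_mono) auto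
      also have "\<dots> \<le> L R + (2 * C / ?\<eta>) / R + \<delta>"
        using \<epsilon>(2) elim(3)[folded g_def] by linarith
      finally show ?case using low by simp
    qed
  qed
  have "0 \<le> 2 * C / ?\<eta>" using C \<eta> by simp
  from convergent_if_sandwiched_up_to[OF this ev]
  obtain l where l: "(F \<longlongrightarrow> l) at_top" "\<And>R. 2 \<le> R \<Longrightarrow> L R \<le> l" by auto
  \<comment> \<open>Any single truncation bounds the limit from below, so \<open>R = 2\<close>
    decides about its sign.\<close>
  have "0 \<le> L 2" using \<zeta> \<eta> by (simp add: L_def J_def edge_const_nonneg)
  moreover have "0 < L 2" if "0 < lam x"
    using that \<zeta> \<eta> edge_const_pos[of c 2, where 'd='d] by (simp add: L_def J_def c_def)
  ultimately have "0 \<le> l \<and> (0 < lam x \<longrightarrow> 0 < l)" using l(2)[of 2] by fastforce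
  then show ?thesis using l(1) unfolding F_def EN_def by blast
qed

section \<open>Dimension one\<close>

lemma vec_eq_if_proj1_eq:
  fixes v w :: "real ^ 'd::{finite,linorder}"
  assumes "CARD('d) = 1" "proj1 v = proj1 w"
  shows "v = w"
proof -
  obtain i :: 'd where "UNIV = {i}" using assms(1) by (auto simp: card_1_singleton_iff)
  then have "j = Min UNIV" for j :: 'd by (metis Min_singleton UNIV_I singletonD)
  then show ?thesis using assms(2) by (metis proj1_def vec_eq_iff)
qed

text \<open>Only the last point before \<open>s x\<close> can jump over it. Any earlier point has
  that last point ahead of it and strictly closer than everything beyond \<open>s x\<close>.\<close>

lemma card_crossing_points_line:
  fixes x :: "real ^ 'd::{finite,linorder}"
  assumes d: "CARD('d) = 1" and g: "0 \<le> g s" and fin: "finite \<phi>" and x: "s *\<^sub>R x \<notin> \<phi>"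
  shows "card (crossing_points g s x \<phi>) =
    of_bool ((\<exists>y\<in>\<phi>. proj1 y < proj1 (s *\<^sub>R x)) \<and> (\<exists>z\<in>\<phi>. proj1 (s *\<^sub>R x) < proj1 z))"
proof -
  let ?h = "proj1 (s *\<^sub>R x)"
  note eq = vec_eq_if_proj1_eq[OF d]
  have I: "cross_section g s x = {s *\<^sub>R x}"
  proof (intro equalityI subsetI)
    fix v assume "v \<in> cross_section g s x"
    then have "proj1 v = ?h" unfolding cross_section_def by blast
    then show "v \<in> {s *\<^sub>R x}" using eq by blast
  qed (use g in \<open>simp add: cross_section_def\<close>)
  have ne: "proj1 y \<noteq> ?h" if "y \<in> \<phi>" for y using eq[of y "s *\<^sub>R x"] x that by blast
  have cross: "y \<in> crossing_points g s x \<phi> \<longleftrightarrow> y \<in> \<phi> \<and> proj1 y < ?h \<and> ?h < proj1 (dst_nav y \<phi>)" for y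
  proof (cases "y \<in> \<phi> \<and> points_ahead y \<phi> \<noteq> {}")
    case True
    then have y: "y \<in> \<phi>" and ahead: "points_ahead y \<phi> \<noteq> {}" by auto
    let ?z = "dst_nav y \<phi>"
    note nav = dst_nav_ahead[OF fin ahead]
    \<comment> \<open>On the line the section is a single point whatever its radius, so the crossing
      criterion can be used with radius \<open>0\<close>.\<close>
    have 0: "cball (s *\<^sub>R x) 0 \<inter> {w. proj1 w = ?h} = {s *\<^sub>R x}" by auto
    have "y \<in> crossing_points g s x \<phi> \<longleftrightarrow> (y, ?z) \<in> edges_meeting {s *\<^sub>R x}"
      using y nav(2) by (simp add: crossing_points_def I edges_meeting_def)
    also have "\<dots> \<longleftrightarrow> proj1 y \<le> ?h \<and> ?h \<le> proj1 ?z \<and>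
        dist (s *\<^sub>R x) (y + ((?h - proj1 y) / (proj1 ?z - proj1 y)) *\<^sub>R (?z - y)) \<le> 0"
      using edges_meeting_cross_section[of y ?z "s *\<^sub>R x" 0, unfolded 0] nav(2) by simp
    also have "\<dots> \<longleftrightarrow> proj1 y \<le> ?h \<and> ?h \<le> proj1 ?z"
    proof -
      have "y + ((?h - proj1 y) / (proj1 ?z - proj1 y)) *\<^sub>R (?z - y) = s *\<^sub>R x"
        by (rule eq) (use nav(2) in simp)
      then show ?thesis by (simp only: dist_self order_refl simp_thms)
    qed
    finally have "y \<in> crossing_points g s x \<phi> \<longleftrightarrow> proj1 y \<le> ?h \<and> ?h \<le> proj1 ?z" .
    moreover have "proj1 y \<noteq> ?h" "proj1 ?z \<noteq> ?h" using ne[OF y] ne[OF nav(1)] .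
    ultimately show ?thesis using y by linarith
  next
    case False
    then show ?thesis
    proof (cases "y \<in> \<phi>")
      case True
      \<comment> \<open>By the convention for points with nothing ahead the segment degenerates to
        \<open>y\<close>, which differs from \<open>s x\<close>.\<close>
      then have "dst_nav y \<phi> = y" using False by (simp add: dst_nav_def)
      then show ?thesis using x True by (auto simp: crossing_points_def I)
    qed (simp add: crossing_points_def)
  qed
  show ?thesis
  proof (cases "(\<exists>y\<in>\<phi>. proj1 y < ?h) \<and> (\<exists>z\<in>\<phi>. ?h < proj1 z)")
    case True
    let ?L = "{y \<in> \<phi>. proj1 y < ?h}"
    have L: "finite ?L" "?L \<noteq> {}" using fin True by auto
    have "Max (proj1 ` ?L) \<in> proj1 ` ?L" using L by (intro Max_in) auto
    then obtain y where y0: "y \<in> ?L" "proj1 y = Max (proj1 ` ?L)" by auto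
    have y: "y \<in> ?L" "\<And>w. w \<in> ?L \<Longrightarrow> proj1 w \<le> proj1 y"
      using y0 L(1) by auto
    obtain z where "z \<in> \<phi>" "?h < proj1 z" using True by blast
    then have "z \<in> points_ahead y \<phi>" using y(1) by (simp add: points_ahead_def del: proj1_scaleR)
    then have ahead: "points_ahead y \<phi> \<noteq> {}" by blast
    note nav = dst_nav_ahead[OF fin ahead]
    have "?h < proj1 (dst_nav y \<phi>)"
    proof -
      have "\<not> proj1 (dst_nav y \<phi>) < ?h"
        using y(2)[of "dst_nav y \<phi>"] nav(1,2) by (auto simp del: proj1_scaleR)
      then show ?thesis using ne[OF nav(1)] by linarith
    qed
    then have "y \<in> crossing_points g s x \<phi>" using y(1) cross by auto
    moreover have "w = y" if w: "w \<in> crossing_points g s x \<phi>" for w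
    proof (rule ccontr)
      assume "w \<noteq> y"
      have w': "w \<in> \<phi>" "proj1 w < ?h" "?h < proj1 (dst_nav w \<phi>)" using w cross by auto
      then have "proj1 w \<le> proj1 y" by (intro y(2)) simp
      moreover have "proj1 w \<noteq> proj1 y" using eq[of w y] \<open>w \<noteq> y\<close> by blast
      ultimately have less: "proj1 w < proj1 y" by simp
      have "points_ahead w \<phi> \<noteq> {}" using y(1) less by (auto simp: points_ahead_def)
      from dst_nav_ahead(3)[OF fin this] have "y \<notin> preferred w (dst_nav w \<phi>)" using y(1) by auto
      then have le: "dist w (dst_nav w \<phi>) \<le> dist w y" using less by (auto simp: preferred_def)
      \<comment> \<open>The step from \<open>w\<close> to \<open>y\<close> is a fraction below
        \<open>1\<close> of the jump made by \<open>w\<close>, so \<open>y\<close> would have been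
        the nearer choice.\<close>
      have "y - w = ((proj1 y - proj1 w) / (proj1 (dst_nav w \<phi>) - proj1 w)) *\<^sub>R (dst_nav w \<phi> - w)"
        by (rule eq) (use w'(2,3) in simp)
      then have "norm (y - w) = \<bar>(proj1 y - proj1 w) / (proj1 (dst_nav w \<phi>) - proj1 w)\<bar> * norm (dst_nav w \<phi> - w)"
        by (metis norm_scaleR)
      moreover have "\<bar>(proj1 y - proj1 w) / (proj1 (dst_nav w \<phi>) - proj1 w)\<bar> < 1"
        using less y(1) w'(3) by (simp add: divide_less_eq)
      moreover have "0 < norm (dst_nav w \<phi> - w)" using w'(2,3) by auto
      ultimately have "norm (y - w) < 1 * norm (dst_nav w \<phi> - w)"
        by (simp only:) (rule mult_strict_right_mono)
      then have "norm (y - w) < norm (dst_nav w \<phi> - w)" by simp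
      then show False using le by (simp add: dist_norm norm_minus_commute)
    qed
    ultimately have "crossing_points g s x \<phi> = {y}" by blast
    then show ?thesis using True by (simp del: proj1_scaleR)
  next
    case False
    have "crossing_points g s x \<phi> = {}"
    proof (rule ccontr)
      assume "crossing_points g s x \<phi> \<noteq> {}"
      then obtain y where y: "y \<in> \<phi>" "proj1 y < ?h" "?h < proj1 (dst_nav y \<phi>)" using cross by auto
      then have "points_ahead y \<phi> \<noteq> {}" by (auto simp: dst_nav_def)
      then have "dst_nav y \<phi> \<in> \<phi>" by (rule dst_nav_ahead(1)[OF fin])
      then show False using False y by blast
    qed
    then show ?thesis using False by (simp del: proj1_scaleR)
  qed
qed

context bounded_poisson_process
begin

lemma prob_both_nonempty:
  assumes A: "A \<in> sets borel" and B: "B \<in> sets borel" and AB: "A \<inter> B = {}"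
  shows "prob {\<omega> \<in> space M. X \<omega> \<inter> A \<noteq> {} \<and> X \<omega> \<inter> B \<noteq> {}} =
    (1 - exp (- measure intensity A)) * (1 - exp (- measure intensity B))"
proof -
  let ?V = "\<lambda>B. {\<omega> \<in> space M. X \<omega> \<inter> B = {}}"
  have "{\<omega> \<in> space M. X \<omega> \<inter> A \<noteq> {} \<and> X \<omega> \<inter> B \<noteq> {}} = space M - (?V A \<union> ?V B)" by auto
  then have "prob {\<omega> \<in> space M. X \<omega> \<inter> A \<noteq> {} \<and> X \<omega> \<inter> B \<noteq> {}} = 1 - prob (?V A \<union> ?V B)"
    by (simp only: prob_compl sets.Un sets_void A B)
  also have "prob (?V A \<union> ?V B) = prob (?V A) + prob (?V B) - prob (?V A \<inter> ?V B)"
    by (intro measure_Un3) (simp_all add: fmeasurable_eq_sets sets_void A B)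
  also have "?V A \<inter> ?V B = ?V (A \<union> B)" by auto
  also have "measure intensity (A \<union> B) = measure intensity A + measure intensity B"
    using A B AB by (intro intensity.finite_measure_Union) auto
  then have "prob (?V (A \<union> B)) = exp (- measure intensity A) * exp (- measure intensity B)"
    using A B by (simp add: prob_void exp_add[symmetric])
  finally show ?thesis using A B by (simp add: prob_void algebra_simps)
qed

end

lemma nn_integral_pos_if_open:
  fixes f :: "'a::euclidean_space \<Rightarrow> ennreal"
  assumes f: "f \<in> borel_measurable borel" and S: "open S" "S \<noteq> {}" and pos: "\<And>y. y \<in> S \<Longrightarrow> 0 < f y"
  shows "0 < (\<integral>\<^sup>+ y. f y \<partial>lborel)"
proof (rule ccontr)
  assume "\<not> 0 < (\<integral>\<^sup>+ y. f y \<partial>lborel)"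
  then have "AE y in lborel. f y = 0" using f nn_integral_0_iff_AE[of f lborel] by simp
  moreover obtain y where "y \<in> S" using S(2) by blast
  then obtain r where "0 < r" "ball y r \<subseteq> S" using S(1) by (meson openE)
  ultimately have "AE v in lborel. v \<notin> ball y r"
  proof (elim eventually_mono)
    fix v assume "ball y r \<subseteq> S" "f v = 0"
    then show "v \<notin> ball y r" using pos[of v] by auto
  qed
  then have "ball y r \<in> null_sets lborel" by (simp add: AE_iff_null_sets)
  then have "measure lborel (ball y r) = 0" by (simp add: null_setsD1 measure_def)
  then show False using content_ball_pos[OF \<open>0 < r\<close>, of y] by simp
qed

lemma nn_integral_lborel_scale:
  fixes h :: "'a::euclidean_space \<Rightarrow> ennreal"
  assumes "h \<in> borel_measurable borel" "0 < s"
  shows "(\<integral>\<^sup>+ y. h y \<partial>lborel) = ennreal (s ^ DIM('a)) * (\<integral>\<^sup>+ y. h (s *\<^sub>R y) \<partial>lborel)"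
proof -
  have "(\<integral>\<^sup>+ y. h y \<partial>lborel) =
      (\<integral>\<^sup>+ y. h y \<partial>density (distr lborel borel (\<lambda>x. 0 + s *\<^sub>R x)) (\<lambda>_. ennreal (\<bar>s\<bar> ^ DIM('a))))"
    by (rule arg_cong[where f="\<lambda>M. nn_integral M h"]) (rule lborel_affine, use assms in simp)
  also have "\<dots> = (\<integral>\<^sup>+ y. ennreal (\<bar>s\<bar> ^ DIM('a)) * h (s *\<^sub>R y) \<partial>lborel)"
    using assms by (simp add: nn_integral_density nn_integral_distr)
  also have "\<dots> = ennreal (s ^ DIM('a)) * (\<integral>\<^sup>+ y. h (s *\<^sub>R y) \<partial>lborel)"
    using assms by (subst nn_integral_cmult) auto
  finally show ?thesis .
qed

text \<open>The mean is the probability that both sides of \<open>s x\<close> are occupied. It is a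
  product of two explicit factors, each tending to \<open>1\<close> or identically \<open>0\<close>
  according to whether its side of \<open>x\<close> carries mass.\<close>

lemma crossing_intensity_limit_line:
  fixes D :: "(real ^ 'd::{finite,linorder}) set" and lam :: "(real, 'd) vec \<Rightarrow> real"
    and M :: "real \<Rightarrow> 'w measure" and X :: "real \<Rightarrow> 'w \<Rightarrow> ((real, 'd) vec) set"
  assumes D: "open D" "bounded D" and lam: "continuous_on D lam"
    and pp: "\<And>s. 1 \<le> s \<Longrightarrow> poisson_process (M s) ((\<lambda>x. s *\<^sub>R x) ` D) (\<lambda>y. lam (y /\<^sub>R s)) (X s)"
    and x: "x \<in> D" and d: "CARD('d) = 1"
  shows "\<exists>l. 0 \<le> l \<and> (0 < lam x \<longrightarrow> 0 < l) \<and>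
    (crossing_ratio M X \<xi> x \<longlongrightarrow> l) at_top"
proof -
  let ?g = "\<lambda>s. s powr \<xi>"
  define A where "A = {w :: (real, 'd) vec. proj1 w < proj1 x}"
  define B where "B = {w :: (real, 'd) vec. proj1 x < proj1 w}"
  define \<Lambda> where "\<Lambda> S = (\<integral>\<^sup>+ y. ennreal (lam y) * indicator D y * indicator S y \<partial>lborel)" for S
  define m where "m S = enn2real (\<Lambda> S)" for S
  have AB: "A \<in> sets borel" "B \<in> sets borel" "open A" "open B"
    unfolding A_def B_def by (auto intro!: borel_open open_Collect_less continuous_intros)
  have dens: "(\<lambda>y. ennreal (lam y) * indicator D y) \<in> borel_measurable borel"
  proof -
    have "cartesian_poisson_process (M 1) ((\<lambda>x. 1 *\<^sub>R x) ` D) (\<lambda>y. lam (y /\<^sub>R 1)) (X 1)"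
      by (intro cartesian_poisson_process_scaled D lam pp) auto
    then show ?thesis by (simp add: cartesian_poisson_process_def bounded_poisson_process_def)
  qed
  \<comment> \<open>Lebesgue measure on the line scales by \<open>s\<close>, so the masses to the
    left and right of \<open>s x\<close> are \<open>s\<close> times masses that do not depend on
    \<open>s\<close>.\<close>
  have scale: "emeasure (bounded_poisson_process.intensity ((\<lambda>x. s *\<^sub>R x) ` D) (\<lambda>y. lam (y /\<^sub>R s))) {w. w /\<^sub>R s \<in> S} =
      ennreal s * \<Lambda> S"
    if s: "1 \<le> s" and S: "S \<in> sets borel" for s S
  proof -
    interpret cartesian_poisson_process "M s" "(\<lambda>x. s *\<^sub>R x) ` D" "\<lambda>y. lam (y /\<^sub>R s)" "X s"
      using s by (intro cartesian_poisson_process_scaled D lam pp) auto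
    let ?S = "{w. w /\<^sub>R s \<in> S}"
    have "(\<lambda>w :: (real, 'd) vec. w /\<^sub>R s) \<in> borel_measurable borel" by measurable
    from measurable_sets[OF this S] have S': "?S \<in> sets borel" by (simp add: vimage_def)
    have "emeasure intensity ?S = (\<integral>\<^sup>+ y. indicator ?S y \<partial>intensity)" using S' by simp
    also have "\<dots> = (\<integral>\<^sup>+ y. ennreal (lam (y /\<^sub>R s)) * indicator ((\<lambda>x. s *\<^sub>R x) ` D) y * indicator ?S y \<partial>lborel)"
      using S' by (intro nn_integral_intensity) simp
    also have "\<dots> = ennreal (s ^ DIM((real, 'd) vec)) * (\<integral>\<^sup>+ y. ennreal (lam ((s *\<^sub>R y) /\<^sub>R s)) *
        indicator ((\<lambda>x. s *\<^sub>R x) ` D) (s *\<^sub>R y) * indicator ?S (s *\<^sub>R y) \<partial>lborel)"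
      using density_borel S' s by (intro nn_integral_lborel_scale borel_measurable_times) auto
    also have "DIM((real, 'd) vec) = 1" using d by simp
    also have "(\<integral>\<^sup>+ y. ennreal (lam ((s *\<^sub>R y) /\<^sub>R s)) *
        indicator ((\<lambda>x. s *\<^sub>R x) ` D) (s *\<^sub>R y) * indicator ?S (s *\<^sub>R y) \<partial>lborel) = \<Lambda> S"
      unfolding \<Lambda>_def using s by (intro nn_integral_cong) (auto simp: indicator_def)
    finally show ?thesis by simp
  qed
  have m: "\<Lambda> S = ennreal (m S)" if "S \<in> sets borel" for S
  proof -
    interpret cartesian_poisson_process "M 1" "(\<lambda>x. 1 *\<^sub>R x) ` D" "\<lambda>y. lam (y /\<^sub>R 1)" "X 1"
      by (intro cartesian_poisson_process_scaled D lam pp) auto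
    have "emeasure intensity S = \<Lambda> S" using scale[OF order_refl that] by simp
    then have "\<Lambda> S < \<top>" using emeasure_intensity_finite[OF that] by simp
    then show ?thesis by (simp add: m_def)
  qed
  have m0: "0 \<le> m S" for S by (simp add: m_def)
  have EN: "prob_space.expectation (M s) (\<lambda>\<omega>. real (card (crossing_points ?g s x (X s \<omega>)))) =
      (1 - exp (- s * m A)) * (1 - exp (- s * m B))" if s: "1 \<le> s" for s
  proof -
    interpret cartesian_poisson_process "M s" "(\<lambda>x. s *\<^sub>R x) ` D" "\<lambda>y. lam (y /\<^sub>R s)" "X s"
      using s by (intro cartesian_poisson_process_scaled D lam pp) auto
    let ?A = "{w. w /\<^sub>R s \<in> A}" and ?B = "{w. w /\<^sub>R s \<in> B}"
    have "proj1 (w /\<^sub>R s) < proj1 x \<longleftrightarrow> proj1 w < s * proj1 x"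
      "proj1 x < proj1 (w /\<^sub>R s) \<longleftrightarrow> s * proj1 x < proj1 w" for w :: "(real, 'd) vec"
      using s by (simp_all add: field_simps)
    then have A: "?A = {w. proj1 w < proj1 (s *\<^sub>R x)}" and B: "?B = {w. proj1 (s *\<^sub>R x) < proj1 w}"
      by (simp_all add: A_def B_def)
    have sets: "?A \<in> sets borel" "?B \<in> sets borel" unfolding A B by measurable
    have meas: "measure intensity ?A = s * m A" "measure intensity ?B = s * m B"
      unfolding measure_def scale[OF s AB(1)] scale[OF s AB(2)] m[OF AB(1)] m[OF AB(2)]
      using s m0 by (simp_all add: enn2real_mult)
    let ?G = "{\<omega> \<in> space (M s). X s \<omega> \<inter> ?A \<noteq> {} \<and> X s \<omega> \<inter> ?B \<noteq> {}}"
    have "?G = (space (M s) - {\<omega> \<in> space (M s). X s \<omega> \<inter> ?A = {}}) - {\<omega> \<in> space (M s). X s \<omega> \<inter> ?B = {}}" by blast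
    then have G: "?G \<in> sets (M s)"
      by (simp only: sets.Diff sets.top sets_void sets)
    \<comment> \<open>\<open>card_crossing_points_line\<close> requires that \<open>s x\<close>
      itself is not a point of the process.\<close>
    have "{s *\<^sub>R x} \<in> null_sets lborel" by (rule countable_imp_null_set_lborel) simp
    from AE_avoids_null[OF this]
    have "AE \<omega> in M s. ennreal (real (card (crossing_points ?g s x (X s \<omega>)))) = indicator ?G \<omega>"
    proof (rule AE_mp, intro AE_I2 impI)
      fix \<omega> assume w: "\<omega> \<in> space (M s)" "X s \<omega> \<inter> {s *\<^sub>R x} = {}"
      have "\<omega> \<in> ?G \<longleftrightarrow> (\<exists>y\<in>X s \<omega>. proj1 y < proj1 (s *\<^sub>R x)) \<and> (\<exists>z\<in>X s \<omega>. proj1 (s *\<^sub>R x) < proj1 z)"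
        using w(1) unfolding A B by blast
      moreover have "s *\<^sub>R x \<notin> X s \<omega>" using w(2) by blast
      ultimately have "card (crossing_points ?g s x (X s \<omega>)) = of_bool (\<omega> \<in> ?G)"
        using card_crossing_points_line[OF d _ finite_X[OF w(1)], of ?g s x] by simp
      then show "ennreal (real (card (crossing_points ?g s x (X s \<omega>)))) = indicator ?G \<omega>"
        by (simp add: indicator_def)
    qed
    then have "(\<integral>\<^sup>+ \<omega>. ennreal (real (card (crossing_points ?g s x (X s \<omega>)))) \<partial>M s) = (\<integral>\<^sup>+ \<omega>. indicator ?G \<omega> \<partial>M s)"
      by (rule nn_integral_cong_AE)
    also have "\<dots> = emeasure (M s) ?G" using G by (rule nn_integral_indicator)
    finally have "expectation (\<lambda>\<omega>. real (card (crossing_points ?g s x (X s \<omega>)))) = prob ?G"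
      unfolding expectation_crossing_points by (simp add: measure_def)
    also have "\<dots> = (1 - exp (- measure intensity ?A)) * (1 - exp (- measure intensity ?B))"
      by (rule prob_both_nonempty[OF sets]) (auto simp: A B)
    finally show ?thesis unfolding meas by simp
  qed
  \<comment> \<open>A side without mass stays empty almost surely, and the limit is then
    \<open>0\<close>.\<close>
  have lim: "((\<lambda>s. 1 - exp (- s * c)) \<longlongrightarrow> of_bool (0 < c)) at_top" if "0 \<le> c" for c :: real
  proof (cases "c = 0")
    case False
    then have "0 < c" using that by simp
    then have "((\<lambda>s. 1 - exp (- s * c)) \<longlongrightarrow> 1) at_top" by real_asymp
    then show ?thesis using \<open>0 < c\<close> by simp
  qed simp
  define l where "l = inverse (section_const TYPE('d)) * (of_bool (0 < m A) * of_bool (0 < m B))"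
  have "((\<lambda>s. inverse (section_const TYPE('d)) * ((1 - exp (- s * m A)) * (1 - exp (- s * m B)))) \<longlongrightarrow> l) at_top"
    unfolding l_def by (intro tendsto_mult tendsto_const lim m0)
  moreover have "eventually (\<lambda>s. inverse (section_const TYPE('d)) * ((1 - exp (- s * m A)) * (1 - exp (- s * m B))) =
      crossing_ratio M X \<xi> x s) at_top"
    using eventually_ge_at_top[of "1 :: real"]
  proof eventually_elim
    case (elim s)
    then show ?case using EN[OF elim] hausdorff_measure_cross_section[of ?g s x] d by simp
  qed
  ultimately have "(crossing_ratio M X \<xi> x \<longlongrightarrow> l) at_top"
    by (rule Lim_transform_eventually)
  moreover have "0 \<le> l" using section_const_pos[where 'd='d] by (simp add: l_def)
  moreover have "0 < l" if pos: "0 < lam x"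
  proof -
    have "isCont lam x" using lam D(1) x by (simp add: continuous_on_eq_continuous_at)
    then obtain \<rho>1 where \<rho>1: "0 < \<rho>1" "\<And>y. dist y x < \<rho>1 \<Longrightarrow> dist (lam y) (lam x) < lam x"
      using pos unfolding continuous_at by (auto simp: tendsto_iff eventually_at) (metis dist_self)
    obtain \<rho>2 where \<rho>2: "0 < \<rho>2" "ball x \<rho>2 \<subseteq> D" using D(1) x by (meson openE)
    define \<rho> where "\<rho> = min \<rho>1 \<rho>2"
    have \<rho>: "0 < \<rho>" using \<rho>1(1) \<rho>2(1) by (simp add: \<rho>_def)
    have near: "y \<in> D \<and> 0 < lam y" if "y \<in> ball x \<rho>" for y
      using that \<rho>1(2)[of y] \<rho>2(2) by (auto simp: \<rho>_def dist_commute dist_real_def subset_iff)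
    \<comment> \<open>Near \<open>x\<close> the intensity is positive, and every ball around
      \<open>x\<close> reaches to both sides of it, so neither side is without mass.\<close>
    have pos_m: "0 < m S" if S: "open S" and ne: "ball x \<rho> \<inter> S \<noteq> {}" for S
    proof -
      have "0 < \<Lambda> S" unfolding \<Lambda>_def
      proof (rule nn_integral_pos_if_open)
        show "(\<lambda>y. ennreal (lam y) * indicator D y * indicator S y) \<in> borel_measurable borel"
          by (rule borel_measurable_times_ennreal[OF dens]) (use S in simp)
        show "open (ball x \<rho> \<inter> S)" using S by auto
        show "0 < ennreal (lam y) * indicator D y * indicator S y" if "y \<in> ball x \<rho> \<inter> S" for y
          using near[of y] that by simp
      qed (rule ne)
      then show ?thesis using m[of S] S by simp
    qed
    have p: "proj1 (first_axis :: (real, 'd) vec) = 1" by (simp add: proj1_def)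
    have "x - (\<rho> / 2) *\<^sub>R first_axis \<in> ball x \<rho> \<inter> A" "x + (\<rho> / 2) *\<^sub>R first_axis \<in> ball x \<rho> \<inter> B"
      using \<rho> by (simp_all add: A_def B_def dist_norm norm_axis_1 p)
    then have "ball x \<rho> \<inter> A \<noteq> {}" "ball x \<rho> \<inter> B \<noteq> {}" by blast+
    then have "0 < m A" "0 < m B" by (intro pos_m AB; simp)+
    then show ?thesis using section_const_pos[where 'd='d] by (simp add: l_def)
  qed
  ultimately show ?thesis by blast
qed

theorem proposition5:
  fixes D :: "(real ^ 'd::{finite,linorder}) set"
    and lam :: "real ^ 'd::{finite,linorder} \<Rightarrow> real"
    and M :: "real \<Rightarrow> 'w measure"
    and X :: "real \<Rightarrow> 'w \<Rightarrow> (real ^ 'd::{finite,linorder}) set"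
    and \<xi> :: real
  assumes "open D" and "bounded D" and "convex D"
    and "\<And>x. x \<in> D \<Longrightarrow> 0 \<le> lam x"
    and "continuous_on D lam"
    and "bounded (lam ` D)"
    and "\<And>x. x \<in> D \<Longrightarrow> \<exists>u>0. \<exists>L. L-lipschitz_on (cball x u \<inter> D) lam"
    and "\<And>s. 1 \<le> s \<Longrightarrow>
           poisson_process (M s) ((\<lambda>x. s *\<^sub>R x) ` D) (\<lambda>y. lam (y /\<^sub>R s)) (X s)"
    and "0 < \<xi>" and "\<xi> < 1"
  shows "\<exists>lamA :: real ^ 'd::{finite,linorder} \<Rightarrow> real. \<forall>x\<in>D.
           0 \<le> lamA x \<and> (0 < lam x \<longrightarrow> 0 < lamA x) \<and>
           ((\<lambda>s. inverse (enn2real (hausdorff_measure (CARD('d) - 1)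
                               (cross_section (\<lambda>s. s powr \<xi>) s x)))
                 * prob_space.expectation (M s)
                     (\<lambda>\<omega>. real (card (crossing_points (\<lambda>s. s powr \<xi>) s x (X s \<omega>)))))
            \<longlongrightarrow> lamA x) at_top"
proof (intro bchoice ballI)
  fix x assume x: "x \<in> D"
  show "\<exists>l. 0 \<le> l \<and> (0 < lam x \<longrightarrow> 0 < l) \<and>
    (crossing_ratio M X \<xi> x \<longlongrightarrow> l) at_top"
  proof (cases "CARD('d) = 1")
    case True
    then show ?thesis by (intro crossing_intensity_limit_line[OF assms(1,2,5,8) x])
  next
    case False
    have "0 < CARD('d)" by simp
    then have "2 \<le> CARD('d)" using False by linarith
    then show ?thesis by (intro crossing_intensity_limit[OF assms(1,2,4,5,8,9,10) x])
  qed
qed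

end
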